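(* Let $N = N_{\underline\mu,P} = \Gamma_{\underline\mu,P}\backslash(\mathbb{C}^{2n}\ltimes_\rho\mathbb{C}^{2m})$ be as constructed in the context, with the complex structure for which $\{\varphi^i,\psi^j\}$ is a coframe of $(1,0)$-forms. Then the Dolbeault cohomology of $N$ satisfies $H^*_{\bar\partial}(N)\simeq B^{*,*}$ (isomorphism of bigraded vector spaces), where $B^{*,*}$ is the bigraded space of forms on $N$ defined in the context.
   Context: Construction. Let $n,m\ge1$ and let $M\in\mathrm{SL}(2m,\mathbb{Z})$ be a matrix for which there exist $P\in \mathrm{GL}(2m,\mathbb{R})$ and a real number $\lambda\neq 0$ with $PMP^{-1} = \mathrm{diag}(e^{\lambda},e^{-\lambda},\dots,e^{\lambda},e^{-\lambda})$. Denote coordinates of $\mathbb{C}^{2n}$ by $w=(w_1,\dots,w_{2n})$ and of $\mathbb{C}^{2m}$ by $z=(z_1,\dots,z_{2m})$. Put $a(w) = w_1+\bar w_2+\cdots+w_{2n-1}+\bar w_{2n}$, and define $\rho:\mathbb{C}^{2n}\to \mathrm{GL}(2m,\mathbb{C})$ by $\rho(w) = \mathrm{diag}(e^{\lambda a(w)}, e^{-\lambda\overline{a(w)}},\dots,e^{\lambda a(w)},e^{-\lambda\overline{a(w)}})$. $\mathbb{C}^{2n}\ltimes_\rho\mathbb{C}^{2m}$ has product $(w',z')*(w,z) = (w'+w,\rho(w')z+z')$. Let $\underline\mu = \mathrm{diag}(\mu_1,\dots,\mu_{2n})$ with $\mu_i = \frac{2k_i\pi}{\lambda}$, $k_i\in\mathbb{Z}\setminus\{0\}$,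 and put $\Gamma'_{\underline\mu} = \mathbb{Z}^{2n}\oplus\sqrt{-1}\,\underline\mu\mathbb{Z}^{2n}$, $\Gamma''_P = P\mathbb{Z}^{2m}\oplus\sqrt{-1}\,P\mathbb{Z}^{2m}$. Then $\Gamma_{\underline\mu,P} = \Gamma'_{\underline\mu}\ltimes_\rho\Gamma''_P$ is a lattice in $\mathbb{C}^{2n}\ltimes_\rho\mathbb{C}^{2m}$. The forms $\varphi^i = dw_i$ ($i=1,\dots,2n$), $\psi^{2j+1} = e^{-\lambda a(w)}dz_{2j+1}$, $\psi^{2j+2} = e^{\lambda\overline{a(w)}}dz_{2j+2}$ ($j=0,\dots,m-1$) descend to $N$ and, taken as a coframe of $(1,0)$-forms, define an (integrable) complex structure on $N$. For $j,l\in\{1,\dots,2m\}$ let $\beta_j = e^{-\lambda(w_2-\bar w_2+w_4-\bar w_4+\cdots+w_{2n}-\bar w_{2n})}$ if $j$ is odd, $\beta_j = e^{\lambda(w_1-\bar w_1+w_3-\bar w_3+\cdots+w_{2n-1}-\bar w_{2n-1})}$ if $j$ is even; $\gamma_l = e^{-\lambda(w_1-\bar w_1+w_3-\bar w_3+\cdots+w_{2n-1}-\bar w_{2n-1})}$ if $l$ is odd, $\gamma_l = e^{\lambda(w_2-\bar w_2+w_4-\bar w_4+\cdots+w_{2n}-\bar w_{2n})}$ if $l$ is even. These functions are trivial on $\Gamma_{\underline\mu,P}$ and descend to $N$. For multiindices $J,L\subset\{1,\dots,2m\}$ put $\beta_J = \prod_{j\in J}\beta_j$, $\gamma_L = \prod_{l\in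 L}\gamma_l$. Define $$B^{p,q} = \mathbb{C}\left\langle \beta_J\gamma_L\,\varphi^I\wedge\psi^J\wedge\bar\varphi^K\wedge\bar\psi^L\ :\ |I|+|J| = p,\ |K|+|L| = q\right\rangle,$$ with $I,K\subset\{1,\dots,2n\}$, $J,L\subset\{1,\dots,2m\}$, and $B^{*,*} = \bigoplus_{p,q}B^{p,q}$. Also $H^*_{\bar\partial}(N) = \bigoplus_{p,q}H^{p,q}_{\bar\partial}(N)$. *)

theory Defs
  imports "HOL-Analysis.Analysis" "HOL-Library.Function_Algebras" "HOL-Library.Set_Algebras"
begin

text \<open>
  The index set \<open>{1,\<dots>,2n}\<close> is represented by the type \<^typ>\<open>'n::finite \<times> bool\<close>,
  where \<open>n = CARD('n)\<close>: the pairs \<open>(j, True)\<close> are the odd indices \<open>2j+1\<close> and the pairs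
  \<open>(j, False)\<close> the even indices \<open>2j+2\<close>, for \<open>0 \<le> j < n\<close>. Similarly for \<open>{1,\<dots>,2m}\<close>
  and \<open>m = CARD('m)\<close>.
\<close>

abbreviation odd_index :: "'i \<times> bool \<Rightarrow> bool" where "odd_index \<equiv> snd"

type_synonym ('n, 'm) grp = "(complex ^ ('n \<times> bool)) \<times> (complex ^ ('m \<times> bool))"


section \<open>The group, the lattice\<close>

definition diagonal :: "('i \<Rightarrow> 'a::zero) \<Rightarrow> 'a ^ 'i ^ 'i"
  where "diagonal d = (\<chi> i j. if i = j then d i else 0)"

definition a_fun :: "complex ^ ('n::finite \<times> bool) \<Rightarrow> complex"
  where "a_fun w = (\<Sum>i\<in>UNIV. if odd_index i then w $ i else cnj (w $ i))"

definition rho :: "real \<Rightarrow> complex ^ ('n::finite \<times> bool) \<Rightarrow>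
    complex ^ ('m::finite \<times> bool) ^ ('m \<times> bool)"
  where "rho lam w = diagonal (\<lambda>j. if odd_index j then exp (of_real lam * a_fun w)
                                     else exp (- of_real lam * cnj (a_fun w)))"

definition gmult :: "real \<Rightarrow> ('n::finite, 'm::finite) grp \<Rightarrow> ('n, 'm) grp \<Rightarrow> ('n, 'm) grp"
  where "gmult lam g h = (fst g + fst h, rho lam (fst g) *v snd h + snd g)"

definition Gamma_base :: "('n::finite \<times> bool \<Rightarrow> real) \<Rightarrow> (complex ^ ('n \<times> bool)) set"
  where "Gamma_base mu =
    {\<chi> i. of_int (a $ i) + \<i> * of_real (mu i) * of_int (b $ i) | a b :: int ^ ('n \<times> bool). True}"

definition Gamma_fibre ::
    "real ^ ('m::finite \<times> bool) ^ ('m \<times> bool) \<Rightarrow> (complex ^ ('m \<times> bool)) set"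
  where "Gamma_fibre P =
    {\<chi> j. of_real ((P *v (\<chi> k. of_int (a $ k))) $ j) +
          \<i> * of_real ((P *v (\<chi> k. of_int (b $ k))) $ j) | a b :: int ^ ('m \<times> bool). True}"

definition Gamma_lattice :: "('n::finite \<times> bool \<Rightarrow> real) \<Rightarrow>
    real ^ ('m::finite \<times> bool) ^ ('m \<times> bool) \<Rightarrow> ('n, 'm) grp set"
  where "Gamma_lattice mu P = Gamma_base mu \<times> Gamma_fibre P"


section \<open>Complex-valued differential forms\<close>

text \<open>
  A complex-valued \<open>k\<close>-form on a real normed space \<^typ>\<open>'v\<close> sends a point to an alternating
  real-multilinear map in \<open>k\<close> tangent vectors. The tangent vectors are passed as a list, and
  a \<open>k\<close>-form vanishes on lists whose length is not \<open>k\<close>.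
\<close>

type_synonym 'v covector = "'v list \<Rightarrow> complex"
type_synonym 'v form = "'v \<Rightarrow> 'v covector"

definition covector_scale :: "complex \<Rightarrow> 'v covector \<Rightarrow> 'v covector"
  where "covector_scale c \<alpha> = (\<lambda>vs. c * \<alpha> vs)"

definition form_scale :: "complex \<Rightarrow> 'v form \<Rightarrow> 'v form"
  where "form_scale c \<omega> = (\<lambda>x vs. c * \<omega> x vs)"

global_interpretation covector: vector_space covector_scale
  by unfold_locales (auto simp: covector_scale_def fun_eq_iff algebra_simps)

global_interpretation form: vector_space form_scale
  by unfold_locales (auto simp: form_scale_def fun_eq_iff algebra_simps)

text \<open>Exterior product of a list of 1-forms at a point, normalised as
  \<open>(\<alpha>\<^sub>1 \<and> \<dots> \<and> \<alpha>\<^sub>k)(v\<^sub>1,\<dots>,v\<^sub>k) = det (\<alpha>\<^sub>i(v\<^sub>j))\<close>.\<close>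

definition wedge :: "('v \<Rightarrow> complex) list \<Rightarrow> 'v covector"
  where "wedge as vs =
    (if length vs = length as
     then \<Sum>\<sigma> | \<sigma> permutes {..<length as}.
            of_int (sign \<sigma>) * (\<Prod>i<length as. (as ! i) (vs ! \<sigma> i))
     else 0)"

primrec C_k :: "nat \<Rightarrow> ('v::real_normed_vector \<Rightarrow> complex) \<Rightarrow> bool"
  where
    "C_k 0 f \<longleftrightarrow> continuous_on UNIV f"
  | "C_k (Suc k) f \<longleftrightarrow>
       f differentiable_on UNIV \<and> (\<forall>v. C_k k (\<lambda>x. frechet_derivative f (at x) v))"

definition smooth :: "('v::real_normed_vector \<Rightarrow> complex) \<Rightarrow> bool"
  where "smooth f \<longleftrightarrow> (\<forall>k. C_k k f)"

definition smooth_form :: "'v::real_normed_vector form \<Rightarrow> bool"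
  where "smooth_form \<omega> \<longleftrightarrow> (\<forall>vs. smooth (\<lambda>x. \<omega> x vs))"

definition pullback ::
    "('v::real_normed_vector \<Rightarrow> 'v) \<Rightarrow> 'v form \<Rightarrow> 'v form"
  where "pullback g \<omega> = (\<lambda>x vs. \<omega> (g x) (map (frechet_derivative g (at x)) vs))"

text \<open>The exterior derivative. Since the space is flat, the constant vector fields \<open>v\<^sub>i\<close>
  commute and the bracket terms of the invariant formula vanish.\<close>

definition ext_d :: "'v::real_normed_vector form \<Rightarrow> 'v form"
  where "ext_d \<omega> = (\<lambda>x vs. \<Sum>i<length vs.
    (-1) ^ i * frechet_derivative (\<lambda>y. \<omega> y (take i vs @ drop (Suc i) vs)) (at x) (vs ! i))"


section \<open>The coframe and the complex structure\<close>

definition phi :: "'n::finite \<times> bool \<Rightarrow> ('n, 'm::finite) grp \<Rightarrow> ('n, 'm) grp \<Rightarrow> complex"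
  where "phi i x v = fst v $ i"

definition psi ::
    "real \<Rightarrow> 'm::finite \<times> bool \<Rightarrow> ('n::finite, 'm) grp \<Rightarrow> ('n, 'm) grp \<Rightarrow> complex"
  where "psi lam j x v =
    (if odd_index j then exp (- of_real lam * a_fun (fst x))
     else exp (of_real lam * cnj (a_fun (fst x)))) * snd v $ j"

text \<open>A multi-index \<open>I \<subseteq> {1,\<dots>,2n}\<close> is given by a repetition-free list enumerating \<open>I\<close>; two
  enumerations of the same set change the form below by a sign only, which is immaterial
  as these forms are only used to span spaces.\<close>

definition coframe_form :: "real \<Rightarrow> ('n::finite \<times> bool) list \<Rightarrow> ('m::finite \<times> bool) list \<Rightarrow>
    ('n \<times> bool) list \<Rightarrow> ('m \<times> bool) list \<Rightarrow> ('n, 'm) grp form"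
  where "coframe_form lam I J K L = (\<lambda>x. wedge
    (map (\<lambda>i. phi i x) I @ map (\<lambda>j. psi lam j x) J @
     map (\<lambda>k v. cnj (phi k x v)) K @ map (\<lambda>l v. cnj (psi lam l x v)) L))"

definition multi_indices :: "nat \<Rightarrow> nat \<Rightarrow>
    (('n \<times> bool) list \<times> ('m \<times> bool) list \<times> ('n \<times> bool) list \<times> ('m \<times> bool) list) set"
  where "multi_indices p q =
    {(I, J, K, L). distinct I \<and> distinct J \<and> distinct K \<and> distinct L \<and>
       length I + length J = p \<and> length K + length L = q}"

text \<open>The covectors of bidegree \<open>(p,q)\<close> at \<open>x\<close>, for the complex structure whose
  \<open>(1,0)\<close>-forms are spanned by the \<^const>\<open>phi\<close> and \<^const>\<open>psi\<close>.\<close>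

definition bidegree_space ::
    "real \<Rightarrow> nat \<Rightarrow> nat \<Rightarrow> ('n::finite, 'm::finite) grp \<Rightarrow> ('n, 'm) grp covector set"
  where "bidegree_space lam p q x =
    covector.span {coframe_form lam I J K L x | I J K L. (I, J, K, L) \<in> multi_indices p q}"

text \<open>The description is unique when \<open>\<omega> x\<close> is an alternating \<open>k\<close>-covector, since the spaces
  \<^const>\<open>bidegree_space\<close> are linearly independent; it is applied to such forms only.\<close>

definition bidegree_part ::
    "real \<Rightarrow> nat \<Rightarrow> nat \<Rightarrow> ('n::finite, 'm::finite) grp form \<Rightarrow> ('n, 'm) grp form"
  where "bidegree_part lam p q \<omega> = (\<lambda>x. THE \<alpha>. \<alpha> \<in> bidegree_space lam p q x \<and>
    \<omega> x - \<alpha> \<in> covector.span (\<Union>(r, s)\<in>- {(p, q)}. bidegree_space lam r s x))"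


section \<open>Dolbeault cohomology of the quotient\<close>

text \<open>
  The projection of the group onto its quotient \<open>N\<close> by left translations by the lattice
  \<open>\<Gamma>\<close> is a covering. Pulling back along it identifies the smooth forms on \<open>N\<close> with the
  smooth forms on the group that are invariant under left translation by all elements of
  \<open>\<Gamma>\<close>, compatibly with the exterior derivative and bidegrees.
  All forms on \<open>N\<close> are given in this way.
\<close>

definition forms :: "real \<Rightarrow> ('n::finite, 'm::finite) grp set \<Rightarrow> nat \<Rightarrow> nat \<Rightarrow>
    ('n, 'm) grp form set"
  where "forms lam \<Gamma> p q =
    {\<omega>. smooth_form \<omega> \<and> (\<forall>x. \<omega> x \<in> bidegree_space lam p q x) \<and>
        (\<forall>\<gamma>\<in>\<Gamma>. pullback (gmult lam \<gamma>) \<omega> = \<omega>)}"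

text \<open>Meaningful on forms of bidegree \<open>(p,q)\<close>: the \<open>(p,q+1)\<close>-component of the exterior derivative.\<close>

definition dbar :: "real \<Rightarrow> nat \<Rightarrow> nat \<Rightarrow> ('n::finite, 'm::finite) grp form \<Rightarrow> ('n, 'm) grp form"
  where "dbar lam p q \<omega> = bidegree_part lam p (Suc q) (ext_d \<omega>)"

definition dbar_closed :: "real \<Rightarrow> ('n::finite, 'm::finite) grp set \<Rightarrow> nat \<Rightarrow> nat \<Rightarrow>
    ('n, 'm) grp form set"
  where "dbar_closed lam \<Gamma> p q = {\<omega> \<in> forms lam \<Gamma> p q. dbar lam p q \<omega> = 0}"

definition dbar_exact :: "real \<Rightarrow> ('n::finite, 'm::finite) grp set \<Rightarrow> nat \<Rightarrow> nat \<Rightarrow>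
    ('n, 'm) grp form set"
  where "dbar_exact lam \<Gamma> p q =
    (case q of 0 \<Rightarrow> {0} | Suc q' \<Rightarrow> dbar lam p q' ` forms lam \<Gamma> p q')"

definition dolbeault :: "real \<Rightarrow> ('n::finite, 'm::finite) grp set \<Rightarrow> nat \<Rightarrow> nat \<Rightarrow>
    ('n, 'm) grp form set set"
  where "dolbeault lam \<Gamma> p q =
    (\<lambda>\<omega>. \<omega> +o dbar_exact lam \<Gamma> p q) ` dbar_closed lam \<Gamma> p q"

text \<open>Cosets of \<open>U\<close> are added by the sum of sets from \<^theory>\<open>HOL-Library.Set_Algebras\<close>.
  In the scalar multiple, \<open>U\<close> is added so that \<open>c = 0\<close> gives the coset \<open>U\<close>, not \<open>{0}\<close>.\<close>

definition coset_scale :: "'v form set \<Rightarrow> complex \<Rightarrow> 'v form set \<Rightarrow> 'v form set"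
  where "coset_scale U c A = form_scale c ` A + U"

definition linear_iso :: "'a set \<Rightarrow> ('a \<Rightarrow> 'a \<Rightarrow> 'a) \<Rightarrow> (complex \<Rightarrow> 'a \<Rightarrow> 'a) \<Rightarrow>
    'b set \<Rightarrow> ('b \<Rightarrow> 'b \<Rightarrow> 'b) \<Rightarrow> (complex \<Rightarrow> 'b \<Rightarrow> 'b) \<Rightarrow> ('a \<Rightarrow> 'b) \<Rightarrow> bool"
  where "linear_iso V addV scaleV W addW scaleW f \<longleftrightarrow>
    bij_betw f V W \<and>
    (\<forall>x\<in>V. \<forall>y\<in>V. f (addV x y) = addW (f x) (f y)) \<and>
    (\<forall>c. \<forall>x\<in>V. f (scaleV c x) = scaleW c (f x))"


section \<open>The space \<open>B\<close>\<close>

definition w_diff :: "bool \<Rightarrow> complex ^ ('n::finite \<times> bool) \<Rightarrow> complex"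
  where "w_diff b w = (\<Sum>i | odd_index i = b. w $ i - cnj (w $ i))"

definition beta_fun :: "real \<Rightarrow> 'm::finite \<times> bool \<Rightarrow> ('n::finite, 'm) grp \<Rightarrow> complex"
  where "beta_fun lam j x = (if odd_index j then exp (- of_real lam * w_diff False (fst x))
                         else exp (of_real lam * w_diff True (fst x)))"

definition gamma_fun :: "real \<Rightarrow> 'm::finite \<times> bool \<Rightarrow> ('n::finite, 'm) grp \<Rightarrow> complex"
  where "gamma_fun lam l x = (if odd_index l then exp (- of_real lam * w_diff True (fst x))
                          else exp (of_real lam * w_diff False (fst x)))"

definition B_space :: "real \<Rightarrow> nat \<Rightarrow> nat \<Rightarrow> ('n::finite, 'm::finite) grp form set"
  where "B_space lam p q = form.span
    {\<lambda>x vs. (\<Prod>j\<in>set J. beta_fun lam j x) * (\<Prod>l\<in>set L. gamma_fun lam l x) *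
             coframe_form lam I J K L x vs | I J K L. (I, J, K, L) \<in> multi_indices p q}"

end

theory Submission
  imports Defs "Jordan_Normal_Form.Determinant"
begin

text \<open>
  Put \<open>s(w) = w\<^sub>1 + \<dots> + w\<^sub>2\<^sub>n\<close>. The forms \<open>\<beta>\<^sub>j \<psi>\<^sup>j\<close> and \<open>\<gamma>\<^sub>l \<psi>\<^sup>l\<close>-bar are \<open>exp (\<plusminus> \<lambda> s(w))\<close> times the
  differentials of \<open>z\<^sub>j\<close> and \<open>z\<^sub>l\<close>-bar, so they are closed for the Dolbeault operator. In terms of the
  coefficients, the Dolbeault complex of \<open>N\<close> is therefore the Koszul complex of the commuting operators
  \<open>\<partial>/\<partial>w\<^sub>k\<close>-bar and \<open>exp (\<plusminus> \<lambda> s(w)) \<partial>/\<partial>z\<^sub>l\<close>-bar on the smooth \<open>\<Gamma>\<close>-invariant functions, and \<open>B\<close> is the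
  subcomplex of constants. It has to be shown that the functions of mean zero do not contribute.

  Since \<open>P\<close> and the entries of \<open>\<mu>\<close> are real, fibre and base of \<open>N\<close> are products of elliptic curves, on each of
  which the Cauchy-Riemann operator has an explicit Green operator: a Fourier series in one direction and
  an ordinary differential equation in the other. Composing these with averages gives operators \<open>g\<^sub>s\<close>
  with \<open>\<Sum>\<^sub>s g\<^sub>s Z\<^sub>s = 1 - mean\<close> for the operators \<open>Z\<^sub>s\<close> of the Koszul complex; in the fibre directions they depend on
  a basis of the lattice, which \<open>M\<close> permutes, and have to be glued by a partition of unity in \<open>Re a(w)\<close>.
  All commutators of the \<open>g\<^sub>s\<close> and \<open>Z\<^sub>t\<close> vanish except for \<open>t\<close> in the base and \<open>s\<close> in the fibre, so that the
  contraction with the \<open>g\<^sub>s\<close> is a homotopy up to a nilpotent error.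
\<close>

text \<open>The obstacle is the monodromy. Left translation by a lattice element acts on the fibre
  by a power of M, so the Green operators of one basis of the fibre lattice do not preserve
  invariant functions; only a sum over all powers of M, with weights that shift along, does. These
  weights depend on w, and their derivatives cause the only surviving commutators. Such an error
  term trades a base index for a fibre index, so it sees the form on index sets with one base index
  fewer, and it is pushed out after finitely many levels. The base Green operators need no gluing
  but must follow the fibre average: an invariant function need not be periodic in the base
  directions, its fibre average is. One-dimensional Fourier inversion suffices because in the second
  direction of each elliptic curve a linear ODE is solved exactly; dividing mode n by n squared
  makes the kernel continuous, and the two derivatives spent are harmless for smooth functions. The
  choice of \<open>mu\<close> makes \<open>exp (lam a)\<close> and \<open>exp (lam s)\<close> agree
  on the lattice, with a common real value; hence the frame that makes up B is invariant.\<close>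

hide_const (open) Determinant.det Matrix.mat Matrix.row Matrix.col Matrix.vec Matrix.diagonal_mat
no_notation Matrix.vec_index (infixl \<open>$\<close> 100)

section \<open>Calculus of smooth functions\<close>

definition dd :: "'v::real_normed_vector \<Rightarrow> ('v \<Rightarrow> complex) \<Rightarrow> 'v \<Rightarrow> complex"
  where "dd v f x = frechet_derivative f (at x) v"

lemma dd_eqI: "(f has_derivative D) (at x) \<Longrightarrow> dd v f x = D v"
  unfolding dd_def by (metis frechet_derivative_at)

lemma C_k_Suc_dd: "C_k (Suc k) f \<longleftrightarrow> f differentiable_on UNIV \<and> (\<forall>v. C_k k (dd v f))"
  by (simp add: dd_def[abs_def])

text \<open>\<open>smooth\<close> is the largest class of differentiable functions that is closed
  under directional derivatives. Operators that commute with \<open>dd\<close>, such as integrals,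
  are treated by taking for \<open>P\<close> their whole image.\<close>

lemma smooth_coinduct:
  assumes "P f" "\<And>f. P f \<Longrightarrow> f differentiable_on UNIV" "\<And>f v. P f \<Longrightarrow> P (dd v f)"
  shows "smooth f"
proof -
  have "C_k k f" if "P f" for k f
    using that
  proof (induction k arbitrary: f)
    case 0
    then show ?case using assms(2) differentiable_imp_continuous_on by auto
  next
    case (Suc k)
    then show ?case unfolding C_k_Suc_dd using assms(2,3) by blast
  qed
  then show ?thesis using assms(1) unfolding smooth_def by blast
qed

lemma smooth_differentiable: "smooth f \<Longrightarrow> f differentiable (at x)"
  unfolding smooth_def by (metis C_k_Suc_dd differentiable_on_eq_differentiable_at open_UNIV UNIV_I)

lemma smooth_dd: "smooth f \<Longrightarrow> smooth (dd v f)"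
  unfolding smooth_def by (metis C_k_Suc_dd)

lemma smooth_has_derivative: "smooth f \<Longrightarrow> (f has_derivative (\<lambda>v. dd v f x)) (at x)"
  unfolding dd_def using smooth_differentiable frechet_derivative_works by blast

lemma smooth_continuous_on: "smooth f \<Longrightarrow> continuous_on S f"
  unfolding smooth_def by (metis C_k.simps(1) continuous_on_subset subset_UNIV)

lemma smooth_step:
  assumes "\<And>x. (f has_derivative (\<lambda>v. D v x)) (at x)" "\<And>v. smooth (D v)"
  shows "smooth f"
proof -
  have "dd v f = D v" for v
    using dd_eqI[OF assms(1)] by blast
  moreover have "f differentiable_on UNIV"
    using assms(1) differentiable_def by (metis differentiable_at_imp_differentiable_on)
  ultimately have "C_k (Suc k) f" for k
    using assms(2) by (simp only: C_k_Suc_dd) (auto simp: smooth_def)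
  moreover have "C_k 0 f"
    using \<open>f differentiable_on UNIV\<close> differentiable_imp_continuous_on by auto
  ultimately show ?thesis unfolding smooth_def by (metis not0_implies_Suc)
qed

lemma dd_linear:
  assumes "smooth f"
  shows dd_add_dir: "dd (u + v) f x = dd u f x + dd v f x"
    and dd_scale_dir: "dd (c *\<^sub>R v) f x = c * dd v f x"
    and dd_zero_dir: "dd 0 f x = 0"
    and dd_sum_dir: "dd (\<Sum>i\<in>A. g i) f x = (\<Sum>i\<in>A. dd (g i) f x)"
proof -
  interpret l: bounded_linear "\<lambda>v. dd v f x"
    using smooth_has_derivative[OF assms] has_derivative_bounded_linear by blast
  show "dd (u + v) f x = dd u f x + dd v f x" by (rule l.add)
  show "dd (c *\<^sub>R v) f x = c * dd v f x" by (simp add: l.scaleR scaleR_conv_of_real)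
  show "dd 0 f x = 0" by (rule l.zero)
  show "dd (\<Sum>i\<in>A. g i) f x = (\<Sum>i\<in>A. dd (g i) f x)" by (rule l.sum)
qed

lemma C_k_Suc_imp: "C_k (Suc k) f \<Longrightarrow> C_k k f"
proof (induction k arbitrary: f)
  case 0
  then show ?case using differentiable_imp_continuous_on by (simp only: C_k_Suc_dd C_k.simps(1)) blast
next
  case (Suc k)
  then show ?case unfolding C_k_Suc_dd[of "Suc k"] unfolding C_k_Suc_dd[of k f] by blast
qed

lemma dd_add:
  "f differentiable (at x) \<Longrightarrow> g differentiable (at x) \<Longrightarrow> dd v (\<lambda>x. f x + g x) x = dd v f x + dd v g x"
  using dd_eqI[OF has_derivative_add, of f "\<lambda>v. dd v f x" x g "\<lambda>v. dd v g x" v]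
  by (simp add: dd_def frechet_derivative_works)

lemma dd_mult:
  "f differentiable (at x) \<Longrightarrow> g differentiable (at x) \<Longrightarrow>
    dd v (\<lambda>x. f x * g x) x = f x * dd v g x + dd v f x * g x"
  using dd_eqI[OF has_derivative_mult, of f "\<lambda>v. dd v f x" x g "\<lambda>v. dd v g x" v]
  by (simp add: dd_def frechet_derivative_works)

lemma C_k_add: "C_k k f \<Longrightarrow> C_k k g \<Longrightarrow> C_k k (\<lambda>x. f x + g x)"
proof (induction k arbitrary: f g)
  case 0
  then show ?case by (auto intro: continuous_intros)
next
  case (Suc k)
  then have d: "f differentiable (at x)" "g differentiable (at x)" for x
    by (simp_all add: C_k_Suc_dd differentiable_on_eq_differentiable_at del: C_k.simps)
  have "dd v (\<lambda>x. f x + g x) = (\<lambda>x. dd v f x + dd v g x)" for v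
    using d by (auto simp: dd_add)
  then show ?case using Suc
    by (simp add: C_k_Suc_dd differentiable_on_eq_differentiable_at d del: C_k.simps)
qed

lemma C_k_mult: "C_k k f \<Longrightarrow> C_k k g \<Longrightarrow> C_k k (\<lambda>x. f x * g x)"
proof (induction k arbitrary: f g)
  case 0
  then show ?case by (auto intro: continuous_intros)
next
  case (Suc k)
  then have d: "f differentiable (at x)" "g differentiable (at x)" for x
    by (simp_all add: C_k_Suc_dd differentiable_on_eq_differentiable_at del: C_k.simps)
  have "dd v (\<lambda>x. f x * g x) = (\<lambda>x. f x * dd v g x + dd v f x * g x)" for v
    using d by (auto simp: dd_mult)
  moreover have "C_k k f" "C_k k g" using Suc.prems C_k_Suc_imp by blast+
  ultimately show ?case using Suc
    by (simp add: C_k_Suc_dd differentiable_on_eq_differentiable_at d C_k_add del: C_k.simps)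
qed

lemma smooth_add: "smooth f \<Longrightarrow> smooth g \<Longrightarrow> smooth (\<lambda>x. f x + g x)"
  unfolding smooth_def by (simp add: C_k_add)

lemma smooth_mult: "smooth f \<Longrightarrow> smooth g \<Longrightarrow> smooth (\<lambda>x. f x * g x)"
  unfolding smooth_def by (simp add: C_k_mult)

lemma dd_const: "dd v (\<lambda>x. c) = (\<lambda>x. 0)"
  by (intro ext dd_eqI) (rule has_derivative_const)

lemma smooth_const: "smooth (\<lambda>x. c)"
proof (rule smooth_coinduct[where P = "\<lambda>f. \<exists>c. f = (\<lambda>_. c)"])
  show "\<exists>d. dd v f = (\<lambda>_. d)" if "\<exists>c. f = (\<lambda>_. c)" for f :: "'a \<Rightarrow> complex" and v
    using that dd_const by blast
qed (use differentiable_on_const in blast)+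

lemma smooth_cmult: "smooth f \<Longrightarrow> smooth (\<lambda>x. c * f x)"
  by (intro smooth_mult smooth_const)

lemma smooth_uminus: "smooth f \<Longrightarrow> smooth (\<lambda>x. - f x)"
  using smooth_cmult[of f "-1"] by simp

lemma smooth_diff: "smooth f \<Longrightarrow> smooth g \<Longrightarrow> smooth (\<lambda>x. f x - g x)"
  using smooth_add[of f "\<lambda>x. - g x"] smooth_uminus[of g] by simp

lemma smooth_sum: "(\<And>i. i \<in> A \<Longrightarrow> smooth (f i)) \<Longrightarrow> smooth (\<lambda>x. \<Sum>i\<in>A. f i x)"
  by (induction A rule: infinite_finite_induct) (auto intro: smooth_add smooth_const)

lemma smooth_linear: "bounded_linear f \<Longrightarrow> smooth f"
  by (rule smooth_step[where D = "\<lambda>v x. f v"]) (auto intro: bounded_linear_imp_has_derivative smooth_const)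

text \<open>The derivative is \<open>exp (f x)\<close> times a smooth factor, so
  \<open>C_k_mult\<close> lifts the regularity of the exponential itself by one order at each
  step.\<close>

lemma smooth_exp:
  assumes "smooth f" shows "smooth (\<lambda>x. exp (f x))"
proof -
  have der: "((\<lambda>x. exp (f x)) has_derivative (\<lambda>v. dd v f x * exp (f x))) (at x)" for x
    using has_derivative_compose[OF smooth_has_derivative[OF assms, of x]
        DERIV_exp[of "f x", unfolded has_field_derivative_def]]
    by (simp add: mult_ac)
  have dd: "dd v (\<lambda>x. exp (f x)) = (\<lambda>x. dd v f x * exp (f x))" for v
    using dd_eqI[OF der] by blast
  have "C_k k (\<lambda>x. exp (f x))" for k
  proof (induction k)
    case 0
    show ?case using smooth_continuous_on[OF assms] by (auto intro!: continuous_intros)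
  next
    case (Suc k)
    have "C_k k (dd v f)" for v
      using smooth_dd[OF assms] smooth_def by blast
    moreover have "(\<lambda>x. exp (f x)) differentiable_on UNIV"
      using der differentiable_def by (metis differentiable_at_imp_differentiable_on)
    ultimately show ?case using Suc by (simp only: C_k_Suc_dd dd C_k_mult simp_thms)
  qed
  then show ?thesis unfolding smooth_def by blast
qed

lemma smooth_inverse:
  assumes "smooth f" "\<And>x. f x \<noteq> 0" shows "smooth (\<lambda>x. inverse (f x))"
proof -
  have der: "((\<lambda>x. inverse (f x)) has_derivative (\<lambda>v. - 1 * dd v f x * (inverse (f x) * inverse (f x)))) (at x)" for x
    using Deriv.has_derivative_inverse[OF assms(2) smooth_has_derivative[OF assms(1)], of x]
    by (simp add: mult_ac)
  have dd: "dd v (\<lambda>x. inverse (f x)) = (\<lambda>x. - 1 * dd v f x * (inverse (f x) * inverse (f x)))" for v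
    using dd_eqI[OF der] by blast
  have "C_k k (\<lambda>x. inverse (f x))" for k
  proof (induction k)
    case 0
    show ?case using smooth_continuous_on[OF assms(1)] assms(2) by (auto intro!: continuous_intros)
  next
    case (Suc k)
    have "C_k k (\<lambda>x. - 1 * dd v f x)" for v
      using smooth_cmult[OF smooth_dd[OF assms(1)]] smooth_def by blast
    moreover have "(\<lambda>x. inverse (f x)) differentiable_on UNIV"
      using der differentiable_def by (metis differentiable_at_imp_differentiable_on)
    ultimately show ?case using Suc by (simp only: C_k_Suc_dd dd C_k_mult simp_thms)
  qed
  then show ?thesis unfolding smooth_def by blast
qed

lemma dd_affine:
  assumes "bounded_linear L" "smooth f"
  shows "((\<lambda>x. f (c + L x)) has_derivative (\<lambda>v. dd (L v) f (c + L x))) (at x)"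
proof -
  have "((\<lambda>x. c + L x) has_derivative L) (at x)"
    using bounded_linear_imp_has_derivative[OF assms(1)] by (auto intro!: derivative_eq_intros)
  from has_derivative_compose[OF this smooth_has_derivative[OF assms(2)]] show ?thesis .
qed

lemma smooth_affine:
  assumes "bounded_linear L" "smooth f"
  shows "smooth (\<lambda>x. f (c + L x))"
proof (rule smooth_coinduct[where P = "\<lambda>h. \<exists>f. smooth f \<and> h = (\<lambda>x. f (c + L x))"])
  show "\<exists>f'. smooth f' \<and> (\<lambda>x. f (c + L x)) = (\<lambda>x. f' (c + L x))" using assms(2) by blast
  show "h differentiable_on UNIV" if "\<exists>f. smooth f \<and> h = (\<lambda>x. f (c + L x))" for h
    using that dd_affine[OF assms(1)] differentiable_def
    by (metis differentiable_at_imp_differentiable_on)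
  show "\<exists>f. smooth f \<and> dd v h = (\<lambda>x. f (c + L x))" if "\<exists>f. smooth f \<and> h = (\<lambda>x. f (c + L x))" for h v
    using that dd_eqI[OF dd_affine[OF assms(1)], of _ v] smooth_dd by blast
qed

lemma dd_translate: "smooth f \<Longrightarrow> dd v (\<lambda>x. f (x + c)) x = dd v f (x + c)"
  using dd_eqI[OF dd_affine[OF bounded_linear_ident, of f c]] by (simp add: add.commute)

text \<open>Used for functions given by sums whose range jumps with the point, such as
  \<open>glue\<close>: near each point they agree with one smooth function, and so do their
  derivatives.\<close>

lemma smooth_local:
  assumes "\<And>x. \<exists>U g. open U \<and> x \<in> U \<and> smooth g \<and> (\<forall>y\<in>U. f y = g y)"
  shows "smooth f"
proof (rule smooth_coinduct[where P = "\<lambda>f. \<forall>x. \<exists>U g. open U \<and> x \<in> U \<and> smooth g \<and> (\<forall>y\<in>U. f y = g y)"])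
  show "\<forall>x. \<exists>U g. open U \<and> x \<in> U \<and> smooth g \<and> (\<forall>y\<in>U. f y = g y)" using assms by blast
next
  fix f :: "'a \<Rightarrow> complex"
  assume l: "\<forall>x. \<exists>U g. open U \<and> x \<in> U \<and> smooth g \<and> (\<forall>y\<in>U. f y = g y)"
  have d: "\<exists>U g. open U \<and> x \<in> U \<and> smooth g \<and> (\<forall>y\<in>U. (f has_derivative (\<lambda>v. dd v g y)) (at y))" for x
  proof -
    obtain U g where U: "open U" "x \<in> U" "smooth g" "\<forall>y\<in>U. f y = g y" using l by blast
    have "(f has_derivative (\<lambda>v. dd v g y)) (at y)" if "y \<in> U" for y
      using has_derivative_transform_within_open[OF smooth_has_derivative[OF U(3), of y] U(1) that] U(4) by metis
    then show ?thesis using U by blast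
  qed
  show "f differentiable_on UNIV"
    using d differentiable_def by (metis differentiable_at_imp_differentiable_on)
  fix v
  show "\<forall>x. \<exists>U g. open U \<and> x \<in> U \<and> smooth g \<and> (\<forall>y\<in>U. dd v f y = g y)"
  proof
    fix x
    obtain U g where "open U" "x \<in> U" "smooth g" "\<forall>y\<in>U. (f has_derivative (\<lambda>v. dd v g y)) (at y)"
      using d by blast
    then show "\<exists>U g. open U \<and> x \<in> U \<and> smooth g \<and> (\<forall>y\<in>U. dd v f y = g y)"
      using smooth_dd dd_eqI by metis
  qed
qed

text \<open>All averages and Green operators are built from this convolution along the image of a
  linear map \<open>L\<close>. A one-dimensional box gives line integrals, a two-dimensional one
  integrals over an elliptic curve.\<close>

definition cint :: "'b::euclidean_space \<Rightarrow> 'b \<Rightarrow> ('b \<Rightarrow> complex) \<Rightarrow> ('b \<Rightarrow> 'v) \<Rightarrow> ('v::euclidean_space \<Rightarrow> complex) \<Rightarrow> 'v \<Rightarrow> complex"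
  where "cint a b k L f x = integral (cbox a b) (\<lambda>t. k t * f (x + L t))"

lemma cint_continuous:
  assumes "continuous_on (cbox a b) k" "bounded_linear L" "smooth f"
  shows "continuous_on (cbox a b) (\<lambda>t. k t * f (x + L t))"
  by (intro continuous_intros assms continuous_on_compose2[OF smooth_continuous_on[OF assms(3), of UNIV]]
      linear_continuous_on) auto

lemma cint_has_derivative:
  fixes f :: "'b::euclidean_space \<Rightarrow> complex"
  assumes k: "continuous_on (cbox a b) k" and L: "bounded_linear L" and f: "smooth f"
  shows "((cint a b k L f) has_derivative (\<lambda>v. cint a b k L (dd v f) x)) (at x)"
proof -
  \<comment> \<open>The Leibniz rule wants the derivative as a continuous map into the bounded
    linear maps; continuity is checked on basis vectors.\<close>
  define fx where "fx x t = Blinfun (\<lambda>v. k t * dd v f (x + L t))" for x t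
  have bl: "bounded_linear (\<lambda>v. k t * dd v f (x + L t))" for x t
    by (intro bounded_linear_mult_const bounded_linear_const_mult
        has_derivative_bounded_linear[OF smooth_has_derivative[OF f]])
  have fx: "blinfun_apply (fx x t) = (\<lambda>v. k t * dd v f (x + L t))" for x t
    unfolding fx_def using bl bounded_linear_Blinfun_apply by blast
  have c: "continuous_on (UNIV \<times> cbox a b) (\<lambda>(x, t). fx x t)"
  proof (rule continuous_on_blinfun_componentwise)
    fix i :: 'b
    have "continuous_on (UNIV \<times> cbox a b) (\<lambda>p. k (snd p) * dd i f (fst p + L (snd p)))"
      by (intro continuous_intros continuous_on_compose2[OF k] linear_continuous_on_compose[OF _ bounded_linear.linear[OF L]]
          continuous_on_compose2[OF smooth_continuous_on[OF smooth_dd[OF f], of UNIV]]) auto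
    then show "continuous_on (UNIV \<times> cbox a b) (\<lambda>p. blinfun_apply (case p of (x, t) \<Rightarrow> fx x t) i)"
      by (simp add: case_prod_unfold fx)
  qed
  have der: "((\<lambda>x. k t * f (x + L t)) has_derivative blinfun_apply (fx x t)) (at x)" for x t
  proof -
    have "((\<lambda>x. f (L t + x)) has_derivative (\<lambda>v. dd v f (L t + x))) (at x)"
      using dd_affine[OF bounded_linear_ident f, of "L t" x] by simp
    from has_derivative_mult_right[OF this, of "k t"] show ?thesis
      by (simp add: fx add.commute)
  qed
  have "((\<lambda>x. integral (cbox a b) (\<lambda>t. k t * f (x + L t))) has_derivative
      blinfun_apply (integral (cbox a b) (fx x))) (at x within UNIV)"
    by (rule leibniz_rule[OF _ _ c]) (auto intro: der integrable_continuous cint_continuous[OF k L f])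
  moreover have "blinfun_apply (integral (cbox a b) (fx x)) = (\<lambda>v. cint a b k L (dd v f) x)"
  proof
    fix v
    have "continuous_on (cbox a b) (fx x)"
      using continuous_on_compose2[OF c, of "cbox a b" "\<lambda>t. (x, t)"]
        continuous_on_Pair[OF continuous_on_const continuous_on_id, of "cbox a b" x]
      by auto
    then have "fx x integrable_on cbox a b" by (rule integrable_continuous)
    from blinfun_apply_integral[OF this, of v]
    show "blinfun_apply (integral (cbox a b) (fx x)) v = cint a b k L (dd v f) x"
      by (simp add: cint_def fx)
  qed
  ultimately show ?thesis by (simp add: cint_def[abs_def])
qed

lemma dd_cint:
  assumes "continuous_on (cbox a b) k" "bounded_linear L" "smooth f"
  shows "dd v (cint a b k L f) = cint a b k L (dd v f)"
  using dd_eqI[OF cint_has_derivative[OF assms]] by blast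

lemma smooth_cint:
  assumes k: "continuous_on (cbox a b) k" and L: "bounded_linear L" and f: "smooth f"
  shows "smooth (cint a b k L f)"
proof (rule smooth_coinduct[where P = "\<lambda>h. \<exists>f. smooth f \<and> h = cint a b k L f"])
  show "\<exists>g. smooth g \<and> cint a b k L f = cint a b k L g" using f by blast
  show "h differentiable_on UNIV" if "\<exists>f. smooth f \<and> h = cint a b k L f" for h
    using that cint_has_derivative[OF k L] differentiable_def
    by (metis differentiable_at_imp_differentiable_on)
  show "\<exists>f. smooth f \<and> dd v h = cint a b k L f" if "\<exists>f. smooth f \<and> h = cint a b k L f" for h v
    using that dd_cint[OF k L] smooth_dd by blast
qed

lemma line_derivative:
  assumes "smooth f"
  shows "((\<lambda>t. f (x + t *\<^sub>R u)) has_vector_derivative dd u f (x + t *\<^sub>R u)) (at t within S)"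
proof -
  have "((\<lambda>t. f (x + t *\<^sub>R u)) has_derivative (\<lambda>s. dd (s *\<^sub>R u) f (x + t *\<^sub>R u))) (at t)"
    by (rule dd_affine[OF bounded_linear_scaleR_left assms])
  then show ?thesis
    unfolding has_vector_derivative_def
    by (auto intro: has_derivative_at_withinI simp: dd_scale_dir[OF assms] scaleR_conv_of_real)
qed

lemma integral_line:
  assumes "smooth f" "0 \<le> s"
  shows "integral {0..s} (\<lambda>t. dd u f (x + t *\<^sub>R u)) = f (x + s *\<^sub>R u) - f x"
  using fundamental_theorem_of_calculus[OF assms(2) line_derivative[OF assms(1), of x u]]
  by (auto intro: integral_unique)

text \<open>Symmetry of second derivatives by integration: \<open>f (x + s u) - f x\<close> is the
  integral of \<open>dd u f\<close> along the segment, the derivative along \<open>v\<close> passes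
  under the integral, and then s is differentiated at 0.\<close>

lemma dd_commute:
  fixes f :: "'v::euclidean_space \<Rightarrow> complex"
  assumes f: "smooth f"
  shows "dd u (dd v f) = dd v (dd u f)"
proof
  fix x
  have eq: "dd v f (x + s *\<^sub>R u) = dd v f x + integral {0..s} (\<lambda>t. dd v (dd u f) (x + t *\<^sub>R u))" if "0 \<le> s" for s
  proof -
    let ?c = "cint 0 s (\<lambda>_. 1) (\<lambda>t. t *\<^sub>R u)"
    have c: "?c (dd u f) = (\<lambda>x. f (x + s *\<^sub>R u) - f x)"
      using integral_line[OF f that] by (simp add: cint_def fun_eq_iff)
    have "dd v (?c (dd u f)) x = ?c (dd v (dd u f)) x"
      by (subst dd_cint) (auto intro: smooth_dd f continuous_intros bounded_linear_scaleR_left)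
    moreover have "dd v (\<lambda>x. f (x + s *\<^sub>R u) - f x) x = dd v f (x + s *\<^sub>R u) - dd v f x"
    proof (rule dd_eqI)
      have "((\<lambda>x. f (s *\<^sub>R u + x)) has_derivative (\<lambda>v. dd v f (s *\<^sub>R u + x))) (at x)"
        using dd_affine[OF bounded_linear_ident f, of "s *\<^sub>R u" x] by simp
      from has_derivative_diff[OF this smooth_has_derivative[OF f, of x]]
      show "((\<lambda>x. f (x + s *\<^sub>R u) - f x) has_derivative (\<lambda>v. dd v f (x + s *\<^sub>R u) - dd v f x)) (at x)"
        by (simp add: add.commute)
    qed
    ultimately show ?thesis unfolding c by (simp add: cint_def algebra_simps)
  qed
  have cont: "continuous_on {0..1} (\<lambda>t. dd v (dd u f) (x + t *\<^sub>R u))"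
    by (intro continuous_on_compose2[OF smooth_continuous_on[OF smooth_dd[OF smooth_dd[OF f]], of UNIV]]
        continuous_intros) auto
  \<comment> \<open>The formula \<open>eq\<close> holds for s \<ge> 0 only, so the derivatives at 0
    are one-sided; on a closed interval they are still unique.\<close>
  have "((\<lambda>s. dd v f x + integral {0..s} (\<lambda>t. dd v (dd u f) (x + t *\<^sub>R u))) has_vector_derivative
      dd v (dd u f) x) (at 0 within {0..1})"
    using integral_has_vector_derivative[OF cont, of 0]
    by (auto intro!: derivative_eq_intros)
  then have "((\<lambda>s. dd v f (x + s *\<^sub>R u)) has_vector_derivative dd v (dd u f) x) (at 0 within {0..1})"
    by (rule has_vector_derivative_transform[rotated 2]) (auto simp: eq)
  moreover have "((\<lambda>s. dd v f (x + s *\<^sub>R u)) has_vector_derivative dd u (dd v f) x) (at 0 within {0..1})"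
    using line_derivative[OF smooth_dd[OF f], of v x u 0] by simp
  ultimately have "((\<lambda>s. dd v f (x + s *\<^sub>R u)) has_vector_derivative dd u (dd v f) x) (at 0 within cbox 0 1)"
    "((\<lambda>s. dd v f (x + s *\<^sub>R u)) has_vector_derivative dd v (dd u f) x) (at 0 within cbox 0 1)"
    by (simp_all only: cbox_interval)
  then show "dd u (dd v f) x = dd v (dd u f) x"
    by (rule vector_derivative_unique_within_closed_interval[rotated 2]) auto
qed

section \<open>Fourier inversion\<close>

lemma exp_has_vector_derivative:
  "((\<lambda>t. exp (of_real t * c)) has_vector_derivative c * exp (of_real t * c)) (at t within S)" for c :: complex
  by (rule has_vector_derivative_real_field) (auto intro!: derivative_eq_intros)

text \<open>Multiplying by \<open>c\<close> instead of dividing keeps one statement for all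
  \<open>c\<close>: imaginary \<open>c\<close> gives the decay of oscillatory integrals, multiples
  of 2 pi \<i> the orthogonality of the exponentials.\<close>

lemma integral_exp_by_parts:
  fixes g g' :: "real \<Rightarrow> complex"
  assumes g: "\<And>t. (g has_vector_derivative g' t) (at t)" and g': "continuous_on UNIV g'"
  shows "c * integral {0..1} (\<lambda>t. exp (of_real t * c) * g t) =
     exp c * g 1 - g 0 - integral {0..1} (\<lambda>t. exp (of_real t * c) * g' t)"
proof -
  have gc: "continuous_on S g" for S
    using g has_vector_derivative_continuous continuous_at_imp_continuous_on by blast
  have "((\<lambda>t. exp (of_real t * c) * g t) has_vector_derivative
     (exp (of_real t * c) * g' t + c * exp (of_real t * c) * g t)) (at t within {0..1})" for t
    by (rule has_vector_derivative_mult[OF exp_has_vector_derivative has_vector_derivative_at_within[OF g]])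
  from fundamental_theorem_of_calculus[OF zero_le_one this]
  have "((\<lambda>t. exp (of_real t * c) * g' t + c * (exp (of_real t * c) * g t)) has_integral
    exp c * g 1 - g 0) {0..1}" by (simp add: mult.assoc)
  moreover have "((\<lambda>t. exp (of_real t * c) * g' t + c * (exp (of_real t * c) * g t)) has_integral
    integral {0..1} (\<lambda>t. exp (of_real t * c) * g' t) + c * integral {0..1} (\<lambda>t. exp (of_real t * c) * g t)) {0..1}"
    by (intro has_integral_add has_integral_mult_right integrable_integral integrable_continuous_interval
        continuous_intros gc continuous_on_subset[OF g']) auto
  ultimately have "exp c * g 1 - g 0 = integral {0..1} (\<lambda>t. exp (of_real t * c) * g' t) +
      c * integral {0..1} (\<lambda>t. exp (of_real t * c) * g t)"
    by (rule has_integral_unique)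
  then show ?thesis by (simp add: algebra_simps)
qed

lemma norm_exp_imaginary: "norm (exp (of_real t * (\<i> * of_real r))) = 1"
  by (simp add: norm_exp_eq_Re)

text \<open>Integration by parts gives decay like 1/r, but only for differentiable functions;
  \<open>\<psi>\<close> is merely continuous, so it is first replaced by a polynomial within
  \<open>e / 2\<close>.\<close>

lemma riemann_lebesgue:
  fixes \<psi> :: "real \<Rightarrow> complex"
  assumes \<psi>: "continuous_on {0..1} \<psi>"
  shows "((\<lambda>r. integral {0..1} (\<lambda>t. exp (of_real t * (\<i> * of_real r)) * \<psi> t)) \<longlongrightarrow> 0) at_infinity"
proof (rule tendstoI)
  fix e :: real assume e: "e > 0"
  obtain g where g: "polynomial_function g" "\<And>t. t \<in> {0..1} \<Longrightarrow> norm (\<psi> t - g t) < e / 2"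
    using Stone_Weierstrass_polynomial_function[OF _ \<psi>, of "e / 2"] e by auto
  obtain g' where g': "polynomial_function g'" "\<And>t. (g has_vector_derivative g' t) (at t)"
    using has_vector_derivative_polynomial_function[OF g(1)] by blast
  have g'c: "continuous_on S g'" and gc: "continuous_on S g" for S
    using continuous_on_polymonial_function g' g by blast+
  obtain B where B: "\<And>t. t \<in> {0..1} \<Longrightarrow> norm (g' t) \<le> B"
    using compact_imp_bounded[OF compact_continuous_image[OF g'c compact_Icc]]
    unfolding bounded_iff by (metis imageI)
  \<comment> \<open>\<open>K\<close> bounds the two boundary terms and the integral of
    \<open>g'\<close>, independently of r.\<close>
  define K where "K = norm (g 1) + norm (g 0) + B"
  have "norm (g' 0) \<le> B" using B[of 0] by simp
  then have K0: "K \<ge> 0" unfolding K_def by (meson add_nonneg_nonneg norm_ge_zero order_trans)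
  have main: "norm (integral {0..1} (\<lambda>t. exp (of_real t * (\<i> * of_real r)) * \<psi> t)) < e" if r: "norm r > 2 * K / e" for r :: real
  proof -
    let ?E = "\<lambda>t. exp (of_real t * (\<i> * of_real r))"
    have "2 * K / e \<ge> 0" using K0 e by simp
    then have r0: "\<bar>r\<bar> > 0" using r by simp
    have "norm ((\<i> * of_real r) * integral {0..1} (\<lambda>t. ?E t * g t)) \<le> K"
    proof -
      have "norm (integral {0..1} (\<lambda>t. ?E t * g' t)) \<le> B * (1 - 0)"
        by (rule integral_bound) (auto intro!: continuous_intros g'c B simp: norm_mult norm_exp_imaginary)
      moreover have "norm (exp (\<i> * of_real r) * g 1) = norm (g 1)"
        using norm_exp_imaginary[of 1 r] by (simp add: norm_mult)
      ultimately show ?thesis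
        unfolding integral_exp_by_parts[OF g'(2) g'c] K_def
        using norm_triangle_ineq4[of "exp (\<i> * of_real r) * g 1 - g 0" "integral {0..1} (\<lambda>t. ?E t * g' t)"]
          norm_triangle_ineq4[of "exp (\<i> * of_real r) * g 1" "g 0"] by simp
    qed
    then have "\<bar>r\<bar> * norm (integral {0..1} (\<lambda>t. ?E t * g t)) \<le> K" by (simp add: norm_mult)
    moreover have "K < \<bar>r\<bar> * (e / 2)" using r e by (simp add: field_simps)
    ultimately have 1: "norm (integral {0..1} (\<lambda>t. ?E t * g t)) < e / 2"
      using r0 by (meson le_less_trans mult_less_cancel_left_pos)
    have "norm (integral {0..1} (\<lambda>t. ?E t * (\<psi> t - g t))) \<le> e / 2 * (1 - 0)"
      by (rule integral_bound)
        (use g(2) in \<open>auto intro!: continuous_intros gc \<psi> less_imp_le simp: norm_mult norm_exp_imaginary simp del: le_divide_eq_numeral1\<close>)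
    then have "norm (integral {0..1} (\<lambda>t. ?E t * (\<psi> t - g t))) \<le> e / 2" by simp
    moreover have eq: "integral {0..1} (\<lambda>t. ?E t * \<psi> t) =
       integral {0..1} (\<lambda>t. ?E t * (\<psi> t - g t)) + integral {0..1} (\<lambda>t. ?E t * g t)"
      by (subst integral_add[symmetric])
        (auto intro!: integrable_continuous_interval continuous_intros gc \<psi> simp: algebra_simps)
    ultimately show ?thesis unfolding eq using 1
        norm_triangle_ineq[of "integral {0..1} (\<lambda>t. ?E t * (\<psi> t - g t))" "integral {0..1} (\<lambda>t. ?E t * g t)"]
      by linarith
  qed
  show "\<forall>\<^sub>F r in at_infinity. dist (integral {0..1} (\<lambda>t. exp (of_real t * (\<i> * of_real r)) * \<psi> t)) 0 < e"
    unfolding eventually_at_infinity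
    by (rule exI[of _ "2 * K / e + 1"]) (auto intro!: main)
qed

text \<open>The sign in the exponent makes the integral of \<open>fexp n\<close> times a function
  its n-th Fourier coefficient.\<close>

definition fexp :: "int \<Rightarrow> real \<Rightarrow> complex"
  where "fexp n t = exp (of_real t * (- (2 * of_real pi * \<i> * of_int n)))"

lemma fexp_add: "fexp (m + n) t = fexp m t * fexp n t"
  unfolding fexp_def exp_add[symmetric] by (rule arg_cong[of _ _ exp]) (simp add: algebra_simps)

lemma fexp_continuous [continuous_intros]: "continuous_on S (fexp n)"
  unfolding fexp_def[abs_def] by (intro continuous_intros)

lemma norm_fexp [simp]: "norm (fexp n t) = 1"
  by (simp add: norm_exp_eq_Re fexp_def)

lemma fexp_int [simp]: "fexp n 0 = 1" "fexp n 1 = 1" "fexp 0 t = 1"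
proof -
  show "fexp n 1 = 1"
    using exp_integer_2pi[of "of_int (- n)"] by (simp add: fexp_def mult_ac)
qed (simp_all add: fexp_def)

lemma fexp_periodic: "fexp n (t + 1) = fexp n t"
proof -
  have "fexp n (t + 1) = fexp n t * fexp n 1"
    unfolding fexp_def exp_add[symmetric] by (rule arg_cong[of _ _ exp]) (simp add: algebra_simps)
  then show ?thesis by simp
qed

lemma fexp_has_vector_derivative:
  "(fexp n has_vector_derivative - (2 * of_real pi * \<i> * of_int n) * fexp n t) (at t within S)"
  unfolding fexp_def[abs_def] by (rule exp_has_vector_derivative)

lemma fexp_eq_1: "0 < t \<Longrightarrow> t < 1 \<Longrightarrow> fexp (- 1) t \<noteq> 1"
proof
  assume t: "0 < t" "t < 1" and "fexp (- 1) t = 1"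
  then obtain n :: int where "Im (of_real t * (2 * of_real pi * \<i>)) = of_int (2 * n) * pi"
    unfolding fexp_def exp_eq_1 by auto
  then have "t = of_int n" by (simp add: field_simps)
  then show False using t by simp
qed

lemma has_vector_derivative_quotient:
  fixes \<phi> :: "real \<Rightarrow> complex"
  assumes "(\<phi> has_vector_derivative D) (at 0)"
  shows "((\<lambda>t. (\<phi> t - \<phi> 0) / of_real t) \<longlongrightarrow> D) (at 0)"
proof -
  have "((\<lambda>y. norm ((\<phi> y - \<phi> 0) - y *\<^sub>R D) / norm y) \<longlongrightarrow> 0) (at 0)"
    using assms unfolding has_vector_derivative_def has_derivative_iff_norm by simp
  moreover have "\<forall>\<^sub>F y in at 0. norm ((\<phi> y - \<phi> 0) - y *\<^sub>R D) / norm y = norm ((\<phi> y - \<phi> 0) / of_real y - D)"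
  proof (rule eventually_mono[OF eventually_neq_at_within[of 0]])
    fix y :: real assume "y \<noteq> 0"
    then have "(\<phi> y - \<phi> 0) / of_real y - D = ((\<phi> y - \<phi> 0) - y *\<^sub>R D) / of_real y"
      by (simp add: field_simps scaleR_conv_of_real)
    then show "norm ((\<phi> y - \<phi> 0) - y *\<^sub>R D) / norm y = norm ((\<phi> y - \<phi> 0) / of_real y - D)"
      by (simp add: norm_divide)
  qed
  ultimately have "((\<lambda>y. norm ((\<phi> y - \<phi> 0) / of_real y - D)) \<longlongrightarrow> 0) (at 0)"
    by (simp add: filterlim_cong[OF refl refl])
  then show ?thesis
    using LIM_zero_cancel tendsto_norm_zero_iff by blast
qed

text \<open>Dividing \<open>\<phi> t - \<phi> 0\<close> by \<open>fexp (- 1) t - 1\<close> makes the Fourier series of \<open>\<phi> - \<phi> 0\<close> at \<open>0\<close> telescope.\<close>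

lemma fourier_inversion:
  fixes \<phi> :: "real \<Rightarrow> complex"
  assumes der: "\<And>t. (\<phi> has_vector_derivative \<phi>' t) (at t)" and per: "\<And>t. \<phi> (t + 1) = \<phi> t"
  shows "(\<lambda>M. \<Sum>n\<in>{- int M..int M}. integral {0..1} (\<lambda>t. fexp n t * \<phi> t)) \<longlonglongrightarrow> \<phi> 0"
proof -
  have \<phi>c: "continuous_on S \<phi>" for S
    using der has_vector_derivative_continuous continuous_at_imp_continuous_on by blast
  \<comment> \<open>\<open>L\<close> is the limit of the quotient at 0, since
    \<open>fexp (- 1)\<close> has derivative 2 pi \<i> there.\<close>
  define L where "L = \<phi>' 0 / (2 * of_real pi * \<i>)"
  define \<psi> where "\<psi> t = (if fexp (- 1) t = 1 then L else (\<phi> t - \<phi> 0) / (fexp (- 1) t - 1))" for t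
  have \<psi>per: "\<psi> (t + 1) = \<psi> t" for t by (simp add: \<psi>_def fexp_periodic per)
  have cont_in: "isCont \<psi> t" if t: "0 < t" "t < 1" for t
  proof -
    have "continuous_on {0<..<1} (\<lambda>t. (\<phi> t - \<phi> 0) / (fexp (- 1) t - 1))"
      by (intro continuous_intros \<phi>c) (auto dest: fexp_eq_1)
    then have "continuous_on {0<..<1} \<psi>"
      by (rule continuous_on_eq) (auto simp: \<psi>_def dest: fexp_eq_1)
    then show ?thesis using t continuous_on_eq_continuous_at[OF open_greaterThanLessThan] by (metis greaterThanLessThan_iff)
  qed
  have cont0: "isCont \<psi> 0"
  proof -
    have q: "((\<lambda>t. ((\<phi> t - \<phi> 0) / of_real t) / ((fexp (- 1) t - fexp (- 1) 0) / of_real t)) \<longlongrightarrow> \<phi>' 0 / (2 * of_real pi * \<i>)) (at 0)"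
      using has_vector_derivative_quotient[OF der] has_vector_derivative_quotient[OF fexp_has_vector_derivative, of "- 1"]
      by (intro tendsto_divide) auto
    have "\<forall>\<^sub>F t in at 0. ((\<phi> t - \<phi> 0) / of_real t) / ((fexp (- 1) t - fexp (- 1) 0) / of_real t) = \<psi> t"
      unfolding eventually_at
    proof (rule exI[of _ 1], intro conjI ballI impI; (elim conjE)?)
      fix t :: real assume t: "t \<noteq> 0" "dist t 0 < 1"
      have "fexp (- 1) t \<noteq> 1"
        using t fexp_eq_1[of t] fexp_eq_1[of "t + 1"] fexp_periodic[of "- 1" t] by (cases "t > 0") auto
      then show "((\<phi> t - \<phi> 0) / of_real t) / ((fexp (- 1) t - fexp (- 1) 0) / of_real t) = \<psi> t"
        using t by (simp add: \<psi>_def)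
    qed simp
    with q have "(\<psi> \<longlongrightarrow> L) (at 0)" unfolding L_def by (rule Lim_transform_eventually)
    then show ?thesis unfolding isCont_def by (simp add: \<psi>_def)
  qed
  have cont1: "isCont \<psi> 1"
  proof -
    have "isCont (\<lambda>t. \<psi> (t - 1)) 1"
      by (rule isCont_o2[where g = \<psi>]) (use cont0 in \<open>auto intro!: continuous_intros\<close>)
    moreover have "(\<lambda>t. \<psi> (t - 1)) = \<psi>" using \<psi>per[of "_ - 1"] by auto
    ultimately show ?thesis by simp
  qed
  have "isCont \<psi> t" if "t \<in> {0..1}" for t
    using that cont_in[of t] cont0 cont1 by (cases "t = 0 \<or> t = 1") auto
  then have \<psi>c: "continuous_on {0..1} \<psi>" by (simp add: continuous_at_imp_continuous_on)
  have mul: "\<phi> t - \<phi> 0 = (fexp (- 1) t - 1) * \<psi> t" if "t \<in> {0..1}" for t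
  proof (cases "fexp (- 1) t = 1")
    case True
    then have "t = 0 \<or> t = 1" using that fexp_eq_1[of t] by force
    then show ?thesis using per[of 0] by auto
  qed (simp add: \<psi>_def)
  define d where "d n = integral {0..1} (\<lambda>t. fexp n t * \<psi> t)" for n
  define c where "c n = integral {0..1} (\<lambda>t. fexp n t * \<phi> t)" for n
  have int: "(\<lambda>t. fexp n t * \<psi> t) integrable_on {0..1}" "(\<lambda>t. fexp n t * \<phi> t) integrable_on {0..1}"
    "(\<lambda>t. fexp n t * \<phi> 0) integrable_on {0..1}" for n
    by (intro integrable_continuous_interval continuous_intros \<psi>c \<phi>c)+
  have fe: "integral {0..1} (\<lambda>t. fexp n t * \<phi> 0) = (if n = 0 then \<phi> 0 else 0)" for n
  proof (cases "n = 0")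
    case False
    have "- (2 * of_real pi * \<i> * of_int n) * integral {0..1} (\<lambda>t. fexp n t * \<phi> 0) = 0"
      using integral_exp_by_parts[of "\<lambda>_. \<phi> 0" "\<lambda>_. 0" "- (2 * of_real pi * \<i> * of_int n)"] fexp_int(2)[of n]
      unfolding fexp_def by simp
    then show ?thesis using False by simp
  qed simp
  \<comment> \<open>Multiplication by \<open>fexp (- 1)\<close> lowers the index by one, so the
    coefficients of \<open>\<phi> - \<phi> 0\<close> are differences of consecutive coefficients of
    \<open>\<psi>\<close>; the constant contributes at n = 0 alone.\<close>
  have step: "c n = (if n = 0 then \<phi> 0 else 0) + (d (n - 1) - d n)" for n
  proof -
    have "c n - integral {0..1} (\<lambda>t. fexp n t * \<phi> 0) = integral {0..1} (\<lambda>t. fexp n t * \<phi> t - fexp n t * \<phi> 0)"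
      unfolding c_def by (rule integral_diff[symmetric]) (rule int)+
    also have "\<dots> = integral {0..1} (\<lambda>t. fexp (n - 1) t * \<psi> t - fexp n t * \<psi> t)"
    proof (rule integral_cong)
      fix t :: real assume t: "t \<in> {0..1}"
      have "fexp n t * \<phi> t - fexp n t * \<phi> 0 = fexp n t * ((fexp (- 1) t - 1) * \<psi> t)"
        unfolding mul[OF t, symmetric] by (simp add: algebra_simps)
      also have "\<dots> = fexp (n - 1) t * \<psi> t - fexp n t * \<psi> t"
        using fexp_add[of n "- 1" t] by (simp add: algebra_simps)
      finally show "fexp n t * \<phi> t - fexp n t * \<phi> 0 = fexp (n - 1) t * \<psi> t - fexp n t * \<psi> t" .
    qed
    also have "\<dots> = d (n - 1) - d n"
      unfolding d_def by (rule integral_diff) (rule int)+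
    finally show ?thesis unfolding fe by (simp add: algebra_simps)
  qed
  \<comment> \<open>The symmetric sum collapses to two boundary coefficients of
    \<open>\<psi>\<close>, which tend to 0 by \<open>riemann_lebesgue\<close>.\<close>
  have sum: "(\<Sum>n\<in>{- int M..int M}. c n) = \<phi> 0 + (d (- int M - 1) - d (int M))" for M
  proof (induction M)
    case 0
    show ?case by (simp add: step)
  next
    case (Suc M)
    have "{- int (Suc M)..int (Suc M)} = insert (- int M - 1) (insert (int M + 1) {- int M..int M})" by auto
    then show ?case by (simp add: Suc step[of "- int M - 1"] step[of "1 + int M"] add.commute[of _ 1])
  qed
  have lim: "(\<lambda>M. d (g M)) \<longlonglongrightarrow> 0" if g: "filterlim (\<lambda>M. - (2 * pi * real_of_int (g M))) at_infinity sequentially" for g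
  proof -
    have "d n = integral {0..1} (\<lambda>t. exp (of_real t * (\<i> * of_real (- (2 * pi * real_of_int n)))) * \<psi> t)" for n
      by (simp add: d_def fexp_def mult_ac)
    then show ?thesis using filterlim_compose[OF riemann_lebesgue[OF \<psi>c] g] by simp
  qed
  have top: "filterlim (\<lambda>M. 2 * pi * real M) at_top sequentially"
    by (rule filterlim_tendsto_pos_mult_at_top[OF tendsto_const _ filterlim_real_sequentially]) simp
  have "(\<lambda>M. d (- int M - 1)) \<longlonglongrightarrow> 0"
  proof (rule lim)
    have "filterlim (\<lambda>M. 2 * pi * real (Suc M)) at_top sequentially"
      by (rule filterlim_compose[OF top filterlim_Suc])
    then show "filterlim (\<lambda>M. - (2 * pi * real_of_int (- int M - 1))) at_infinity sequentially"
      by (intro filterlim_at_top_imp_at_infinity) (simp add: algebra_simps)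
  qed
  moreover have "(\<lambda>M. d (int M)) \<longlonglongrightarrow> 0"
    by (rule lim) (use top in \<open>simp add: filterlim_at_infinity_conv_norm_at_top abs_mult\<close>)
  ultimately have "(\<lambda>M. \<phi> 0 + (d (- int M - 1) - d (int M))) \<longlonglongrightarrow> \<phi> 0 + (0 - 0)"
    by (intro tendsto_intros)
  then show ?thesis unfolding sum[symmetric] c_def by simp
qed

section \<open>The Green operator of an elliptic curve\<close>

lemma dd_cmult: "smooth f \<Longrightarrow> dd v (\<lambda>x. c * f x) = (\<lambda>x. c * dd v f x)"
  using dd_mult[of "\<lambda>_. c" _ f v] by (auto simp: dd_const smooth_differentiable)

lemma dd_add_fun: "smooth f \<Longrightarrow> smooth g \<Longrightarrow> dd v (\<lambda>x. f x + g x) = (\<lambda>x. dd v f x + dd v g x)"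
  by (intro ext dd_add smooth_differentiable)

lemma dd_mult_fun:
  "smooth f \<Longrightarrow> smooth g \<Longrightarrow> dd v (\<lambda>x. f x * g x) = (\<lambda>x. f x * dd v g x + dd v f x * g x)"
  by (intro ext dd_mult smooth_differentiable)

lemma dd_translate_fun: "smooth f \<Longrightarrow> dd v (\<lambda>x. f (x + c)) = (\<lambda>x. dd v f (x + c))"
  by (intro ext dd_translate)

lemma dd_eq_0:
  assumes "smooth f" "\<And>t x. f (x + t *\<^sub>R e) = f x"
  shows "dd e f = (\<lambda>x. 0)"
proof
  fix x
  have "((\<lambda>t. f x) has_vector_derivative dd e f x) (at 0)"
    using line_derivative[OF assms(1), of x e 0 UNIV] assms(2) by simp
  then show "dd e f x = 0"
    using vector_derivative_unique_at has_vector_derivative_const by blast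
qed

lemma translation_invariant:
  assumes "smooth f" "dd e f = (\<lambda>x. 0)"
  shows "f (x + e) = f x"
  using integral_line[OF assms(1), of 1 e x] assms(2) by simp

lemma cint_integrable:
  assumes "continuous_on (cbox a b) k" "bounded_linear L" "smooth f"
  shows "(\<lambda>t. k t * f (x + L t)) integrable_on cbox a b"
  using integrable_continuous cint_continuous[OF assms] by blast

lemma cint_add:
  assumes "continuous_on (cbox a b) k" "bounded_linear L" "smooth f" "smooth g"
  shows "cint a b k L (\<lambda>x. f x + g x) = (\<lambda>x. cint a b k L f x + cint a b k L g x)"
  by (rule ext) (simp add: cint_def algebra_simps integral_add cint_integrable assms)

lemma cint_mult:
  assumes "\<And>t x. \<phi> (x + L t) = \<phi> x"
  shows "cint a b k L (\<lambda>x. \<phi> x * f x) = (\<lambda>x. \<phi> x * cint a b k L f x)"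
proof
  fix x
  show "cint a b k L (\<lambda>x. \<phi> x * f x) x = \<phi> x * cint a b k L f x"
    unfolding cint_def assms integral_mult_right[symmetric] by (simp add: mult_ac)
qed

lemma cint_cmult: "cint a b k L (\<lambda>x. c * f x) = (\<lambda>x. c * cint a b k L f x)"
  by (rule cint_mult) (rule refl)

lemma cint_translate: "cint a b k L (\<lambda>x. f (x + c)) = (\<lambda>x. cint a b k L f (x + c))"
  by (simp add: cint_def[abs_def] add_ac)

text \<open>An affine substitution only changes the directions of integration. Applied to lattice
  translations it will turn them into a change of the lattice basis.\<close>

lemma cint_affine:
  assumes "linear R"
  shows "cint a b k (\<lambda>t. R (L t)) f (c + R x) = cint a b k L (\<lambda>x. f (c + R x)) x"
  by (simp add: cint_def linear_add[OF assms] add_ac)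

abbreviation lint :: "(real \<Rightarrow> complex) \<Rightarrow> 'v \<Rightarrow> ('v::euclidean_space \<Rightarrow> complex) \<Rightarrow> 'v \<Rightarrow> complex"
  where "lint k e \<equiv> cint (0::real) 1 k (\<lambda>t. t *\<^sub>R e)"

text \<open>The boundary terms stay separate here. For periodic \<open>f\<close> they become the
  jump of the kernel over one period times \<open>f x\<close>, which is where the inverse operators
  get their identity part.\<close>

lemma lint_parts:
  assumes k: "\<And>t. (k has_vector_derivative k' t) (at t)" "continuous_on UNIV k'" and f: "smooth f"
  shows "lint k e (dd e f) x = k 1 * f (x + e) - k 0 * f x - lint k' e f x"
proof -
  have kc: "continuous_on S k" for S
    using k has_vector_derivative_continuous continuous_at_imp_continuous_on by blast
  have "((\<lambda>t. k t * f (x + t *\<^sub>R e)) has_vector_derivative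
     k t * dd e f (x + t *\<^sub>R e) + k' t * f (x + t *\<^sub>R e)) (at t within {0..1})" for t
    by (rule has_vector_derivative_mult[OF has_vector_derivative_at_within[OF k(1)] line_derivative[OF f]])
  from fundamental_theorem_of_calculus[OF zero_le_one this]
  have "((\<lambda>t. k t * dd e f (x + t *\<^sub>R e) + k' t * f (x + t *\<^sub>R e)) has_integral k 1 * f (x + e) - k 0 * f x) {0..1}"
    by simp
  moreover have "((\<lambda>t. k t * dd e f (x + t *\<^sub>R e) + k' t * f (x + t *\<^sub>R e)) has_integral
      lint k e (dd e f) x + lint k' e f x) {0..1}"
  proof -
    have "(\<lambda>t. k t * dd e f (x + t *\<^sub>R e)) integrable_on cbox 0 1"
      by (rule cint_integrable[OF kc bounded_linear_scaleR_left smooth_dd[OF f]])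
    moreover have "(\<lambda>t. k' t * f (x + t *\<^sub>R e)) integrable_on cbox 0 1"
      by (rule cint_integrable[OF continuous_on_subset[OF k(2) subset_UNIV] bounded_linear_scaleR_left f])
    ultimately show ?thesis
      unfolding cint_def cbox_interval by (intro has_integral_add integrable_integral)
  qed
  ultimately have "k 1 * f (x + e) - k 0 * f x = lint k e (dd e f) x + lint k' e f x"
    by (rule has_integral_unique)
  then show ?thesis by (simp add: algebra_simps)
qed

definition avg :: "'v::euclidean_space \<Rightarrow> 'v \<Rightarrow> ('v \<Rightarrow> complex) \<Rightarrow> 'v \<Rightarrow> complex"
  where "avg e1 e2 f = lint (\<lambda>_. 1) e1 (lint (\<lambda>_. 1) e2 f)"

definition plane :: "'v::real_vector \<Rightarrow> 'v \<Rightarrow> real \<times> real \<Rightarrow> 'v"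
  where "plane e1 e2 p = fst p *\<^sub>R e1 + snd p *\<^sub>R e2"

text \<open>\<open>ode_kernel \<mu> n\<close> gives the periodic solution operator of \<open>2 \<pi> \<i> n u + (\<i> / \<mu>) u' = g\<close>.\<close>

definition ode_kernel :: "real \<Rightarrow> int \<Rightarrow> real \<Rightarrow> complex"
  where "ode_kernel \<mu> n t = - \<i> * of_real \<mu> / (exp (of_real (2 * pi * of_int n * \<mu>)) - 1) *
    exp (of_real t * of_real (2 * pi * of_int n * \<mu>))"

text \<open>The modes are divided by \<open>(2 \<pi> \<i> n)\<^sup>2\<close>, which makes the sum over \<open>n\<close> uniformly convergent; the
  Green operator compensates for this by two derivatives in the first direction.\<close>

definition mode_kernel :: "real \<Rightarrow> int \<Rightarrow> real \<times> real \<Rightarrow> complex"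
  where "mode_kernel \<mu> n p = fexp n (fst p) * (ode_kernel \<mu> n (snd p) / (2 * of_real pi * \<i> * of_int n)\<^sup>2)"

text \<open>Modes n and -n are paired because Fourier inversion is proved for symmetric partial
  sums. Mode 0, whose equation is solvable only up to the mean, is left out and enters
  \<open>green\<close> separately.\<close>

definition green_kernel :: "real \<Rightarrow> real \<times> real \<Rightarrow> complex"
  where "green_kernel \<mu> p = (\<Sum>m. mode_kernel \<mu> (int (Suc m)) p + mode_kernel \<mu> (- int (Suc m)) p)"

text \<open>The linear kernel in the first term inverts \<open>(\<i> / \<mu>) d/dt\<close> on mode
  0, up to the mean. The factor 2 cancels the 1/2 of \<open>cr_op\<close>.\<close>

definition green :: "'v::euclidean_space \<Rightarrow> 'v \<Rightarrow> real \<Rightarrow> ('v \<Rightarrow> complex) \<Rightarrow> 'v \<Rightarrow> complex"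
  where "green e1 e2 \<mu> f = (\<lambda>x. 2 * (cint (0, 0) (1, 1) (\<lambda>p. - \<i> * of_real \<mu> * of_real (snd p)) (plane e1 e2) f x +
    cint (0, 0) (1, 1) (green_kernel \<mu>) (plane e1 e2) (dd e1 (dd e1 f)) x))"

text \<open>When \<open>e2\<close> is \<i> \<open>\<mu>\<close> times \<open>e1\<close> for a
  complex structure, this is the antiholomorphic derivative in the direction \<open>e1\<close>:
  \<open>e2 / \<mu>\<close> plays the role of \<i> \<open>e1\<close>.\<close>

definition cr_op :: "'v::euclidean_space \<Rightarrow> 'v \<Rightarrow> real \<Rightarrow> ('v \<Rightarrow> complex) \<Rightarrow> 'v \<Rightarrow> complex"
  where "cr_op e1 e2 \<mu> f = (\<lambda>x. 1 / 2 * (dd e1 f x + \<i> / of_real \<mu> * dd e2 f x))"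

lemma plane_bounded_linear: "bounded_linear (plane e1 e2)"
  unfolding plane_def[abs_def]
  by (intro bounded_linear_add bounded_linear_scaleR_const bounded_linear_fst bounded_linear_snd)

lemma ode_kernel_continuous: "continuous_on S (ode_kernel \<mu> n)"
  unfolding ode_kernel_def[abs_def] by (intro continuous_intros)

lemma mode_kernel_continuous: "continuous_on S (mode_kernel \<mu> n)"
  unfolding mode_kernel_def[abs_def] divide_inverse
  by (intro continuous_intros continuous_on_compose2[OF ode_kernel_continuous[of UNIV]]
      continuous_on_compose2[OF fexp_continuous[of UNIV]]) auto

text \<open>The bound must not depend on n, which carries either sign. With y = 2 pi n
  \<open>\<mu>\<close>, a large numerator exp (t y) is balanced by the denominator for y > 0, and
  for y < 0 it is at most 1; in both cases |y| \<ge> 2 pi |\<open>\<mu>\<close>| keeps exp y away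
  from 1.\<close>

lemma ode_kernel_bound:
  assumes mu: "\<mu> \<noteq> 0" and n: "n \<noteq> 0" and t: "0 \<le> t" "t \<le> 1"
  shows "norm (ode_kernel \<mu> n t) \<le> \<bar>\<mu>\<bar> / (1 - exp (- (2 * pi * \<bar>\<mu>\<bar>)))"
proof -
  define y where "y = 2 * pi * of_int n * \<mu>"
  have "\<bar>real_of_int n\<bar> \<ge> 1" using n by linarith
  then have "(2 * pi * \<bar>\<mu>\<bar>) * 1 \<le> (2 * pi * \<bar>\<mu>\<bar>) * \<bar>real_of_int n\<bar>" by (intro mult_left_mono) auto
  then have y: "2 * pi * \<bar>\<mu>\<bar> \<le> \<bar>y\<bar>" by (simp add: y_def abs_mult mult_ac)
  have pos: "0 < 2 * pi * \<bar>\<mu>\<bar>" using mu by simp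
  have "exp (t * y) / \<bar>exp y - 1\<bar> \<le> 1 / (1 - exp (- \<bar>y\<bar>))"
  proof (cases "y > 0")
    case True
    have "t * y \<le> 1 * y" using t True by (intro mult_right_mono) auto
    then have "exp (t * y) / \<bar>exp y - 1\<bar> \<le> exp y / (exp y - 1)"
      using True by (auto intro!: divide_right_mono)
    also have "\<dots> = 1 / (1 - exp (- y))" using True by (simp add: exp_minus divide_simps)
    finally show ?thesis using True by simp
  next
    case False
    then have "y < 0" using y pos by linarith
    moreover have "exp (t * y) \<le> 1" using t False by (simp add: mult_nonneg_nonpos)
    ultimately show ?thesis by (auto intro!: divide_right_mono)
  qed
  also have "\<dots> \<le> 1 / (1 - exp (- (2 * pi * \<bar>\<mu>\<bar>)))"
    using y pos by (intro divide_left_mono) (auto intro!: mult_pos_pos)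
  finally have b: "exp (t * y) / \<bar>exp y - 1\<bar> \<le> 1 / (1 - exp (- (2 * pi * \<bar>\<mu>\<bar>)))" .
  have "complex_of_real (exp y) - 1 = of_real (exp y - 1)" by simp
  then have "norm (complex_of_real (exp y) - 1) = \<bar>exp y - 1\<bar>" by (metis norm_of_real)
  moreover have "norm (exp (complex_of_real t * complex_of_real y)) = exp (t * y)"
    by (simp add: norm_exp_eq_Re)
  ultimately have "norm (ode_kernel \<mu> n t) = \<bar>\<mu>\<bar> * (exp (t * y) / \<bar>exp y - 1\<bar>)"
    unfolding ode_kernel_def y_def[symmetric] by (simp add: norm_mult norm_divide exp_of_real)
  also have "\<dots> \<le> \<bar>\<mu>\<bar> * (1 / (1 - exp (- (2 * pi * \<bar>\<mu>\<bar>))))"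
    by (intro mult_left_mono b) simp
  finally show ?thesis by simp
qed

lemma mode_kernel_bound:
  assumes mu: "\<mu> \<noteq> 0" and n: "n \<noteq> 0" and p: "p \<in> cbox (0, 0) (1, 1)"
  shows "norm (mode_kernel \<mu> n p) \<le> \<bar>\<mu>\<bar> / (1 - exp (- (2 * pi * \<bar>\<mu>\<bar>))) * inverse ((real_of_int n)\<^sup>2)"
proof -
  let ?C = "\<bar>\<mu>\<bar> / (1 - exp (- (2 * pi * \<bar>\<mu>\<bar>)))"
  have "0 \<le> snd p" "snd p \<le> 1" using p by (cases p; simp add: cbox_Pair_eq)+
  then have b: "norm (ode_kernel \<mu> n (snd p)) \<le> ?C" by (rule ode_kernel_bound[OF mu n])
  have C0: "?C \<ge> 0" using b norm_ge_zero order_trans by blast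
  have "2 * pi \<ge> 1" using pi_gt3 by linarith
  then have "1 * \<bar>real_of_int n\<bar> \<le> (2 * pi) * \<bar>real_of_int n\<bar>" by (intro mult_right_mono) auto
  then have "(real_of_int n)\<^sup>2 \<le> (2 * pi * \<bar>real_of_int n\<bar>)\<^sup>2" 
    by (metis abs_ge_zero mult_1 power2_abs power_mono)
  then have "inverse ((2 * pi * \<bar>real_of_int n\<bar>)\<^sup>2) \<le> inverse ((real_of_int n)\<^sup>2)"
    using n by (intro le_imp_inverse_le) auto
  then have "norm (ode_kernel \<mu> n (snd p)) * inverse ((2 * pi * \<bar>real_of_int n\<bar>)\<^sup>2) \<le> ?C * inverse ((real_of_int n)\<^sup>2)"
    by (intro mult_mono b C0) auto
  moreover have "norm (2 * of_real pi * \<i> * of_int n) = 2 * pi * \<bar>real_of_int n\<bar>"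
    by (simp add: norm_mult)
  ultimately show ?thesis
    unfolding mode_kernel_def norm_mult norm_divide norm_power norm_fexp by (simp add: divide_inverse)
qed

lemma green_kernel_uniform:
  assumes mu: "\<mu> \<noteq> 0"
  shows "uniform_limit (cbox (0, 0) (1, 1))
    (\<lambda>M p. \<Sum>m<M. mode_kernel \<mu> (int (Suc m)) p + mode_kernel \<mu> (- int (Suc m)) p) (green_kernel \<mu>) sequentially"
  unfolding green_kernel_def[abs_def]
proof (rule Weierstrass_m_test)
  let ?C = "\<bar>\<mu>\<bar> / (1 - exp (- (2 * pi * \<bar>\<mu>\<bar>)))"
  fix m and p :: "real \<times> real" assume p: "p \<in> cbox (0, 0) (1, 1)"
  show "norm (mode_kernel \<mu> (int (Suc m)) p + mode_kernel \<mu> (- int (Suc m)) p) \<le> (2 * ?C) * inverse (real (Suc m) ^ 2)"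
  proof -
    have "(real_of_int (- int (Suc m)))\<^sup>2 = (real (Suc m))\<^sup>2" by (simp add: power2_eq_square algebra_simps)
    then have "norm (mode_kernel \<mu> (int (Suc m)) p) \<le> ?C * inverse (real (Suc m) ^ 2)"
      "norm (mode_kernel \<mu> (- int (Suc m)) p) \<le> ?C * inverse (real (Suc m) ^ 2)"
      using mode_kernel_bound[OF mu _ p, of "int (Suc m)"] mode_kernel_bound[OF mu _ p, of "- int (Suc m)"]
      by (simp_all only: of_int_of_nat_eq)
    then show ?thesis
      using norm_triangle_ineq[of "mode_kernel \<mu> (int (Suc m)) p" "mode_kernel \<mu> (- int (Suc m)) p"]
      unfolding mult.assoc[of 2] by linarith
  qed
next
  have "summable (\<lambda>n. inverse (real n ^ 2))" using inverse_power_summable[of 2, where 'a = real] by simp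
  then have "summable (\<lambda>n. inverse (real (Suc n) ^ 2))" by (subst summable_Suc_iff)
  then show "summable (\<lambda>m. (2 * (\<bar>\<mu>\<bar> / (1 - exp (- (2 * pi * \<bar>\<mu>\<bar>))))) * inverse (real (Suc m) ^ 2))"
    by (rule summable_mult)
qed

lemma green_kernel_continuous: "\<mu> \<noteq> 0 \<Longrightarrow> continuous_on (cbox (0, 0) (1, 1)) (green_kernel \<mu>)"
  by (rule uniform_limit_theorem[OF _ green_kernel_uniform])
    (auto intro!: always_eventually continuous_intros mode_kernel_continuous)

lemma cint_plane:
  assumes k: "continuous_on UNIV k1" "continuous_on UNIV k2" and f: "smooth f"
  shows "cint (0, 0) (1, 1) (\<lambda>p. k1 (fst p) * k2 (snd p)) (plane e1 e2) f = lint k1 e1 (lint k2 e2 f)"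
proof
  fix x
  have "continuous_on (cbox (0, 0) (1, 1)) (\<lambda>p. k1 (fst p) * k2 (snd p) * f (x + plane e1 e2 p))"
    by (rule cint_continuous[OF _ plane_bounded_linear f])
      (intro continuous_intros continuous_on_compose2[OF k(1)] continuous_on_compose2[OF k(2)]; auto)
  from integral_prod_continuous[OF this]
  show "cint (0, 0) (1, 1) (\<lambda>p. k1 (fst p) * k2 (snd p)) (plane e1 e2) f x = lint k1 e1 (lint k2 e2 f) x"
    by (simp add: cint_def plane_def mult.assoc add.assoc integral_mult_right)
qed

text \<open>Uniform convergence on the unit square allows the kernel to be integrated mode by
  mode.\<close>

lemma cint_green_kernel_sums:
  assumes mu: "\<mu> \<noteq> 0" and h: "smooth h"
  shows "(\<lambda>M. \<Sum>m<M. cint (0, 0) (1, 1) (mode_kernel \<mu> (int (Suc m))) (plane e1 e2) h x +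
      cint (0, 0) (1, 1) (mode_kernel \<mu> (- int (Suc m))) (plane e1 e2) h x)
    \<longlonglongrightarrow> cint (0, 0) (1, 1) (green_kernel \<mu>) (plane e1 e2) h x"
proof -
  let ?B = "cbox (0, 0) (1, 1) :: (real \<times> real) set"
  let ?S = "\<lambda>M p. \<Sum>m<M. mode_kernel \<mu> (int (Suc m)) p + mode_kernel \<mu> (- int (Suc m)) p"
  have Sc: "continuous_on ?B (?S M)" for M
    by (intro continuous_intros mode_kernel_continuous)
  have hc: "continuous_on ?B (\<lambda>p. h (x + plane e1 e2 p))"
    using cint_continuous[OF continuous_on_const plane_bounded_linear h, of _ _ 1] by simp
  have Shc: "continuous_on ?B (\<lambda>p. ?S M p * h (x + plane e1 e2 p))" for M
    by (rule continuous_on_mult[OF Sc hc])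
  have U: "uniform_limit ?B (\<lambda>M p. ?S M p * h (x + plane e1 e2 p)) (\<lambda>p. green_kernel \<mu> p * h (x + plane e1 e2 p)) sequentially"
    by (intro uniform_lim_mult green_kernel_uniform mu uniform_limit_const compact_imp_bounded
        compact_continuous_image hc green_kernel_continuous compact_cbox)
  obtain I J where I: "\<And>M. ((\<lambda>p. ?S M p * h (x + plane e1 e2 p)) has_integral I M) ?B"
    and J: "((\<lambda>p. green_kernel \<mu> p * h (x + plane e1 e2 p)) has_integral J) ?B" and lim: "I \<longlonglongrightarrow> J"
    using uniform_limit_integral_cbox[OF U Shc sequentially_bot] by blast
  have JJ: "J = cint (0, 0) (1, 1) (green_kernel \<mu>) (plane e1 e2) h x"
    unfolding cint_def using J integral_unique by metis
  have II: "I M = (\<Sum>m<M. cint (0, 0) (1, 1) (mode_kernel \<mu> (int (Suc m))) (plane e1 e2) h x +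
      cint (0, 0) (1, 1) (mode_kernel \<mu> (- int (Suc m))) (plane e1 e2) h x)" for M
  proof -
    have "((\<lambda>p. ?S M p * h (x + plane e1 e2 p)) has_integral
      (\<Sum>m<M. cint (0, 0) (1, 1) (mode_kernel \<mu> (int (Suc m))) (plane e1 e2) h x +
        cint (0, 0) (1, 1) (mode_kernel \<mu> (- int (Suc m))) (plane e1 e2) h x)) ?B"
      unfolding cint_def sum_distrib_right distrib_right
      by (intro has_integral_sum has_integral_add integrable_integral
          cint_integrable mode_kernel_continuous plane_bounded_linear h) auto
    then show ?thesis using I has_integral_unique by blast
  qed
  show ?thesis unfolding II[symmetric] JJ[symmetric] by (rule lim)
qed

lemma lint_smooth: "continuous_on UNIV k \<Longrightarrow> smooth f \<Longrightarrow> smooth (lint k e f)"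
  by (intro smooth_cint bounded_linear_scaleR_left) (auto elim: continuous_on_subset)

lemma dd_lint: "continuous_on UNIV k \<Longrightarrow> smooth f \<Longrightarrow> dd v (lint k e f) = lint k e (dd v f)"
  by (intro dd_cint bounded_linear_scaleR_left) (auto elim: continuous_on_subset)

lemma lint_add: "continuous_on UNIV k \<Longrightarrow> smooth f \<Longrightarrow> smooth g \<Longrightarrow>
    lint k e (\<lambda>x. f x + g x) = (\<lambda>x. lint k e f x + lint k e g x)"
  by (intro cint_add bounded_linear_scaleR_left) (auto elim: continuous_on_subset)

lemma lint_periodic: "(\<And>x. f (x + c) = f x) \<Longrightarrow> lint k e f (x + c) = lint k e f x"
  by (metis (no_types, lifting) cint_translate ext)

lemma lint_const_dd:
  assumes "smooth f" "\<And>x. f (x + e) = f x"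
  shows "lint (\<lambda>_. 1) e (dd e f) = (\<lambda>x. 0)"
proof
  fix x
  have "lint (\<lambda>_. 0) e f x = 0" by (simp add: cint_def)
  then show "lint (\<lambda>_. 1) e (dd e f) x = 0"
    using lint_parts[of "\<lambda>_. 1" "\<lambda>_. 0" f e x] assms by auto
qed

lemma lint_fexp_dd:
  assumes "smooth f" "\<And>x. f (x + e) = f x"
  shows "lint (fexp n) e (dd e f) = (\<lambda>x. (2 * of_real pi * \<i> * of_int n) * lint (fexp n) e f x)"
proof
  fix x
  have "lint (\<lambda>t. - (2 * of_real pi * \<i> * of_int n) * fexp n t) e f x =
      - (2 * of_real pi * \<i> * of_int n) * lint (fexp n) e f x"
    by (simp only: cint_def mult.assoc integral_mult_right)
  then show "lint (fexp n) e (dd e f) x = (2 * of_real pi * \<i> * of_int n) * lint (fexp n) e f x"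
    by (subst lint_parts[OF fexp_has_vector_derivative _ assms(1)])
      (auto intro!: continuous_intros simp: assms(2))
qed

text \<open>The kernel solves k' = y k and jumps by -\<i> \<open>\<mu>\<close> over one period.
  Integration by parts turns the jump into \<open>f x\<close> and k' into the multiple of the
  solution.\<close>

lemma lint_ode_kernel_dd:
  assumes mu: "\<mu> \<noteq> 0" and n: "n \<noteq> 0" and "smooth f" "\<And>x. f (x + e) = f x"
  shows "\<i> / of_real \<mu> * lint (ode_kernel \<mu> n) e (dd e f) x =
     f x - (2 * of_real pi * \<i> * of_int n) * lint (ode_kernel \<mu> n) e f x"
proof -
  let ?y = "complex_of_real (2 * pi * of_int n * \<mu>)"
  let ?\<kappa> = "- \<i> * of_real \<mu> / (exp ?y - 1)"
  have y: "exp ?y \<noteq> 1" using mu n by (simp add: exp_eq_1)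
  have der: "(ode_kernel \<mu> n has_vector_derivative ?y * ode_kernel \<mu> n t) (at t)" for t
    using has_vector_derivative_mult_right[OF exp_has_vector_derivative[of ?y t UNIV], of ?\<kappa>]
    unfolding ode_kernel_def[abs_def] by (simp only: mult_ac)
  have "lint (\<lambda>t. ?y * ode_kernel \<mu> n t) e f x = ?y * lint (ode_kernel \<mu> n) e f x"
    by (simp only: cint_def mult.assoc integral_mult_right)
  then have "lint (ode_kernel \<mu> n) e (dd e f) x =
      ode_kernel \<mu> n 1 * f x - ode_kernel \<mu> n 0 * f x - ?y * lint (ode_kernel \<mu> n) e f x"
    by (subst lint_parts[OF der _ assms(3)])
      (auto intro!: continuous_intros ode_kernel_continuous simp: assms(4))
  also have "ode_kernel \<mu> n 1 * f x - ode_kernel \<mu> n 0 * f x = ?\<kappa> * (exp ?y - 1) * f x"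
  proof -
    have "ode_kernel \<mu> n 1 = ?\<kappa> * exp ?y" "ode_kernel \<mu> n 0 = ?\<kappa>"
      by (simp_all add: ode_kernel_def)
    then show ?thesis by (simp only: left_diff_distrib right_diff_distrib mult_1_right)
  qed
  also have "?\<kappa> * (exp ?y - 1) = - \<i> * of_real \<mu>" using y by simp
  finally have eq: "lint (ode_kernel \<mu> n) e (dd e f) x =
      - \<i> * of_real \<mu> * f x - ?y * lint (ode_kernel \<mu> n) e f x" .
  show ?thesis unfolding eq using mu by (simp add: field_simps)
qed

text \<open>On the n-th Fourier mode in direction \<open>e1\<close> the derivative
  \<open>dd e1\<close> is multiplication by 2 pi \<i> n, so the Cauchy-Riemann equation becomes the
  ordinary differential equation in direction \<open>e2\<close> that \<open>ode_kernel\<close>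
  solves.\<close>

lemma mode_inverts:
  assumes mu: "\<mu> \<noteq> 0" and n: "n \<noteq> 0" and f: "smooth f"
    and per: "\<And>x. f (x + e1) = f x" "\<And>x. f (x + e2) = f x"
  shows "lint (fexp n) e1 (lint (ode_kernel \<mu> n) e2 (\<lambda>x. dd e1 f x + \<i> / of_real \<mu> * dd e2 f x)) = lint (fexp n) e1 f"
proof -
  define u where "u = lint (ode_kernel \<mu> n) e2 f"
  have oc: "continuous_on UNIV (ode_kernel \<mu> n)" and fc: "continuous_on UNIV (fexp n)"
    by (rule ode_kernel_continuous fexp_continuous)+
  have u: "smooth u" unfolding u_def by (rule lint_smooth[OF oc f])
  have uper: "u (x + e1) = u x" for x unfolding u_def by (rule lint_periodic) (rule per)
  have "lint (ode_kernel \<mu> n) e2 (\<lambda>x. dd e1 f x + \<i> / of_real \<mu> * dd e2 f x) =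
      (\<lambda>x. lint (ode_kernel \<mu> n) e2 (dd e1 f) x + \<i> / of_real \<mu> * lint (ode_kernel \<mu> n) e2 (dd e2 f) x)"
    using lint_add[OF oc smooth_dd[OF f] smooth_cmult[OF smooth_dd[OF f]]] by (simp only: cint_cmult)
  also have "\<dots> = (\<lambda>x. dd e1 u x + (f x + - (2 * of_real pi * \<i> * of_int n) * u x))"
    unfolding lint_ode_kernel_dd[OF mu n f per(2)] dd_lint[OF oc f, of e1 e2, symmetric] u_def[symmetric]
    by (simp add: fun_eq_iff)
  finally have eq: "lint (ode_kernel \<mu> n) e2 (\<lambda>x. dd e1 f x + \<i> / of_real \<mu> * dd e2 f x) =
    (\<lambda>x. dd e1 u x + (f x + - (2 * of_real pi * \<i> * of_int n) * u x))" .
  have "lint (fexp n) e1 (lint (ode_kernel \<mu> n) e2 (\<lambda>x. dd e1 f x + \<i> / of_real \<mu> * dd e2 f x)) =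
    (\<lambda>x. lint (fexp n) e1 (dd e1 u) x +
      (lint (fexp n) e1 f x + - (2 * of_real pi * \<i> * of_int n) * lint (fexp n) e1 u x))"
    unfolding eq lint_add[OF fc smooth_dd[OF u] smooth_add[OF f smooth_cmult[OF u]]]
      lint_add[OF fc f smooth_cmult[OF u]] cint_cmult ..
  also have "\<dots> = lint (fexp n) e1 f"
    unfolding lint_fexp_dd[OF u uper] by (simp add: fun_eq_iff)
  finally show ?thesis .
qed

lemma mode_kernel_inverts:
  assumes mu: "\<mu> \<noteq> 0" and n: "n \<noteq> 0" and f: "smooth f"
    and per: "\<And>x. f (x + e1) = f x" "\<And>x. f (x + e2) = f x"
    and g_def: "g = (\<lambda>x. dd e1 f x + \<i> / of_real \<mu> * dd e2 f x)"
  shows "cint (0, 0) (1, 1) (mode_kernel \<mu> n) (plane e1 e2) (dd e1 (dd e1 g)) = lint (fexp n) e1 f"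
proof -
  let ?c = "2 * of_real pi * \<i> * of_int n :: complex"
  have c: "?c \<noteq> 0" using n by simp
  have oc: "continuous_on UNIV (ode_kernel \<mu> n)" and fc: "continuous_on UNIV (fexp n)"
    by (rule ode_kernel_continuous fexp_continuous)+
  have g: "smooth g" unfolding g_def by (intro smooth_cmult smooth_add smooth_dd f)
  have fper: "(\<lambda>x. f (x + e1)) = f" using per by auto
  have gper: "g (x + e1) = g x" for x
    unfolding g_def using dd_translate[OF f, of _ e1 x] fper by simp
  define u where "u = lint (ode_kernel \<mu> n) e2 g"
  have u: "smooth u" unfolding u_def by (rule lint_smooth[OF oc g])
  have uper: "u (x + e1) = u x" for x unfolding u_def by (rule lint_periodic) (rule gper)
  have dper: "dd e1 u (x + e1) = dd e1 u x" for x
    using dd_translate[OF u, of e1 e1 x] uper by simp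
  \<comment> \<open>Two derivatives in direction \<open>e1\<close> give the square of
    \<open>?c\<close>, which will cancel the denominator of \<open>mode_kernel\<close>.\<close>
  have "lint (fexp n) e1 (dd e1 (dd e1 u)) = (\<lambda>x. ?c * (?c * lint (fexp n) e1 u x))"
    unfolding lint_fexp_dd[OF smooth_dd[OF u] dper] lint_fexp_dd[OF u uper] ..
  moreover have "dd e1 (dd e1 u) = lint (ode_kernel \<mu> n) e2 (dd e1 (dd e1 g))"
    unfolding u_def dd_lint[OF oc g] dd_lint[OF oc smooth_dd[OF g]] ..
  moreover have "lint (fexp n) e1 u = lint (fexp n) e1 f"
    unfolding u_def g_def by (rule mode_inverts[OF mu n f per])
  ultimately have main: "lint (fexp n) e1 (lint (ode_kernel \<mu> n) e2 (dd e1 (dd e1 g))) = (\<lambda>x. ?c\<^sup>2 * lint (fexp n) e1 f x)"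
    by (simp only: power2_eq_square mult.assoc)
  have "mode_kernel \<mu> n = (\<lambda>p. fexp n (fst p) * ((\<lambda>t. ode_kernel \<mu> n t / ?c\<^sup>2) (snd p)))"
    by (simp add: mode_kernel_def fun_eq_iff)
  then have "cint (0, 0) (1, 1) (mode_kernel \<mu> n) (plane e1 e2) (dd e1 (dd e1 g)) =
      lint (fexp n) e1 (lint (\<lambda>t. ode_kernel \<mu> n t / ?c\<^sup>2) e2 (dd e1 (dd e1 g)))"
    using cint_plane[OF fc _ smooth_dd[OF smooth_dd[OF g]], of "\<lambda>t. ode_kernel \<mu> n t / ?c\<^sup>2" e1 e2 e1 e1] c
    by (simp add: oc continuous_on_divide)
  also have "lint (\<lambda>t. ode_kernel \<mu> n t / ?c\<^sup>2) e2 (dd e1 (dd e1 g)) =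
     (\<lambda>x. 1 / ?c\<^sup>2 * lint (ode_kernel \<mu> n) e2 (dd e1 (dd e1 g)) x)"
    unfolding cint_def integral_mult_right[symmetric] by (simp add: fun_eq_iff)
  also have "lint (fexp n) e1 \<dots> = (\<lambda>x. 1 / ?c\<^sup>2 * (?c\<^sup>2 * lint (fexp n) e1 f x))"
    unfolding cint_cmult main ..
  also have "\<dots> = lint (fexp n) e1 f" using c by simp
  finally show ?thesis .
qed

text \<open>Mode 0 in direction \<open>e1\<close> contributes mode 0 of \<open>f\<close> minus the
  average; the other modes contribute \<open>f\<close> minus its mode 0, by Fourier inversion along
  the line through x. The two parts telescope.\<close>

lemma green_cr_op:
  assumes mu: "\<mu> \<noteq> 0" and f: "smooth f"
    and per: "\<And>x. f (x + e1) = f x" "\<And>x. f (x + e2) = f x"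
  shows "green e1 e2 \<mu> (cr_op e1 e2 \<mu> f) = (\<lambda>x. f x - avg e1 e2 f x)"
proof
  fix x
  define g where "g = (\<lambda>x. dd e1 f x + \<i> / of_real \<mu> * dd e2 f x)"
  have g: "smooth g" unfolding g_def by (intro smooth_cmult smooth_add smooth_dd f)
  have cr: "cr_op e1 e2 \<mu> f = (\<lambda>x. 1 / 2 * g x)" by (simp add: cr_op_def g_def)
  \<comment> \<open>Kernel for mode 0: its jump over a period is -\<i> \<open>\<mu>\<close>, as for
    \<open>ode_kernel\<close>, and its constant derivative produces the mean over
    \<open>e2\<close>.\<close>
  define k0 where "k0 t = - \<i> * of_real \<mu> * complex_of_real t" for t
  have k0c: "continuous_on S k0" for S unfolding k0_def[abs_def] by (intro continuous_intros)
  have k0d: "(k0 has_vector_derivative - \<i> * of_real \<mu> * 1) (at t)" for t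
    unfolding k0_def[abs_def] by (rule has_vector_derivative_mult_right) (auto intro!: derivative_eq_intros)
  have 1: "continuous_on UNIV (\<lambda>t::real. 1 :: complex)" by (rule continuous_on_const)
  define v where "v = lint k0 e2 f"
  have v: "smooth v" unfolding v_def by (rule lint_smooth[OF k0c f])
  have vper: "v (y + e1) = v y" for y unfolding v_def by (rule lint_periodic) (rule per)
  have "lint k0 e2 g = (\<lambda>y. dd e1 v y + \<i> / of_real \<mu> * lint k0 e2 (dd e2 f) y)"
    unfolding g_def v_def dd_lint[OF k0c f]
    using lint_add[OF k0c smooth_dd[OF f] smooth_cmult[OF smooth_dd[OF f]]] by (simp only: cint_cmult)
  also have "\<dots> = (\<lambda>y. dd e1 v y + (f y + - 1 * lint (\<lambda>_. 1) e2 f y))"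
  proof
    fix y
    have "lint (\<lambda>t. - \<i> * of_real \<mu> * 1) e2 f y = - \<i> * of_real \<mu> * lint (\<lambda>_. 1) e2 f y"
      by (simp only: cint_def mult.assoc integral_mult_right)
    then have eq: "lint k0 e2 (dd e2 f) y = - \<i> * of_real \<mu> * f y + \<i> * of_real \<mu> * lint (\<lambda>_. 1) e2 f y"
      using lint_parts[OF k0d continuous_on_const f, of e2 y] per(2)[of y] by (simp add: k0_def)
    show "dd e1 v y + \<i> / of_real \<mu> * lint k0 e2 (dd e2 f) y = dd e1 v y + (f y + - 1 * lint (\<lambda>_. 1) e2 f y)"
      unfolding eq using mu by (simp add: field_simps)
  qed
  finally have eq: "lint k0 e2 g = (\<lambda>y. dd e1 v y + (f y + - 1 * lint (\<lambda>_. 1) e2 f y))" .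
  have "lint (\<lambda>_. 1) e1 (lint k0 e2 g) =
      (\<lambda>y. lint (\<lambda>_. 1) e1 (dd e1 v) y + (lint (\<lambda>_. 1) e1 f y + - 1 * avg e1 e2 f y))"
    unfolding eq avg_def lint_add[OF 1 smooth_dd[OF v] smooth_add[OF f smooth_cmult[OF lint_smooth[OF 1 f]]]]
      lint_add[OF 1 f smooth_cmult[OF lint_smooth[OF 1 f]]] cint_cmult ..
  then have zero: "lint (\<lambda>_. 1) e1 (lint k0 e2 g) x = lint (\<lambda>_. 1) e1 f x - avg e1 e2 f x"
    unfolding lint_const_dd[OF v vper] by simp
  have "cint (0, 0) (1, 1) (\<lambda>p. 1 * k0 (snd p)) (plane e1 e2) g = lint (\<lambda>_. 1) e1 (lint k0 e2 g)"
    by (rule cint_plane[OF 1 k0c g])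
  then have zero': "cint (0, 0) (1, 1) (\<lambda>p. - \<i> * of_real \<mu> * of_real (snd p)) (plane e1 e2) g x =
      lint (\<lambda>_. 1) e1 f x - avg e1 e2 f x"
    unfolding zero[symmetric] by (simp add: k0_def)
  have "(\<lambda>M. \<Sum>m<M. lint (fexp (int (Suc m))) e1 f x + lint (fexp (- int (Suc m))) e1 f x)
      \<longlonglongrightarrow> cint (0, 0) (1, 1) (green_kernel \<mu>) (plane e1 e2) (dd e1 (dd e1 g)) x"
    using cint_green_kernel_sums[OF mu smooth_dd[OF smooth_dd[OF g]], of e1 e2 e1 e1 x]
      mode_kernel_inverts[OF mu _ f per g_def] by simp
  moreover have "(\<lambda>M. \<Sum>m<M. lint (fexp (int (Suc m))) e1 f x + lint (fexp (- int (Suc m))) e1 f x)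
      \<longlonglongrightarrow> f x - lint (\<lambda>_. 1) e1 f x"
  proof -
    have sum: "(\<Sum>n\<in>{- int M..int M}. lint (fexp n) e1 f x) = lint (\<lambda>_. 1) e1 f x +
        (\<Sum>m<M. lint (fexp (int (Suc m))) e1 f x + lint (fexp (- int (Suc m))) e1 f x)" for M
    proof (induction M)
      case 0
      show ?case by (simp add: cint_def)
    next
      case (Suc M)
      have "{- int (Suc M)..int (Suc M)} = insert (- int (Suc M)) (insert (int (Suc M)) {- int M..int M})" by auto
      then have "(\<Sum>n\<in>{- int (Suc M)..int (Suc M)}. lint (fexp n) e1 f x) = lint (fexp (- int (Suc M))) e1 f x +
          (lint (fexp (int (Suc M))) e1 f x + (\<Sum>n\<in>{- int M..int M}. lint (fexp n) e1 f x))"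
        by simp
      then show ?case unfolding Suc by simp
    qed
    have "(\<lambda>M. \<Sum>n\<in>{- int M..int M}. lint (fexp n) e1 f x) \<longlonglongrightarrow> f (x + 0 *\<^sub>R e1)"
      unfolding cint_def cbox_interval
    proof (rule fourier_inversion[OF line_derivative[OF f]])
      show "f (x + (t + 1) *\<^sub>R e1) = f (x + t *\<^sub>R e1)" for t
        using per(1)[of "x + t *\<^sub>R e1"] by (simp add: algebra_simps)
    qed
    from tendsto_diff[OF this tendsto_const[of "lint (\<lambda>_. 1) e1 f x"]] show ?thesis
      unfolding sum by simp
  qed
  ultimately have "cint (0, 0) (1, 1) (green_kernel \<mu>) (plane e1 e2) (dd e1 (dd e1 g)) x = f x - lint (\<lambda>_. 1) e1 f x"
    by (rule LIMSEQ_unique)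
  then show "green e1 e2 \<mu> (cr_op e1 e2 \<mu> f) x = f x - avg e1 e2 f x"
    unfolding green_def cr using zero'
    by (simp only: dd_cmult[OF g] dd_cmult[OF smooth_dd[OF g]] cint_cmult) (simp add: field_simps)
qed

section \<open>Averages and Green operators in several variables\<close>

text \<open>The common properties of translation-invariant integral and differential operators in
  the directions \<open>U\<close>. They are stable under composition and supply commutation rules
  without inspecting kernels; the last clause lets factors that do not vary along \<open>U\<close>
  pass through.\<close>

definition convop :: "'v::euclidean_space set \<Rightarrow> (('v \<Rightarrow> complex) \<Rightarrow> 'v \<Rightarrow> complex) \<Rightarrow> bool"
  where "convop U T \<longleftrightarrow>
    (\<forall>f. smooth f \<longrightarrow> smooth (T f)) \<and>
    (\<forall>f v. smooth f \<longrightarrow> dd v (T f) = T (dd v f)) \<and>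
    (\<forall>f c. smooth f \<longrightarrow> T (\<lambda>x. f (x + c)) = (\<lambda>x. T f (x + c))) \<and>
    (\<forall>f g. smooth f \<longrightarrow> smooth g \<longrightarrow> T (\<lambda>x. f x + g x) = (\<lambda>x. T f x + T g x)) \<and>
    (\<forall>f \<phi>. smooth f \<longrightarrow> smooth \<phi> \<longrightarrow> (\<forall>u\<in>U. \<forall>x. \<phi> (x + u) = \<phi> x) \<longrightarrow>
       T (\<lambda>x. \<phi> x * f x) = (\<lambda>x. \<phi> x * T f x))"

lemma convopI:
  assumes "\<And>f. smooth f \<Longrightarrow> smooth (T f)"
    and "\<And>f v. smooth f \<Longrightarrow> dd v (T f) = T (dd v f)"
    and "\<And>f c. smooth f \<Longrightarrow> T (\<lambda>x. f (x + c)) = (\<lambda>x. T f (x + c))"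
    and "\<And>f g. smooth f \<Longrightarrow> smooth g \<Longrightarrow> T (\<lambda>x. f x + g x) = (\<lambda>x. T f x + T g x)"
    and "\<And>f \<phi>. smooth f \<Longrightarrow> smooth \<phi> \<Longrightarrow> (\<And>u x. u \<in> U \<Longrightarrow> \<phi> (x + u) = \<phi> x) \<Longrightarrow>
       T (\<lambda>x. \<phi> x * f x) = (\<lambda>x. \<phi> x * T f x)"
  shows "convop U T"
  unfolding convop_def by (intro conjI allI impI assms) auto

lemma convop_smooth:
  assumes T: "convop U T" and f: "smooth f"
  shows "smooth (T f)"
  by (rule T[unfolded convop_def, THEN conjunct1, THEN spec[of _ f], THEN mp, OF f])

lemma convop_dd:
  assumes T: "convop U T" and f: "smooth f"
  shows "dd v (T f) = T (dd v f)"
  by (rule T[unfolded convop_def, THEN conjunct2, THEN conjunct1,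
        THEN spec[of _ f], THEN spec[of _ v], THEN mp, OF f])

lemma convop_translate:
  assumes T: "convop U T" and f: "smooth f"
  shows "T (\<lambda>x. f (x + c)) = (\<lambda>x. T f (x + c))"
  by (rule T[unfolded convop_def, THEN conjunct2, THEN conjunct2, THEN conjunct1,
        THEN spec[of _ f], THEN spec[of _ c], THEN mp, OF f])

lemma convop_add:
  assumes T: "convop U T" and f: "smooth f" and g: "smooth g"
  shows "T (\<lambda>x. f x + g x) = (\<lambda>x. T f x + T g x)"
  by (rule T[unfolded convop_def, THEN conjunct2, THEN conjunct2, THEN conjunct2, THEN conjunct1,
        THEN spec[of _ f], THEN spec[of _ g], THEN mp, OF f, THEN mp, OF g])

lemma convop_mult:
  assumes T: "convop U T" and f: "smooth f" and \<phi>: "smooth \<phi>"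
    and inv: "\<And>u x. u \<in> U \<Longrightarrow> \<phi> (x + u) = \<phi> x"
  shows "T (\<lambda>x. \<phi> x * f x) = (\<lambda>x. \<phi> x * T f x)"
proof -
  have "\<forall>u\<in>U. \<forall>x. \<phi> (x + u) = \<phi> x" using inv by simp
  then show ?thesis
    by (rule T[unfolded convop_def, THEN conjunct2, THEN conjunct2, THEN conjunct2, THEN conjunct2,
          THEN spec[of _ f], THEN spec[of _ \<phi>], THEN mp, OF f, THEN mp, OF \<phi>, THEN mp])
qed

lemma convop_cmult: "convop U T \<Longrightarrow> smooth f \<Longrightarrow> T (\<lambda>x. c * f x) = (\<lambda>x. c * T f x)"
  by (rule convop_mult) (auto intro: smooth_const)

lemma convop_zero: "convop U T \<Longrightarrow> T (\<lambda>x. 0) = (\<lambda>x. 0)"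
  using convop_cmult[of U T "\<lambda>x. 0" 0] smooth_const[of 0] by simp

lemma convop_periodic:
  assumes "convop U T" "smooth f" "\<And>x. f (x + c) = f x"
  shows "T f (x + c) = T f x"
proof -
  have "T (\<lambda>x. f (x + c)) x = T f (x + c)" using convop_translate[OF assms(1,2)] by metis
  then show ?thesis using assms(3) by simp
qed

lemma convop_cint:
  assumes "continuous_on (cbox a b) k" "bounded_linear L" "\<And>t. L t \<in> U"
  shows "convop U (cint a b k L)"
proof (rule convopI)
  show "cint a b k L (\<lambda>x. \<phi> x * f x) = (\<lambda>x. \<phi> x * cint a b k L f x)"
    if "\<And>u x. u \<in> U \<Longrightarrow> \<phi> (x + u) = \<phi> x" for f \<phi>
    by (rule cint_mult) (rule that[OF assms(3)])
qed (rule smooth_cint dd_cint cint_translate cint_add; (rule assms | assumption))+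

lemma convop_comp:
  assumes S: "convop U S" and T: "convop U T"
  shows "convop U (\<lambda>f. S (T f))"
proof (rule convopI)
  fix f :: "'a \<Rightarrow> complex" and v c g
  assume f: "smooth f"
  note Tf = convop_smooth[OF T f]
  show "smooth (S (T f))" by (rule convop_smooth[OF S Tf])
  show "dd v (S (T f)) = S (T (dd v f))" unfolding convop_dd[OF S Tf] convop_dd[OF T f] ..
  show "S (T (\<lambda>x. f (x + c))) = (\<lambda>x. S (T f) (x + c))"
    unfolding convop_translate[OF T f] convop_translate[OF S Tf] ..
  show "S (T (\<lambda>x. f x + g x)) = (\<lambda>x. S (T f) x + S (T g) x)" if g: "smooth g"
    unfolding convop_add[OF T f g] convop_add[OF S Tf convop_smooth[OF T g]] ..
  show "S (T (\<lambda>x. \<phi> x * f x)) = (\<lambda>x. \<phi> x * S (T f) x)"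
    if "smooth \<phi>" "\<And>u x. u \<in> U \<Longrightarrow> \<phi> (x + u) = \<phi> x" for \<phi>
    using convop_mult[OF T f that] convop_mult[OF S Tf that] by simp
qed

lemma convop_dd_op:
  assumes U: "subspace U" and e: "e \<in> U"
  shows "convop U (dd e)"
proof (rule convopI)
  fix f :: "'a \<Rightarrow> complex" and v c g
  assume f: "smooth f"
  show "smooth (dd e f)" by (rule smooth_dd[OF f])
  show "dd v (dd e f) = dd e (dd v f)" by (rule dd_commute[OF f])
  show "dd e (\<lambda>x. f (x + c)) = (\<lambda>x. dd e f (x + c))" by (rule dd_translate_fun[OF f])
  show "dd e (\<lambda>x. f x + g x) = (\<lambda>x. dd e f x + dd e g x)" if "smooth g" by (rule dd_add_fun[OF f that])
  show "dd e (\<lambda>x. \<phi> x * f x) = (\<lambda>x. \<phi> x * dd e f x)"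
    if \<phi>: "smooth \<phi>" and inv: "\<And>u x. u \<in> U \<Longrightarrow> \<phi> (x + u) = \<phi> x" for \<phi>
  proof -
    have "dd e \<phi> = (\<lambda>x. 0)" by (rule dd_eq_0[OF \<phi>]) (rule inv[OF subspace_scale[OF U e]])
    then show ?thesis by (simp add: dd_mult_fun[OF \<phi> f])
  qed
qed

lemma convop_plus:
  assumes S: "convop U S" and T: "convop U T"
  shows "convop U (\<lambda>f x. S f x + T f x)"
proof (rule convopI)
  fix f :: "'a \<Rightarrow> complex" and v c g
  assume f: "smooth f"
  note Tf = convop_smooth[OF T f] and Sf = convop_smooth[OF S f]
  show "smooth (\<lambda>x. S f x + T f x)" by (rule smooth_add[OF Sf Tf])
  show "dd v (\<lambda>x. S f x + T f x) = (\<lambda>x. S (dd v f) x + T (dd v f) x)"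
    unfolding dd_add_fun[OF Sf Tf] convop_dd[OF T f] convop_dd[OF S f] ..
  show "(\<lambda>x. S (\<lambda>x. f (x + c)) x + T (\<lambda>x. f (x + c)) x) = (\<lambda>x. S f (x + c) + T f (x + c))"
    unfolding convop_translate[OF T f] convop_translate[OF S f] ..
  show "(\<lambda>x. S (\<lambda>x. f x + g x) x + T (\<lambda>x. f x + g x) x) = (\<lambda>x. (S f x + T f x) + (S g x + T g x))" if g: "smooth g"
    unfolding convop_add[OF T f g] convop_add[OF S f g] by (simp add: add_ac)
  show "(\<lambda>x. S (\<lambda>x. \<phi> x * f x) x + T (\<lambda>x. \<phi> x * f x) x) = (\<lambda>x. \<phi> x * (S f x + T f x))"
    if "smooth \<phi>" "\<And>u x. u \<in> U \<Longrightarrow> \<phi> (x + u) = \<phi> x" for \<phi>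
    using convop_mult[OF T f that] convop_mult[OF S f that] by (simp add: distrib_left)
qed

lemma convop_scale:
  assumes T: "convop U T"
  shows "convop U (\<lambda>f x. c * T f x)"
proof (rule convopI)
  fix f :: "'a \<Rightarrow> complex" and v b g
  assume f: "smooth f"
  note Tf = convop_smooth[OF T f]
  show "smooth (\<lambda>x. c * T f x)" by (rule smooth_cmult[OF Tf])
  show "dd v (\<lambda>x. c * T f x) = (\<lambda>x. c * T (dd v f) x)"
    unfolding dd_cmult[OF Tf] convop_dd[OF T f] ..
  show "(\<lambda>x. c * T (\<lambda>x. f (x + b)) x) = (\<lambda>x. c * T f (x + b))"
    unfolding convop_translate[OF T f] ..
  show "(\<lambda>x. c * T (\<lambda>x. f x + g x) x) = (\<lambda>x. c * T f x + c * T g x)" if g: "smooth g"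
    unfolding convop_add[OF T f g] by (simp add: distrib_left)
  show "(\<lambda>x. c * T (\<lambda>x. \<phi> x * f x) x) = (\<lambda>x. \<phi> x * (c * T f x))"
    if "smooth \<phi>" "\<And>u x. u \<in> U \<Longrightarrow> \<phi> (x + u) = \<phi> x" for \<phi>
    using convop_mult[OF T f that] by (simp add: mult_ac)
qed

lemma convop_id: "convop U (\<lambda>f. f)"
  by (rule convopI) simp_all

lemma convop_zero_op: "convop U (\<lambda>f x. 0)"
  using convop_scale[OF convop_id, of _ 0] by simp

lemma convop_sum_op: "(\<And>i. i \<in> A \<Longrightarrow> convop U (T i)) \<Longrightarrow> convop U (\<lambda>f x. \<Sum>i\<in>A. T i f x)"
  by (induction A rule: infinite_finite_induct) (simp_all add: convop_zero_op convop_plus)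

lemma convop_lint:
  "subspace U \<Longrightarrow> e \<in> U \<Longrightarrow> continuous_on UNIV k \<Longrightarrow> convop U (lint k e)"
  by (rule convop_cint[OF continuous_on_subset bounded_linear_scaleR_left]) (auto intro: subspace_scale)

lemma convop_avg:
  assumes U: "subspace U" and e: "e1 \<in> U" "e2 \<in> U"
  shows "convop U (avg e1 e2)"
proof -
  have "avg e1 e2 = (\<lambda>f. lint (\<lambda>_. 1) e1 (lint (\<lambda>_. 1) e2 f))"
    by (rule ext) (rule avg_def)
  then show ?thesis
    using convop_comp[OF convop_lint[OF U e(1) continuous_on_const[of UNIV 1]]
        convop_lint[OF U e(2) continuous_on_const[of UNIV 1]]] by simp
qed

lemma convop_green:
  assumes "subspace U" "e1 \<in> U" "e2 \<in> U" "\<mu> \<noteq> 0"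
  shows "convop U (green e1 e2 \<mu>)"
proof -
  have "plane e1 e2 t \<in> U" for t
    unfolding plane_def by (intro subspace_add subspace_scale assms)
  note c = convop_cint[OF _ plane_bounded_linear this]
  have k0: "continuous_on (cbox (0, 0) (1, 1)) (\<lambda>p. - \<i> * of_real \<mu> * complex_of_real (snd p))"
    by (intro continuous_intros)
  have dde: "convop U (dd e1)" by (rule convop_dd_op[OF assms(1,2)])
  have "green e1 e2 \<mu> = (\<lambda>f x. 2 * (cint (0, 0) (1, 1) (\<lambda>p. - \<i> * of_real \<mu> * of_real (snd p)) (plane e1 e2) f x +
      cint (0, 0) (1, 1) (green_kernel \<mu>) (plane e1 e2) (dd e1 (dd e1 f)) x))"
    by (rule ext) (rule green_def)
  then show ?thesis
    using convop_scale[OF convop_plus[OF c[OF k0]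
        convop_comp[OF c[OF green_kernel_continuous[OF assms(4)]] convop_comp[OF dde dde]]], of 2] by simp
qed

lemma convop_cr_commute:
  assumes T: "convop U T" and f: "smooth f"
  shows "T (cr_op e1 e2 \<mu> f) = cr_op e1 e2 \<mu> (T f)"
proof -
  note s = smooth_dd[OF f]
  show ?thesis
    unfolding cr_op_def convop_cmult[OF T smooth_add[OF s smooth_cmult[OF s]]]
      convop_add[OF T s smooth_cmult[OF s]] convop_cmult[OF T s] convop_dd[OF T f] ..
qed

lemma avg_affine: "linear R \<Longrightarrow> avg (R e1) (R e2) f (c + R x) = avg e1 e2 (\<lambda>x. f (c + R x)) x"
  using cint_affine[of R 0 "1::real" "\<lambda>_. 1" "\<lambda>t. t *\<^sub>R _"]
  by (simp add: avg_def linear_scale)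

lemma green_affine:
  assumes R: "bounded_linear R" and f: "smooth f"
  shows "green (R e1) (R e2) \<mu> f (c + R x) = green e1 e2 \<mu> (\<lambda>x. f (c + R x)) x"
proof -
  interpret R: bounded_linear R by (rule R)
  have dR: "dd e (\<lambda>x. h (c + R x)) = (\<lambda>x. dd (R e) h (c + R x))" if "smooth h" for h e
    using dd_eqI[OF dd_affine[OF R that]] by blast
  have p: "plane (R e1) (R e2) = (\<lambda>t. R (plane e1 e2 t))"
    by (simp add: plane_def fun_eq_iff R.add R.scaleR)
  show ?thesis
    unfolding green_def p cint_affine[OF R.linear] dR[OF f] dR[OF smooth_dd[OF f]] ..
qed

lemma avg_dd_zero:
  assumes f: "smooth f" and per: "\<And>x. f (x + e1) = f x" "\<And>x. f (x + e2) = f x" and v: "v = e1 \<or> v = e2"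
  shows "dd v (avg e1 e2 f) = (\<lambda>x. 0)"
proof -
  have g: "convop UNIV (lint (\<lambda>_. 1) e)" for e :: 'a
    by (intro convop_lint subspace_UNIV UNIV_I continuous_on_const)
  note l = convop_smooth[OF g f]
  show ?thesis
    using v
  proof
    assume "v = e1"
    have "lint (\<lambda>_. 1) e2 f (x + e1) = lint (\<lambda>_. 1) e2 f x" for x
      by (rule lint_periodic) (rule per(1))
    then show ?thesis
      unfolding avg_def convop_dd[OF g l] \<open>v = e1\<close> by (intro lint_const_dd l)
  next
    assume "v = e2"
    show ?thesis
      unfolding avg_def convop_dd[OF g l] convop_dd[OF g f] \<open>v = e2\<close> lint_const_dd[OF f per(2)] convop_zero[OF g] ..
  qed
qed

primrec avgs :: "('j \<Rightarrow> 'v \<times> 'v) \<Rightarrow> 'j list \<Rightarrow> ('v::euclidean_space \<Rightarrow> complex) \<Rightarrow> 'v \<Rightarrow> complex"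
  where
    "avgs D [] f = f"
  | "avgs D (j # js) f = avg (fst (D j)) (snd (D j)) (avgs D js f)"

text \<open>The telescoping 1 - A_1 ... A_k = sum of (1 - A_j) A_(j+1) ... A_k splits the identity,
  and 1 - A_j is the Green operator of variable j after its Cauchy-Riemann operator. Hence each
  Green operator is applied to the average over the later variables.\<close>

primrec greens :: "('j \<Rightarrow> 'v \<times> 'v) \<Rightarrow> ('j \<Rightarrow> real) \<Rightarrow> 'j list \<Rightarrow> 'j \<Rightarrow> ('v::euclidean_space \<Rightarrow> complex) \<Rightarrow> 'v \<Rightarrow> complex"
  where
    "greens D \<mu> [] i f = (\<lambda>x. 0)"
  | "greens D \<mu> (j # js) i f =
      (if i = j then green (fst (D j)) (snd (D j)) (\<mu> j) (avgs D js f) else greens D \<mu> js i f)"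

definition periods :: "('j \<Rightarrow> 'v \<times> 'v) \<Rightarrow> ('v::plus \<Rightarrow> complex) \<Rightarrow> bool"
  where "periods D f \<longleftrightarrow> (\<forall>j x. f (x + fst (D j)) = f x \<and> f (x + snd (D j)) = f x)"

context
  fixes U :: "'v::euclidean_space set" and D :: "'j \<Rightarrow> 'v \<times> 'v" and \<mu> :: "'j \<Rightarrow> real"
  assumes U: "subspace U" and D: "\<And>j. fst (D j) \<in> U" "\<And>j. snd (D j) \<in> U" and mu: "\<And>j. \<mu> j \<noteq> 0"
begin

lemma convop_avgs: "convop U (avgs D js)"
proof (induction js)
  case Nil
  have "avgs D [] = (\<lambda>f. f)" by (rule ext) simp
  then show ?case using convop_id by simp
next
  case (Cons j js)
  have "avgs D (j # js) = (\<lambda>f. avg (fst (D j)) (snd (D j)) (avgs D js f))" by (rule ext) simp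
  then show ?case using convop_comp[OF convop_avg[OF U D] Cons] by simp
qed

lemma convop_greens: "convop U (greens D \<mu> js i)"
proof (induction js)
  case Nil
  have "greens D \<mu> [] i = (\<lambda>f x. 0)" by (rule ext) simp
  then show ?case using convop_zero_op by simp
next
  case (Cons j js)
  have "greens D \<mu> (j # js) i =
      (if i = j then (\<lambda>f. green (fst (D j)) (snd (D j)) (\<mu> j) (avgs D js f)) else greens D \<mu> js i)"
    by (rule ext) simp
  then show ?case using convop_comp[OF convop_green[OF U D mu] convop_avgs] Cons by simp
qed

lemma greens_cr_op:
  assumes "distinct js" and f: "smooth f" and per: "periods D f"
  shows "(\<Sum>i\<in>set js. greens D \<mu> js i (cr_op (fst (D i)) (snd (D i)) (\<mu> i) f) x) = f x - avgs D js f x"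
  using assms(1)
proof (induction js)
  case (Cons j js)
  note g = convop_smooth[OF convop_avgs f, of js]
  have p: "avgs D js f (x + fst (D j)) = avgs D js f x" "avgs D js f (x + snd (D j)) = avgs D js f x" for x
    by (rule convop_periodic[OF convop_avgs f]; use per in \<open>simp add: periods_def\<close>)+
  have "green (fst (D j)) (snd (D j)) (\<mu> j) (avgs D js (cr_op (fst (D j)) (snd (D j)) (\<mu> j) f)) =
      (\<lambda>x. avgs D js f x - avgs D (j # js) f x)"
    unfolding convop_cr_commute[OF convop_avgs f] green_cr_op[OF mu g p] by simp
  moreover have "(\<Sum>i\<in>set js. greens D \<mu> (j # js) i (cr_op (fst (D i)) (snd (D i)) (\<mu> i) f) x) =
      (\<Sum>i\<in>set js. greens D \<mu> js i (cr_op (fst (D i)) (snd (D i)) (\<mu> i) f) x)"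
    using Cons.prems by (intro sum.cong) auto
  ultimately show ?case using Cons by simp
qed simp

lemma avgs_dd_zero:
  assumes "i \<in> set js" and f: "smooth f" and per: "periods D f" and v: "v = fst (D i) \<or> v = snd (D i)"
  shows "dd v (avgs D js f) = (\<lambda>x. 0)"
  using assms(1)
proof (induction js)
  case (Cons j js)
  note g = convop_smooth[OF convop_avgs f, of js]
  show ?case
  proof (cases "i = j")
    case True
    have p: "avgs D js f (x + fst (D j)) = avgs D js f x" "avgs D js f (x + snd (D j)) = avgs D js f x" for x
      by (rule convop_periodic[OF convop_avgs f]; use per in \<open>simp add: periods_def\<close>)+
    show ?thesis using avg_dd_zero[OF g p] v True by simp
  next
    case False
    then have "dd v (avgs D js f) = (\<lambda>x. 0)" using Cons by simp
    then show ?thesis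
      using convop_dd[OF convop_avg[OF U D] g, of v j j] convop_zero[OF convop_avg[OF U D], of j j] by simp
  qed
qed simp

lemma avgs_cr_zero:
  assumes "i \<in> set js" and f: "smooth f" and per: "periods D f"
  shows "avgs D js (cr_op (fst (D i)) (snd (D i)) c f) = (\<lambda>x. 0)"
  unfolding convop_cr_commute[OF convop_avgs f]
  unfolding cr_op_def
  using avgs_dd_zero[OF assms, of "fst (D i)"] avgs_dd_zero[OF assms, of "snd (D i)"] by simp

text \<open>Averages fix the constant 1, and invariant functions pull out of them.\<close>

lemma avgs_invariant:
  assumes "smooth \<phi>" "\<And>u x. u \<in> U \<Longrightarrow> \<phi> (x + u) = \<phi> x"
  shows "avgs D js \<phi> = \<phi>"
proof -
  have "avgs D js (\<lambda>x. 1) = (\<lambda>x. 1)"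
    by (induction js) (simp_all add: avg_def cint_def)
  then show ?thesis
    using convop_mult[OF convop_avgs smooth_const assms, of js 1] by simp
qed

end

lemma avgs_affine:
  assumes "linear R"
  shows "avgs (\<lambda>j. (R (fst (D j)), R (snd (D j)))) js f (c + R x) = avgs D js (\<lambda>x. f (c + R x)) x"
  by (induction js arbitrary: x) (simp_all add: avg_affine[OF assms])

lemma greens_affine:
  assumes R: "bounded_linear R" and f: "smooth f" and mu: "\<And>j. \<mu> j \<noteq> 0"
  shows "greens (\<lambda>j. (R (fst (D j)), R (snd (D j)))) \<mu> js i f (c + R x) = greens D \<mu> js i (\<lambda>x. f (c + R x)) x"
proof (induction js)
  case (Cons j js)
  have "avgs D js (\<lambda>x. f (c + R x)) = (\<lambda>x. avgs (\<lambda>j. (R (fst (D j)), R (snd (D j)))) js f (c + R x))"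
    using avgs_affine[OF bounded_linear.linear[OF R]] by metis
  moreover have "smooth (avgs (\<lambda>j. (R (fst (D j)), R (snd (D j)))) js f)"
    by (rule convop_smooth[OF convop_avgs[OF subspace_UNIV] f]) auto
  ultimately show ?case using green_affine[OF R] Cons by simp
qed simp

section \<open>A smooth partition of unity\<close>

text \<open>All derivatives of exp (-1/t), extended by 0 to t \<le> 0, are of this form for some
  polynomial \<open>p\<close>, so the family is closed under differentiation.\<close>

definition bump_fun :: "real poly \<Rightarrow> real \<Rightarrow> real"
  where "bump_fun p t = (if t > 0 then poly p (inverse t) * exp (- inverse t) else 0)"

lemma poly_exp_tendsto_0: "((\<lambda>y::real. y ^ k * poly p y * exp (- y)) \<longlongrightarrow> 0) at_top"
proof (induction p arbitrary: k)
  case (pCons a p)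
  have "((\<lambda>y::real. a * (y ^ k / exp y) + y ^ Suc k * poly p y * exp (- y)) \<longlongrightarrow> a * 0 + 0) at_top"
    by (intro tendsto_intros pCons tendsto_power_div_exp_0)
  then show ?case by (simp add: algebra_simps exp_minus field_simps)
qed simp

text \<open>For t > 0 the chain rule, with -1/t^2 as inner derivative, gives the new polynomial X^2
  (p - p'). At 0 the difference quotient tends to 0 because exp (-1/t) beats every power of
  1/t.\<close>

lemma bump_fun_has_derivative:
  "(bump_fun p has_real_derivative bump_fun (monom 1 2 * (p - pderiv p)) t) (at t)"
proof (cases "t > 0" "t < 0" rule: bool.exhaust[case_product bool.exhaust])
  case True_True
  then show ?thesis by simp
next
  case True_False
  have "((\<lambda>t. poly p (inverse t) * exp (- inverse t)) has_real_derivative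
      bump_fun (monom 1 2 * (p - pderiv p)) t) (at t)"
    using True_False
    by (auto intro!: derivative_eq_intros DERIV_chain2[OF poly_DERIV]
        simp: bump_fun_def poly_monom power2_eq_square algebra_simps)
  then show ?thesis
    by (rule has_field_derivative_transform_within_open[of _ _ _ "{0<..}"])
      (use True_False in \<open>auto simp: bump_fun_def\<close>)
next
  case False_True
  have "((\<lambda>t. 0) has_real_derivative 0) (at t)" by simp
  then have "(bump_fun p has_real_derivative 0) (at t)"
    by (rule has_field_derivative_transform_within_open[of _ _ _ "{..<0}"])
      (use False_True in \<open>auto simp: bump_fun_def\<close>)
  then show ?thesis using False_True by (simp add: bump_fun_def)
next
  case False_False
  then have t: "t = 0" by simp
  have "((\<lambda>h. bump_fun p h / h) \<longlongrightarrow> 0) (at 0)"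
  proof (rule filterlim_split_at)
    have "((\<lambda>h. 0) \<longlongrightarrow> (0::real)) (at_left (0::real))" by simp
    then show "((\<lambda>h. bump_fun p h / h) \<longlongrightarrow> 0) (at_left 0)"
      by (rule Lim_transform_eventually) (auto simp: bump_fun_def eventually_at_filter)
    have "((\<lambda>h. inverse h ^ 1 * poly p (inverse h) * exp (- inverse h)) \<longlongrightarrow> 0) (at_right (0::real))"
      by (rule filterlim_compose[OF poly_exp_tendsto_0 filterlim_inverse_at_top_right])
    then show "((\<lambda>h. bump_fun p h / h) \<longlongrightarrow> 0) (at_right 0)"
      by (rule Lim_transform_eventually)
        (auto simp: bump_fun_def eventually_at_filter field_simps)
  qed
  then show ?thesis unfolding t DERIV_def by (simp add: bump_fun_def)
qed

lemma smooth_bump_fun: "smooth (\<lambda>t. complex_of_real (bump_fun p t))"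
proof -
  have der: "((\<lambda>t. c * complex_of_real (bump_fun p t)) has_derivative
      (\<lambda>v. (c * of_real v) * complex_of_real (bump_fun (monom 1 2 * (p - pderiv p)) t))) (at t)" for c p t
  proof -
    have "(bump_fun p has_derivative (\<lambda>v. bump_fun (monom 1 2 * (p - pderiv p)) t * v)) (at t)"
      using bump_fun_has_derivative[of p t] by (simp add: has_field_derivative_def)
    from has_derivative_mult_right[OF bounded_linear.has_derivative[OF bounded_linear_of_real this], of c]
    show ?thesis by (simp add: mult_ac)
  qed
  show ?thesis
  proof (rule smooth_coinduct[where P = "\<lambda>f. \<exists>c p. f = (\<lambda>t. c * complex_of_real (bump_fun p t))"])
    show "\<exists>c q. (\<lambda>t. complex_of_real (bump_fun p t)) = (\<lambda>t. c * complex_of_real (bump_fun q t))"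
      by (rule exI[of _ 1]) auto
    show "f differentiable_on UNIV" if "\<exists>c p. f = (\<lambda>t. c * complex_of_real (bump_fun p t))" for f
      using that der differentiable_def by (metis differentiable_at_imp_differentiable_on)
    show "\<exists>c p. dd v f = (\<lambda>t. c * complex_of_real (bump_fun p t))"
      if "\<exists>c p. f = (\<lambda>t. c * complex_of_real (bump_fun p t))" for f v
      using that dd_eqI[OF der, of v] by blast
  qed
qed

definition smooth_step_fun :: "real \<Rightarrow> complex"
  where "smooth_step_fun t = of_real (bump_fun 1 t) * inverse (of_real (bump_fun 1 t) + of_real (bump_fun 1 (1 - t)))"

lemma smooth_step_denom: "bump_fun 1 t + bump_fun 1 (1 - t) \<noteq> 0"
  by (cases "t > 0") (auto simp: bump_fun_def add_pos_pos add_nonneg_eq_0_iff)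

lemma smooth_smooth_step_fun: "smooth smooth_step_fun"
proof -
  have "smooth (\<lambda>t. complex_of_real (bump_fun 1 (1 + - t)))"
    by (rule smooth_affine[OF bounded_linear_minus[OF bounded_linear_ident] smooth_bump_fun])
  then have "smooth (\<lambda>t. complex_of_real (bump_fun 1 (1 - t)))" by simp
  moreover have "complex_of_real (bump_fun 1 t) + of_real (bump_fun 1 (1 - t)) \<noteq> 0" for t
    using smooth_step_denom[of t] by (metis of_real_add of_real_eq_0_iff)
  ultimately show ?thesis
    unfolding smooth_step_fun_def[abs_def]
    by (intro smooth_mult smooth_bump_fun smooth_inverse smooth_add)
qed

lemma smooth_step_fun_0: "t \<le> 0 \<Longrightarrow> smooth_step_fun t = 0"
  by (simp add: smooth_step_fun_def bump_fun_def)

lemma smooth_step_fun_1: "t \<ge> 1 \<Longrightarrow> smooth_step_fun t = 1"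
  by (simp add: smooth_step_fun_def bump_fun_def)

text \<open>Differences of shifted step functions: sums telescope, supports have length 2, and an
  integer shift of \<open>t\<close> only renumbers the family, as the action of the lattice will
  require.\<close>

definition part_unity :: "int \<Rightarrow> real \<Rightarrow> complex"
  where "part_unity N t = smooth_step_fun (t - of_int N + 1) - smooth_step_fun (t - of_int N)"

lemma part_unity_shift: "part_unity (N + k) (t + of_int k) = part_unity N t"
  by (simp add: part_unity_def algebra_simps)

lemma part_unity_support: "\<bar>t - of_int N\<bar> \<ge> 1 \<Longrightarrow> part_unity N t = 0"
  by (cases "t - of_int N \<ge> 1") (simp_all add: part_unity_def smooth_step_fun_0 smooth_step_fun_1)

lemma smooth_part_unity:
  assumes "bounded_linear (l :: 'v::real_normed_vector \<Rightarrow> real)"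
  shows "smooth (\<lambda>x. part_unity N (l x))"
  using smooth_affine[OF assms smooth_smooth_step_fun, of "1 - of_int N"]
    smooth_affine[OF assms smooth_smooth_step_fun, of "- of_int N"]
  unfolding part_unity_def by (simp add: smooth_diff algebra_simps)

lemma part_unity_sum:
  "(\<Sum>N\<in>{\<lfloor>t\<rfloor>..\<lfloor>t\<rfloor> + 1}. part_unity N t) = 1"
proof -
  have "{\<lfloor>t\<rfloor>..\<lfloor>t\<rfloor> + 1} = {\<lfloor>t\<rfloor>, \<lfloor>t\<rfloor> + 1}" by auto
  then show ?thesis
    by (simp add: part_unity_def smooth_step_fun_0 smooth_step_fun_1)
qed

text \<open>Only the floor of \<open>t\<close> and its successor can contribute, so the moving
  window may be replaced by a fixed larger range when derivatives are taken.\<close>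

lemma part_unity_window:
  assumes "finite S" "{\<lfloor>t\<rfloor>..\<lfloor>t\<rfloor> + 1} \<subseteq> S"
  shows "(\<Sum>N\<in>{\<lfloor>t\<rfloor>..\<lfloor>t\<rfloor> + 1}. part_unity N t * c N) = (\<Sum>N\<in>S. part_unity N t * c N)"
proof (rule sum.mono_neutral_left[OF assms])
  show "\<forall>N\<in>S - {\<lfloor>t\<rfloor>..\<lfloor>t\<rfloor> + 1}. part_unity N t * c N = 0"
  proof
    fix N assume "N \<in> S - {\<lfloor>t\<rfloor>..\<lfloor>t\<rfloor> + 1}"
    then have "N < \<lfloor>t\<rfloor> \<or> N > \<lfloor>t\<rfloor> + 1" by auto
    then have "\<bar>t - of_int N\<bar> \<ge> 1" by linarith
    then show "part_unity N t * c N = 0" by (simp add: part_unity_support)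
  qed
qed

section \<open>Koszul complexes\<close>

text \<open>The sign that moves \<open>s\<close> to its place in the exterior product over
  \<open>A\<close>, ordered by \<open>to_nat\<close>.\<close>

definition ksign :: "'i::countable \<Rightarrow> 'i set \<Rightarrow> complex"
  where "ksign s A = (-1) ^ card {a\<in>A. to_nat a < to_nat s}"

lemma ksign_insert:
  "finite A \<Longrightarrow> t \<notin> A \<Longrightarrow> ksign s (insert t A) = (if to_nat t < to_nat s then - 1 else 1) * ksign s A"
proof -
  assume A: "finite A" "t \<notin> A"
  have "{a\<in>insert t A. to_nat a < to_nat s} =
      (if to_nat t < to_nat s then insert t {a\<in>A. to_nat a < to_nat s} else {a\<in>A. to_nat a < to_nat s})"
    by auto
  then show ?thesis using A by (simp add: ksign_def)
qed

lemma ksign_square [simp]: "ksign s A * ksign s A = 1"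
  by (simp add: ksign_def flip: power_add)

lemma ksign_swap:
  assumes "finite A" "s \<noteq> t" "s \<notin> A" "t \<notin> A"
  shows "ksign s (insert t A) * ksign t A = - (ksign t (insert s A) * ksign s A)"
proof -
  have "to_nat s \<noteq> to_nat t" using assms(2) by simp
  then show ?thesis using assms by (simp add: ksign_insert)
qed

definition linear_op :: "('v \<Rightarrow> complex) set \<Rightarrow> (('v \<Rightarrow> complex) \<Rightarrow> 'v \<Rightarrow> complex) \<Rightarrow> bool"
  where "linear_op F T \<longleftrightarrow>
    (\<forall>f\<in>F. \<forall>g\<in>F. T (\<lambda>x. f x + g x) = (\<lambda>x. T f x + T g x)) \<and>
    (\<forall>f\<in>F. \<forall>c. T (\<lambda>x. c * f x) = (\<lambda>x. c * T f x))"

lemma linear_op_add: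
  "linear_op F T \<Longrightarrow> f \<in> F \<Longrightarrow> g \<in> F \<Longrightarrow> T (\<lambda>x. f x + g x) = (\<lambda>x. T f x + T g x)"
  by (auto simp: linear_op_def)

lemma linear_op_cmult: "linear_op F T \<Longrightarrow> f \<in> F \<Longrightarrow> T (\<lambda>x. c * f x) = (\<lambda>x. c * T f x)"
  by (auto simp: linear_op_def)

text \<open>Index sets may contain indices outside \<open>W\<close>; these label holomorphic
  differentials and are only carried along. \<open>K\<close> marks the base directions. A commutator
  of \<open>Z s\<close> with \<open>g t\<close> is allowed to be nonzero only for s in the base and
  t in the fibre, the case in which the weights of the glued operators get differentiated.\<close>

locale koszul =
  fixes F :: "('v \<Rightarrow> complex) set" and W K :: "'i::finite set"
    and Z g :: "'i \<Rightarrow> ('v \<Rightarrow> complex) \<Rightarrow> 'v \<Rightarrow> complex" and A :: "('v \<Rightarrow> complex) \<Rightarrow> 'v \<Rightarrow> complex"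
  assumes F_zero: "(\<lambda>x. 0) \<in> F"
    and F_add: "f \<in> F \<Longrightarrow> f' \<in> F \<Longrightarrow> (\<lambda>x. f x + f' x) \<in> F"
    and F_cmult: "f \<in> F \<Longrightarrow> (\<lambda>x. c * f x) \<in> F"
    and Z_F: "s \<in> W \<Longrightarrow> f \<in> F \<Longrightarrow> Z s f \<in> F"
    and g_F: "s \<in> W \<Longrightarrow> f \<in> F \<Longrightarrow> g s f \<in> F"
    and Z_linear: "s \<in> W \<Longrightarrow> linear_op F (Z s)"
    and g_linear: "s \<in> W \<Longrightarrow> linear_op F (g s)"
    and A_linear: "linear_op F A"
    and Z_commute: "s \<in> W \<Longrightarrow> t \<in> W \<Longrightarrow> f \<in> F \<Longrightarrow> Z s (Z t f) = Z t (Z s f)"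
    and homotopy: "f \<in> F \<Longrightarrow> (\<Sum>s\<in>W. g s (Z s f) x) = f x - A f x"
    and Zg_commute: "s \<in> W \<Longrightarrow> t \<in> W \<Longrightarrow> f \<in> F \<Longrightarrow> \<not> (s \<in> K \<and> t \<notin> K) \<Longrightarrow> Z s (g t f) = g t (Z s f)"
    and A_Z: "s \<in> W \<Longrightarrow> f \<in> F \<Longrightarrow> A (Z s f) = (\<lambda>x. 0)"
begin

lemma F_sum: "(\<And>i. i \<in> I \<Longrightarrow> f i \<in> F) \<Longrightarrow> (\<lambda>x. \<Sum>i\<in>I. c i * f i x) \<in> F"
proof (induction I rule: infinite_finite_induct)
  case (insert i I)
  then show ?case using F_add[OF F_cmult[of "f i" "c i"]] by simp
qed (simp_all add: F_zero)

lemma op_zero: "linear_op F T \<Longrightarrow> T (\<lambda>x. 0) = (\<lambda>x. 0)"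
  using linear_op_cmult[OF _ F_zero, of T 0] by simp

lemma op_sum:
  assumes T: "linear_op F T"
  shows "(\<And>i. i \<in> I \<Longrightarrow> f i \<in> F) \<Longrightarrow> T (\<lambda>x. \<Sum>i\<in>I. c i * f i x) = (\<lambda>x. \<Sum>i\<in>I. c i * T (f i) x)"
proof (induction I rule: infinite_finite_induct)
  case (insert i I)
  have "T (\<lambda>x. c i * f i x + (\<Sum>i\<in>I. c i * f i x)) = (\<lambda>x. T (\<lambda>x. c i * f i x) x + T (\<lambda>x. \<Sum>i\<in>I. c i * f i x) x)"
    by (intro linear_op_add[OF T] F_cmult F_sum insert.prems) auto
  moreover have "T (\<lambda>x. c i * f i x) = (\<lambda>x. c i * T (f i) x)"
    by (intro linear_op_cmult[OF T] insert.prems) auto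
  ultimately show ?case using insert by simp
qed (simp_all add: op_zero[OF T])

definition cochain :: "('i set \<Rightarrow> 'v \<Rightarrow> complex) \<Rightarrow> bool"
  where "cochain f \<longleftrightarrow> (\<forall>C. f C \<in> F)"

definition diff :: "('i set \<Rightarrow> 'v \<Rightarrow> complex) \<Rightarrow> 'i set \<Rightarrow> 'v \<Rightarrow> complex"
  where "diff f C = (\<lambda>x. \<Sum>s\<in>C \<inter> W. ksign s (C - {s}) * Z s (f (C - {s})) x)"

text \<open>Interior multiplication with the vector of operators \<open>g\<close>, the usual
  contracting homotopy of a Koszul complex.\<close>

definition contract :: "('i set \<Rightarrow> 'v \<Rightarrow> complex) \<Rightarrow> 'i set \<Rightarrow> 'v \<Rightarrow> complex"
  where "contract f C = (\<lambda>x. \<Sum>t\<in>W - C. ksign t C * g t (f (insert t C)) x)"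

lemma cochain_diff: "cochain f \<Longrightarrow> cochain (diff f)"
  unfolding cochain_def diff_def by (auto intro!: F_sum Z_F)

lemma cochain_contract: "cochain f \<Longrightarrow> cochain (contract f)"
  unfolding cochain_def contract_def by (auto intro!: F_sum g_F)

lemma diff_add:
  assumes "cochain f" "cochain f'"
  shows "diff (\<lambda>C x. f C x + c * f' C x) = (\<lambda>C x. diff f C x + c * diff f' C x)"
proof (intro ext)
  fix C x
  have "Z s (\<lambda>x. f B x + c * f' B x) = (\<lambda>x. Z s (f B) x + c * Z s (f' B) x)" if "s \<in> W" for s B
  proof -
    have "Z s (\<lambda>x. f B x + c * f' B x) = (\<lambda>x. Z s (f B) x + Z s (\<lambda>x. c * f' B x) x)"
      using assms unfolding cochain_def by (intro linear_op_add[OF Z_linear[OF that]] F_cmult) auto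
    moreover have "Z s (\<lambda>x. c * f' B x) = (\<lambda>x. c * Z s (f' B) x)"
      using assms unfolding cochain_def by (intro linear_op_cmult[OF Z_linear[OF that]]) auto
    ultimately show ?thesis by simp
  qed
  then show "diff (\<lambda>C x. f C x + c * f' C x) C x = diff f C x + c * diff f' C x"
    by (simp add: diff_def algebra_simps sum.distrib sum_distrib_left)
qed

lemma diff_diff:
  assumes f: "cochain f"
  shows "diff (diff f) = (\<lambda>C x. 0)"
proof (intro ext)
  fix C x
  define \<phi> where "\<phi> s t = ksign s (C - {s}) * ksign t (C - {s} - {t}) * Z s (Z t (f (C - {s} - {t}))) x" for s t
  define Q where "Q = (SIGMA s:C \<inter> W. (C - {s}) \<inter> W)"
  have "diff (diff f) C x = (\<Sum>s\<in>C \<inter> W. \<Sum>t\<in>(C - {s}) \<inter> W. \<phi> s t)"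
    unfolding diff_def[of "diff f"]
  proof (rule sum.cong[OF refl])
    fix s assume s: "s \<in> C \<inter> W"
    have "Z s (diff f (C - {s})) =
        (\<lambda>x. \<Sum>t\<in>(C - {s}) \<inter> W. ksign t (C - {s} - {t}) * Z s (Z t (f (C - {s} - {t}))) x)"
      unfolding diff_def using s f
      by (intro op_sum Z_linear Z_F) (auto simp: cochain_def)
    then show "ksign s (C - {s}) * Z s (diff f (C - {s})) x = (\<Sum>t\<in>(C - {s}) \<inter> W. \<phi> s t)"
      by (simp add: \<phi>_def sum_distrib_left mult.assoc)
  qed
  also have "\<dots> = (\<Sum>(s, t)\<in>Q. \<phi> s t)"
    unfolding Q_def by (rule sum.Sigma) auto
  finally have eq: "diff (diff f) C x = (\<Sum>(s, t)\<in>Q. \<phi> s t)" .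
  have anti: "\<phi> t s = - \<phi> s t" if st: "(s, t) \<in> Q" for s t
  proof -
    have st: "s \<in> C" "s \<in> W" "t \<in> C" "t \<in> W" "s \<noteq> t" using st by (auto simp: Q_def)
    define B where "B = C - {s} - {t}"
    have B: "C - {s} = insert t B" "C - {t} = insert s B" "insert t B - {t} = B" "insert s B - {s} = B"
      "s \<notin> B" "t \<notin> B" using st by (auto simp: B_def)
    have "Z t (Z s (f B)) = Z s (Z t (f B))"
      using Z_commute[OF st(4,2)] f by (auto simp: cochain_def)
    then show ?thesis
      unfolding \<phi>_def B using ksign_swap[of B s t] B(5,6) st(5) by simp
  qed
  have "(\<Sum>(s, t)\<in>Q. \<phi> s t) = (\<Sum>(s, t)\<in>Q. \<phi> t s)"
    by (rule sum.reindex_bij_witness[where i = prod.swap and j = prod.swap]) (auto simp: Q_def)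
  also have "\<dots> = (\<Sum>(s, t)\<in>Q. - \<phi> s t)"
    by (rule sum.cong) (auto simp: anti)
  also have "\<dots> = - (\<Sum>(s, t)\<in>Q. \<phi> s t)"
    by (simp add: case_prod_unfold sum_negf)
  finally show "diff (diff f) C x = 0" unfolding eq by simp
qed

lemma A_diff:
  assumes f: "cochain f"
  shows "A (diff f C) = (\<lambda>x. 0)"
proof -
  have "A (diff f C) = (\<lambda>x. \<Sum>s\<in>C \<inter> W. ksign s (C - {s}) * A (Z s (f (C - {s}))) x)"
    unfolding diff_def using f by (intro op_sum A_linear Z_F) (auto simp: cochain_def)
  then show ?thesis using f by (simp add: A_Z cochain_def)
qed

text \<open>The terms that insert and remove the same index add up to
  \<open>\<Sum> g Z = 1 - A\<close>; terms with two different indices occur twice, with opposite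
  signs, and leave commutators.\<close>

lemma homotopy_formula:
  assumes f: "cochain f"
  shows "diff (contract f) C x + contract (diff f) C x = f C x - A (f C) x +
    (\<Sum>s\<in>C \<inter> W. \<Sum>t\<in>W - C. ksign s (C - {s}) * ksign t (C - {s}) *
      (Z s (g t (f (insert t (C - {s})))) x - g t (Z s (f (insert t (C - {s})))) x))"
proof -
  have fF: "f B \<in> F" for B using f by (simp add: cochain_def)
  have 1: "diff (contract f) C x = (\<Sum>s\<in>C \<inter> W. Z s (g s (f C)) x) +
      (\<Sum>s\<in>C \<inter> W. \<Sum>t\<in>W - C. ksign s (C - {s}) * ksign t (C - {s}) * Z s (g t (f (insert t (C - {s})))) x)"
    unfolding diff_def sum.distrib[symmetric]
  proof (rule sum.cong[OF refl])
    fix s assume s: "s \<in> C \<inter> W"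
    have W: "W - (C - {s}) = insert s (W - C)" using s by auto
    have "Z s (contract f (C - {s})) =
        (\<lambda>x. \<Sum>t\<in>insert s (W - C). ksign t (C - {s}) * Z s (g t (f (insert t (C - {s})))) x)"
      unfolding contract_def W using s by (intro op_sum Z_linear g_F fF) auto
    also have "\<dots> = (\<lambda>x. ksign s (C - {s}) * Z s (g s (f C)) x +
        (\<Sum>t\<in>W - C. ksign t (C - {s}) * Z s (g t (f (insert t (C - {s})))) x))"
      using s by (subst sum.insert) (auto simp: insert_absorb)
    finally show "ksign s (C - {s}) * Z s (contract f (C - {s})) x = Z s (g s (f C)) x +
        (\<Sum>t\<in>W - C. ksign s (C - {s}) * ksign t (C - {s}) * Z s (g t (f (insert t (C - {s})))) x)"
      by (simp add: distrib_left sum_distrib_left mult.assoc[symmetric])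
  qed
  have 2: "contract (diff f) C x = (\<Sum>t\<in>W - C. g t (Z t (f C)) x) +
      (\<Sum>t\<in>W - C. \<Sum>s\<in>C \<inter> W. ksign t C * ksign s (insert t (C - {s})) * g t (Z s (f (insert t (C - {s})))) x)"
    unfolding contract_def sum.distrib[symmetric]
  proof (rule sum.cong[OF refl])
    fix t assume t: "t \<in> W - C"
    have W: "insert t C \<inter> W = insert t (C \<inter> W)" using t by auto
    have "g t (diff f (insert t C)) =
        (\<lambda>x. \<Sum>s\<in>insert t (C \<inter> W). ksign s (insert t C - {s}) * g t (Z s (f (insert t C - {s}))) x)"
      unfolding diff_def W using t by (intro op_sum g_linear Z_F fF) auto
    also have "\<dots> = (\<lambda>x. ksign t (insert t C - {t}) * g t (Z t (f (insert t C - {t}))) x +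
        (\<Sum>s\<in>C \<inter> W. ksign s (insert t C - {s}) * g t (Z s (f (insert t C - {s}))) x))"
      using t by (subst sum.insert) auto
    also have "\<dots> = (\<lambda>x. ksign t C * g t (Z t (f C)) x +
        (\<Sum>s\<in>C \<inter> W. ksign s (insert t (C - {s})) * g t (Z s (f (insert t (C - {s})))) x))"
    proof -
      have "insert t C - {t} = C" using t by auto
      moreover have "insert t C - {s} = insert t (C - {s})" if "s \<in> C \<inter> W" for s
        using t that by auto
      ultimately show ?thesis by simp
    qed
    finally show "ksign t C * g t (diff f (insert t C)) x = g t (Z t (f C)) x +
        (\<Sum>s\<in>C \<inter> W. ksign t C * ksign s (insert t (C - {s})) * g t (Z s (f (insert t (C - {s})))) x)"
      by (simp add: distrib_left sum_distrib_left mult.assoc[symmetric])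
  qed
  have sgn: "ksign t C * ksign s (insert t (C - {s})) = - (ksign s (C - {s}) * ksign t (C - {s}))"
    if "s \<in> C \<inter> W" "t \<in> W - C" for s t
  proof -
    define B where "B = C - {s}"
    have B: "C = insert s B" "s \<notin> B" "t \<notin> B" "to_nat s \<noteq> to_nat t" using that by (auto simp: B_def)
    show ?thesis unfolding B_def[symmetric] B(1) using B(2,3,4) by (simp add: ksign_insert)
  qed
  have "(\<Sum>t\<in>W - C. \<Sum>s\<in>C \<inter> W. ksign t C * ksign s (insert t (C - {s})) * g t (Z s (f (insert t (C - {s})))) x) =
      (\<Sum>s\<in>C \<inter> W. \<Sum>t\<in>W - C. - (ksign s (C - {s}) * ksign t (C - {s}) * g t (Z s (f (insert t (C - {s})))) x))"
    by (subst sum.swap, intro sum.cong refl) (simp add: sgn)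
  moreover have "(\<Sum>s\<in>C \<inter> W. Z s (g s (f C)) x) + (\<Sum>t\<in>W - C. g t (Z t (f C)) x) = f C x - A (f C) x"
  proof -
    have "(\<Sum>s\<in>C \<inter> W. Z s (g s (f C)) x) = (\<Sum>s\<in>C \<inter> W. g s (Z s (f C)) x)"
      by (rule sum.cong) (auto simp: Zg_commute fF)
    moreover have "(\<Sum>s\<in>W. g s (Z s (f C)) x) =
        (\<Sum>s\<in>W - C. g s (Z s (f C)) x) + (\<Sum>s\<in>C \<inter> W. g s (Z s (f C)) x)"
      using sum.subset_diff[of "C \<inter> W" W "\<lambda>s. g s (Z s (f C)) x"] by (simp add: Diff_Int)
    ultimately show ?thesis using homotopy[OF fF, of C x] by simp
  qed
  ultimately show ?thesis
    unfolding 1 2 by (simp add: sum_negf sum_subtractf right_diff_distrib)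
qed

text \<open>Subtracting \<open>diff (contract f)\<close> leaves minus the commutator error. At C
  this error evaluates \<open>f\<close> on \<open>insert t (C - {s})\<close>, which has one base
  index fewer; so if \<open>f\<close> vanishes on all sets with fewer than r base indices, the new
  cochain vanishes on those with fewer than r + 1.\<close>

lemma closed_imp_exact:
  assumes "cochain f" "diff f = (\<lambda>C x. 0)" "\<And>C. A (f C) = (\<lambda>x. 0)"
  shows "\<exists>\<eta>. cochain \<eta> \<and> diff \<eta> = f"
proof -
  \<comment> \<open>\<open>n\<close> counts the levels still to be cleared; \<open>n = 0\<close>
    means that r exceeds \<open>card K\<close>, so the cochain is zero.\<close>
  have "\<exists>\<eta>. cochain \<eta> \<and> diff \<eta> = f"
    if "cochain f" "diff f = (\<lambda>C x. 0)" "\<And>C. A (f C) = (\<lambda>x. 0)" "n + r = Suc (card K)"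
      "\<And>C. card (C \<inter> K) < r \<Longrightarrow> f C = (\<lambda>x. 0)" for n r f
    using that
  proof (induction n arbitrary: r f)
    case 0
    have "card (C \<inter> K) < r" for C
      using 0(4) card_mono[of K "C \<inter> K"] by auto
    then have "f = (\<lambda>C x. 0)" using 0(5) by blast
    then show ?case using 0(1,2) by blast
  next
    case (Suc n)
    note f = Suc.prems(1)
    define f' where "f' = (\<lambda>C x. f C x + (- 1) * diff (contract f) C x)"
    note hf = cochain_contract[OF f] and dhf = cochain_diff[OF cochain_contract[OF f]]
    have f': "cochain f'"
      using f dhf F_add F_cmult unfolding f'_def cochain_def by blast
    have df': "diff f' = (\<lambda>C x. 0)"
      unfolding f'_def diff_add[OF f dhf] diff_diff[OF hf] Suc.prems(2) by simp
    have Af': "A (f' C) = (\<lambda>x. 0)" for C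
    proof -
      note Ad = A_diff[OF hf, of C]
      have "A (f' C) = (\<lambda>x. A (f C) x + A (\<lambda>x. (- 1) * diff (contract f) C x) x)"
        unfolding f'_def using f dhf unfolding cochain_def by (intro linear_op_add[OF A_linear] F_cmult) auto
      moreover have "A (\<lambda>x. (- 1) * diff (contract f) C x) = (\<lambda>x. (- 1) * A (diff (contract f) C) x)"
        using dhf unfolding cochain_def by (intro linear_op_cmult[OF A_linear]) auto
      ultimately show ?thesis using Suc.prems(3) Ad by simp
    qed
    have sup: "f' C = (\<lambda>x. 0)" if C: "card (C \<inter> K) < Suc r" for C
    proof
      fix x
      have "contract (diff f) C x = 0"
        unfolding contract_def Suc.prems(2) using op_zero[OF g_linear] by simp
      then have "f' C x = - (\<Sum>s\<in>C \<inter> W. \<Sum>t\<in>W - C. ksign s (C - {s}) * ksign t (C - {s}) *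
          (Z s (g t (f (insert t (C - {s})))) x - g t (Z s (f (insert t (C - {s})))) x))"
        using homotopy_formula[OF f, of C x] Suc.prems(3)[of C] by (simp add: f'_def algebra_simps)
      also have "\<dots> = 0"
      proof -
        have "Z s (g t (f (insert t (C - {s})))) x - g t (Z s (f (insert t (C - {s})))) x = 0"
          if st: "s \<in> C \<inter> W" "t \<in> W - C" for s t
        proof (cases "s \<in> K \<and> t \<notin> K")
          case True
          then have "insert t (C - {s}) \<inter> K \<subset> C \<inter> K" using st by auto
          then have "card (insert t (C - {s}) \<inter> K) < card (C \<inter> K)"
            by (intro psubset_card_mono) auto
          then have "f (insert t (C - {s})) = (\<lambda>x. 0)" using C by (intro Suc.prems(5)) linarith
          then show ?thesis using st op_zero[OF Z_linear] op_zero[OF g_linear] by simp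
        next
          case False
          then show ?thesis using st f Zg_commute by (simp add: cochain_def)
        qed
        then show ?thesis by simp
      qed
      finally show "f' C x = 0" .
    qed
    have "\<exists>\<eta>. cochain \<eta> \<and> diff \<eta> = f'"
      by (rule Suc.IH[where r = "Suc r", OF f' df' Af']) (use sup Suc.prems(4) in auto)
    then obtain \<eta> where \<eta>: "cochain \<eta>" "diff \<eta> = f'" by blast
    have "diff (\<lambda>C x. contract f C x + 1 * \<eta> C x) = f"
      unfolding diff_add[OF hf \<eta>(1)] \<eta>(2) f'_def by simp
    moreover have "cochain (\<lambda>C x. contract f C x + 1 * \<eta> C x)"
      using hf \<eta>(1) F_add F_cmult unfolding cochain_def by blast
    ultimately show ?case by blast
  qed
  from this[of f "Suc (card K)" 0] show ?thesis using assms by simp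
qed

end

section \<open>Exterior products\<close>

definition delete_nth :: "nat \<Rightarrow> 'a list \<Rightarrow> 'a list"
  where "delete_nth i xs = take i xs @ drop (Suc i) xs"

lemma length_delete_nth [simp]: "i < length xs \<Longrightarrow> length (delete_nth i xs) = length xs - 1"
  by (simp add: delete_nth_def)

lemma nth_delete_nth: "i < length xs \<Longrightarrow> j < length xs - 1 \<Longrightarrow>
    delete_nth i xs ! j = xs ! (if j < i then j else Suc j)"
  by (auto simp: delete_nth_def nth_append)

lemma delete_nth_Cons [simp]:
  "delete_nth 0 (x # xs) = xs" "delete_nth (Suc i) (x # xs) = x # delete_nth i xs"
  by (simp_all add: delete_nth_def)

lemma map_delete_nth: "map f (delete_nth i xs) = delete_nth i (map f xs)"
  by (simp add: delete_nth_def take_map drop_map)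

text \<open>Matrices of variable size: deleting a form and a vector gives a matrix of the same kind,
  so the Laplace expansions can be iterated.\<close>

definition wedge_mat :: "('v \<Rightarrow> complex) list \<Rightarrow> 'v list \<Rightarrow> complex Matrix.mat"
  where "wedge_mat as vs = Matrix.mat (length as) (length as) (\<lambda>(i, j). (as ! i) (vs ! j))"

lemma wedge_det: "length vs = length as \<Longrightarrow> wedge as vs = Determinant.det (wedge_mat as vs)"
proof -
  let ?n = "length as"
  assume "length vs = ?n"
  moreover have "(\<Sum>\<sigma> | \<sigma> permutes {..<?n}. of_int (sign \<sigma>) * (\<Prod>i<?n. (as ! i) (vs ! \<sigma> i))) =
      (\<Sum>\<sigma> | \<sigma> permutes {..<?n}. of_int (sign \<sigma>) * (\<Prod>i<?n. wedge_mat as vs $$ (i, \<sigma> i)))"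
  proof (intro sum.cong refl arg_cong2[of _ _ _ _ "(*)"] prod.cong)
    fix \<sigma> i assume "\<sigma> \<in> {\<sigma>. \<sigma> permutes {..<?n}}" "i \<in> {..<?n}"
    then have "\<sigma> i < ?n" "i < ?n" using permutes_in_image[of \<sigma> "{..<?n}" i] by auto
    then show "(as ! i) (vs ! \<sigma> i) = wedge_mat as vs $$ (i, \<sigma> i)" by (simp add: wedge_mat_def)
  qed
  ultimately show ?thesis
    unfolding wedge_def Determinant.det_def atLeast0LessThan by (simp add: wedge_mat_def)
qed

lemma wedge_length: "length vs \<noteq> length as \<Longrightarrow> wedge as vs = 0"
  by (simp add: wedge_def)

lemma wedge_mat_delete:
  assumes "length vs = length as" "i < length as" "j < length as"
  shows "mat_delete (wedge_mat as vs) i j = wedge_mat (delete_nth i as) (delete_nth j vs)"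
  using assms by (intro eq_matI) (auto simp: mat_delete_def wedge_mat_def nth_delete_nth)

lemma wedge_row_expansion:
  assumes "length vs = Suc (length as)"
  shows "wedge (a # as) vs = (\<Sum>j<length vs. (-1) ^ j * a (vs ! j) * wedge as (delete_nth j vs))"
proof -
  have "Determinant.det (wedge_mat (a # as) vs) = (\<Sum>j<length vs. wedge_mat (a # as) vs $$ (0, j) * cofactor (wedge_mat (a # as) vs) 0 j)"
    by (rule laplace_expansion_row) (use assms in \<open>auto simp: wedge_mat_def\<close>)
  also have "\<dots> = (\<Sum>j<length vs. (-1) ^ j * a (vs ! j) * wedge as (delete_nth j vs))"
  proof (rule sum.cong[OF refl])
    fix j assume "j \<in> {..<length vs}"
    then have j: "j < length vs" by simp
    have "mat_delete (wedge_mat (a # as) vs) 0 j = wedge_mat as (delete_nth j vs)"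
      using assms j by (subst wedge_mat_delete) auto
    then have "cofactor (wedge_mat (a # as) vs) 0 j = (-1) ^ j * wedge as (delete_nth j vs)"
      using assms j by (simp add: cofactor_def wedge_det)
    moreover have "wedge_mat (a # as) vs $$ (0, j) = a (vs ! j)" using assms j by (simp add: wedge_mat_def)
    ultimately show "wedge_mat (a # as) vs $$ (0, j) * cofactor (wedge_mat (a # as) vs) 0 j =
        (-1) ^ j * a (vs ! j) * wedge as (delete_nth j vs)" by simp
  qed
  finally show ?thesis using assms by (simp add: wedge_det)
qed

lemma wedge_column_expansion:
  assumes "length as = Suc (length vs)"
  shows "wedge as (v # vs) = (\<Sum>i<length as. (-1) ^ i * (as ! i) v * wedge (delete_nth i as) vs)"
proof -
  have "Determinant.det (wedge_mat as (v # vs)) = (\<Sum>i<length as. wedge_mat as (v # vs) $$ (i, 0) * cofactor (wedge_mat as (v # vs)) i 0)"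
    by (rule laplace_expansion_column) (use assms in \<open>auto simp: wedge_mat_def\<close>)
  also have "\<dots> = (\<Sum>i<length as. (-1) ^ i * (as ! i) v * wedge (delete_nth i as) vs)"
  proof (rule sum.cong[OF refl])
    fix i assume "i \<in> {..<length as}"
    then have i: "i < length as" by simp
    have "mat_delete (wedge_mat as (v # vs)) i 0 = wedge_mat (delete_nth i as) vs"
      using assms i by (subst wedge_mat_delete) auto
    then have "cofactor (wedge_mat as (v # vs)) i 0 = (-1) ^ i * wedge (delete_nth i as) vs"
      using assms i by (simp add: cofactor_def wedge_det)
    moreover have "wedge_mat as (v # vs) $$ (i, 0) = (as ! i) v" using assms i by (simp add: wedge_mat_def)
    ultimately show "wedge_mat as (v # vs) $$ (i, 0) * cofactor (wedge_mat as (v # vs)) i 0 =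
        (-1) ^ i * (as ! i) v * wedge (delete_nth i as) vs" by simp
  qed
  finally show ?thesis using assms by (simp add: wedge_det)
qed

lemma wedge_swap: "wedge (b # a # as) vs = - wedge (a # b # as) vs"
proof (cases "length vs = Suc (Suc (length as))")
  case True
  have "wedge_mat (b # a # as) vs = mat_swaprows 0 1 (wedge_mat (a # b # as) vs)"
  proof (rule eq_matI)
    fix i j assume "i < dim_row (mat_swaprows 0 1 (wedge_mat (a # b # as) vs))"
      "j < dim_col (mat_swaprows 0 1 (wedge_mat (a # b # as) vs))"
    then have ij: "i < Suc (Suc (length as))" "j < Suc (Suc (length as))" by (simp_all add: wedge_mat_def)
    consider "i = 0" | "i = 1" | k where "i = Suc (Suc k)" by (metis One_nat_def not0_implies_Suc)
    then show "wedge_mat (b # a # as) vs $$ (i, j) = mat_swaprows 0 1 (wedge_mat (a # b # as) vs) $$ (i, j)"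
      using ij by cases (simp_all add: wedge_mat_def)
  qed (simp_all add: wedge_mat_def)
  moreover have "Determinant.det (mat_swaprows 0 1 (wedge_mat (a # b # as) vs)) = - Determinant.det (wedge_mat (a # b # as) vs)"
    by (rule det_swaprows[of 0 "Suc (Suc (length as))"]) (auto simp: wedge_mat_def)
  ultimately show ?thesis using True by (simp add: wedge_det)
next
  case False
  then show ?thesis by (simp add: wedge_length)
qed

lemma wedge_Cons_cong:
  assumes "\<And>vs. wedge as vs = c * wedge bs vs" "length as = length bs"
  shows "wedge (a # as) vs = c * wedge (a # bs) vs"
proof (cases "length vs = Suc (length as)")
  case True
  then show ?thesis using assms
    by (simp add: wedge_row_expansion sum_distrib_left distrib_left mult_ac)
next
  case False
  then show ?thesis using assms(2) by (simp add: wedge_length)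
qed

lemma wedge_scale:
  "wedge (map (\<lambda>s v. c s * e s v) L) vs = prod_list (map c L) * wedge (map e L) vs"
proof (induction L arbitrary: vs)
  case (Cons s L)
  show ?case
  proof (cases "length vs = Suc (length L)")
    case True
    then show ?thesis using Cons
      by (simp add: wedge_row_expansion sum_distrib_left distrib_left mult_ac)
  next
    case False
    then show ?thesis by (simp add: wedge_length)
  qed
qed simp

lemma wedge_double: "wedge (a # a # as) vs = 0"
  using wedge_swap[of a a as vs] by simp

text \<open>The increasing enumeration with respect to \<open>to_nat\<close>. It fixes one exterior
  product per index set, and \<open>ksign\<close> refers to the same order.\<close>

definition enum_set :: "'i::finite set \<Rightarrow> 'i list"
  where "enum_set C = map from_nat (sorted_list_of_set (to_nat ` C))"

abbreviation sorted_idx :: "'i::finite list \<Rightarrow> bool"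
  where "sorted_idx \<equiv> sorted_wrt (\<lambda>a b. to_nat a < to_nat b)"

lemma map_to_nat_enum_set: "map to_nat (enum_set C) = sorted_list_of_set (to_nat ` C)"
proof -
  have "map (\<lambda>x. to_nat (from_nat x :: 'a)) (sorted_list_of_set (to_nat ` C)) = map (\<lambda>x. x) (sorted_list_of_set (to_nat ` C))"
    by (rule map_cong) auto
  then show ?thesis by (simp add: enum_set_def comp_def)
qed

lemma set_enum_set [simp]: "set (enum_set C) = C"
  by (auto simp: enum_set_def image_image)

lemma sorted_enum_set: "sorted_idx (enum_set C)"
proof -
  have "sorted_wrt (<) (map to_nat (enum_set C))"
    unfolding map_to_nat_enum_set by (rule strict_sorted_list_of_set)
  then show ?thesis by (simp add: sorted_wrt_map)
qed

lemma sorted_idx_distinct: "sorted_idx L \<Longrightarrow> distinct L"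
  by (induction L) auto

lemma distinct_enum_set: "distinct (enum_set C)"
  by (rule sorted_idx_distinct[OF sorted_enum_set])

lemma sorted_idx_unique:
  assumes "sorted_idx L" "sorted_idx L'" "set L = set L'"
  shows "L = L'"
proof -
  have "map to_nat L = map to_nat L'"
    by (rule strict_sorted_equal) (use assms in \<open>simp_all add: sorted_wrt_map\<close>)
  then show ?thesis by (simp add: inj_map_eq_map)
qed

lemma enum_set_eq: "sorted_idx L \<Longrightarrow> enum_set (set L) = L"
  by (rule sorted_idx_unique[OF sorted_enum_set]) auto

lemma length_enum_set [simp]: "length (enum_set C) = card C"
  using distinct_card[OF distinct_enum_set, of C] by simp

primrec insert_idx :: "'i::finite \<Rightarrow> 'i list \<Rightarrow> 'i list"
  where
    "insert_idx s [] = [s]"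
  | "insert_idx s (a # L) = (if to_nat s < to_nat a then s # a # L else a # insert_idx s L)"

lemma set_insert_idx [simp]: "set (insert_idx s L) = insert s (set L)"
  by (induction L) auto

lemma length_insert_idx [simp]: "length (insert_idx s L) = Suc (length L)"
  by (induction L) auto

lemma sorted_insert_idx: "sorted_idx L \<Longrightarrow> s \<notin> set L \<Longrightarrow> sorted_idx (insert_idx s L)"
proof (induction L)
  case (Cons a L)
  have "to_nat s \<noteq> to_nat a" using Cons.prems by auto
  then consider "to_nat s < to_nat a" | "to_nat a < to_nat s" by linarith
  then show ?case by cases (use Cons in \<open>auto dest: less_trans\<close>)
qed simp

text \<open>Each transposition with a smaller element contributes a factor -1, and
  \<open>ksign\<close> counts these elements.\<close>

lemma wedge_insert_idx:
  "sorted_idx L \<Longrightarrow> s \<notin> set L \<Longrightarrow>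
    wedge (map e (s # L)) vs = ksign s (set L) * wedge (map e (insert_idx s L)) vs"
proof (induction L arbitrary: vs)
  case Nil
  then show ?case by (simp add: ksign_def)
next
  case (Cons a L)
  have neq: "to_nat s \<noteq> to_nat a" using Cons.prems by auto
  show ?case
  proof (cases "to_nat s < to_nat a")
    case True
    then have "{b \<in> set (a # L). to_nat b < to_nat s} = {}" using Cons.prems(1) by auto
    then have "ksign s (set (a # L)) = 1" unfolding ksign_def by (simp only: card.empty power_0)
    then show ?thesis using True by simp
  next
    case False
    have IH: "wedge (map e (s # L)) vs = ksign s (set L) * wedge (map e (insert_idx s L)) vs" for vs
      using Cons by simp
    have "a \<notin> set L" using Cons.prems(1) by auto
    then have sg: "ksign s (set (a # L)) = - ksign s (set L)"
      using False neq by (simp add: ksign_insert)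
    have "wedge (map e (s # a # L)) vs = - wedge (map e (a # s # L)) vs"
      using wedge_swap[of "e s" "e a" "map e L" vs] by simp
    also have "wedge (map e (a # s # L)) vs = ksign s (set L) * wedge (map e (a # insert_idx s L)) vs"
      using wedge_Cons_cong[of "map e (s # L)" "ksign s (set L)" "map e (insert_idx s L)" "e a" vs, OF IH] by simp
    finally show ?thesis using sg False by simp
  qed
qed

text \<open>Exterior multiplication by one covector. Through this formula the signs of the exterior
  derivative become those of the Koszul differential.\<close>

lemma wedge_Cons_enum_set:
  "wedge (map e (s # enum_set C)) vs =
    (if s \<in> C then 0 else ksign s C * wedge (map e (enum_set (insert s C))) vs)"
proof (cases "s \<in> C")
  case True
  have "wedge (map e (s # L)) vs = 0" if "s \<in> set L" for L vs
    using that
  proof (induction L arbitrary: vs)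
    case (Cons a L)
    show ?case
    proof (cases "s = a")
      case True
      then show ?thesis using wedge_double[of "e s" "map e L" vs] by simp
    next
      case False
      then have IH: "wedge (map e (s # L)) vs = 0 * wedge (map e (s # L)) vs" for vs using Cons by simp
      have "wedge (map e (a # s # L)) vs = 0"
        using wedge_Cons_cong[of "map e (s # L)" 0 "map e (s # L)" "e a" vs, OF IH] by simp
      then show ?thesis using wedge_swap[of "e s" "e a" "map e L" vs] by simp
    qed
  qed simp
  then show ?thesis using True by simp
next
  case False
  have "insert_idx s (enum_set C) = enum_set (insert s C)"
    using enum_set_eq[OF sorted_insert_idx[OF sorted_enum_set, of s C]] False by simp
  then show ?thesis using wedge_insert_idx[OF sorted_enum_set, of s C e vs] False by simp
qed

text \<open>Links the multi-indices, which are arbitrary repetition-free lists, with the canonical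
  enumeration of their sets.\<close>

lemma wedge_distinct_list:
  "distinct L \<Longrightarrow> \<exists>c. (c = 1 \<or> c = - 1) \<and> (\<forall>vs. wedge (map e L) vs = c * wedge (map e (enum_set (set L))) vs)"
proof (induction L)
  case Nil
  have "enum_set {} = ([] :: 'a list)" using enum_set_eq[of "[] :: 'a list"] by simp
  then show ?case by (intro exI[of _ 1]) simp
next
  case (Cons s L)
  then obtain c where c: "c = 1 \<or> c = - 1" "\<And>vs. wedge (map e L) vs = c * wedge (map e (enum_set (set L))) vs"
    by auto
  have "wedge (map e (s # L)) vs = c * ksign s (set L) * wedge (map e (enum_set (set (s # L)))) vs" for vs
  proof -
    have "wedge (map e (s # L)) vs = c * wedge (map e (s # enum_set (set L))) vs"
      using wedge_Cons_cong[of "map e L" c "map e (enum_set (set L))" "e s" vs, OF c(2)]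
        distinct_card[of L] Cons.prems by simp
    then show ?thesis using Cons.prems wedge_Cons_enum_set[of e s "set L" vs] by simp
  qed
  moreover have "ksign s (set L) = 1 \<or> ksign s (set L) = - 1"
    unfolding ksign_def by (cases "even (card {a \<in> set L. to_nat a < to_nat s})") simp_all
  ultimately show ?case using c(1) by (intro exI[of _ "c * ksign s (set L)"]) auto
qed

section \<open>Coordinates of forms\<close>

text \<open>Both sides vanish when the lengths do not match, so the expansion holds for all lists of
  vectors. The left side has the shape of the sum in \<open>ext_d\<close>.\<close>

lemma wedge_row_expansion_all:
  "(\<Sum>j<length vs. (-1) ^ j * a (vs ! j) * wedge as (delete_nth j vs)) = wedge (a # as) vs"
proof (cases "length vs = Suc (length as)")
  case True
  then show ?thesis by (simp only: wedge_row_expansion)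
next
  case False
  have "wedge as (delete_nth j vs) = 0" if "j < length vs" for j
    using that False by (intro wedge_length) auto
  then show ?thesis using False by (simp add: wedge_length)
qed

lemma wedge_map: "wedge as (map L vs) = wedge (map (\<lambda>a v. a (L v)) as) vs"
proof (cases "length vs = length as")
  case True
  have "(\<Prod>i<length as. (as ! i) (map L vs ! \<sigma> i)) = (\<Prod>i<length as. (as ! i) (L (vs ! \<sigma> i)))"
    if "\<sigma> permutes {..<length as}" for \<sigma>
    using permutes_in_image[OF that] True by (intro prod.cong) auto
  then show ?thesis by (simp add: wedge_def)
next
  case False
  then show ?thesis by (simp add: wedge_length)
qed

type_synonym ('n, 'm) coord = "('n \<times> bool) + ('m \<times> bool)"

text \<open>An index \<open>(True, c)\<close> stands for the differential of the coordinate \<open>c\<close> and \<open>(False, c)\<close> for its conjugate.\<close>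

type_synonym ('n, 'm) idx = "bool \<times> ('n, 'm) coord"

definition coord_fun :: "('n::finite, 'm::finite) coord \<Rightarrow> ('n, 'm) grp \<Rightarrow> complex"
  where "coord_fun c v = (case c of Inl i \<Rightarrow> fst v $ i | Inr j \<Rightarrow> snd v $ j)"

definition coord_vec :: "('n::finite, 'm::finite) coord \<Rightarrow> complex \<Rightarrow> ('n, 'm) grp"
  where "coord_vec c z = (case c of Inl i \<Rightarrow> (axis i z, 0) | Inr j \<Rightarrow> (0, axis j z))"

definition cov :: "('n::finite, 'm::finite) idx \<Rightarrow> ('n, 'm) grp \<Rightarrow> complex"
  where "cov s v = (if fst s then coord_fun (snd s) v else cnj (coord_fun (snd s) v))"

lemma coord_coord_vec: "coord_fun c (coord_vec d z) = (if c = d then z else 0)"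
  by (auto simp: coord_fun_def coord_vec_def axis_def split: sum.splits)

lemma coord_fun_inject: "(\<And>c. coord_fun c v = coord_fun c w) \<Longrightarrow> v = w"
proof -
  assume *: "\<And>c. coord_fun c v = coord_fun c w"
  have "fst v $ i = fst w $ i" for i using *[of "Inl i"] by (simp add: coord_fun_def)
  moreover have "snd v $ j = snd w $ j" for j using *[of "Inr j"] by (simp add: coord_fun_def)
  ultimately show ?thesis by (simp add: prod_eq_iff Finite_Cartesian_Product.vec_eq_iff)
qed

lemma bounded_linear_coord_fun: "bounded_linear (coord_fun c)"
proof -
  have "bounded_linear (\<lambda>v :: ('a, 'b) grp. fst v $ i)" for i
    by (rule bounded_linear_compose[OF bounded_linear_vec_nth bounded_linear_fst])
  moreover have "bounded_linear (\<lambda>v :: ('a, 'b) grp. snd v $ i)" for i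
    by (rule bounded_linear_compose[OF bounded_linear_vec_nth bounded_linear_snd])
  ultimately show ?thesis unfolding coord_fun_def[abs_def] by (cases c) simp_all
qed

lemma coord_fun_sum: "coord_fun c (\<Sum>i\<in>I. g i) = (\<Sum>i\<in>I. coord_fun c (g i))"
  using linear_sum[OF bounded_linear.linear[OF bounded_linear_coord_fun]] .

lemma coord_fun_add: "coord_fun c (v + w) = coord_fun c v + coord_fun c w"
  by (rule linear_add[OF bounded_linear.linear[OF bounded_linear_coord_fun]])

lemma coord_fun_scale: "coord_fun c (r *\<^sub>R v) = of_real r * coord_fun c v"
  unfolding linear_scale[OF bounded_linear.linear[OF bounded_linear_coord_fun]] by (simp add: scaleR_conv_of_real)

definition wirtinger :: "('n::finite, 'm::finite) idx \<Rightarrow> (('n, 'm) grp \<Rightarrow> complex) \<Rightarrow> ('n, 'm) grp \<Rightarrow> complex"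
  where "wirtinger s f x = 1 / 2 * (dd (coord_vec (snd s) 1) f x +
    (if fst s then - \<i> else \<i>) * dd (coord_vec (snd s) \<i>) f x)"

lemma smooth_wirtinger: "smooth f \<Longrightarrow> smooth (wirtinger s f)"
  unfolding wirtinger_def[abs_def] by (intro smooth_cmult smooth_add smooth_dd)

lemma sum_idx: "(\<Sum>s\<in>UNIV. g s) = (\<Sum>c\<in>UNIV. g (True, c) + g (False, c))"
  for g :: "bool \<times> 'c::finite \<Rightarrow> complex"
proof -
  have "(\<Sum>s\<in>UNIV. g s) = (\<Sum>h\<in>UNIV. \<Sum>c\<in>UNIV. g (h, c))"
    by (simp add: sum.cartesian_product UNIV_Times_UNIV)
  then show ?thesis by (simp add: UNIV_bool sum.distrib add.commute)
qed

lemma dd_wirtinger: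
  assumes f: "smooth f"
  shows "dd v f x = (\<Sum>s\<in>UNIV. cov s v * wirtinger s f x)"
proof -
  have "v = (\<Sum>c\<in>UNIV. Re (coord_fun c v) *\<^sub>R coord_vec c 1 + Im (coord_fun c v) *\<^sub>R coord_vec c \<i>)" (is "_ = ?v")
  proof (rule coord_fun_inject)
    fix c
    have "coord_fun c ?v = (\<Sum>d\<in>UNIV. if c = d then of_real (Re (coord_fun c v)) + of_real (Im (coord_fun c v)) * \<i> else 0)"
      unfolding coord_fun_sum coord_fun_add coord_fun_scale by (rule sum.cong) (auto simp: coord_coord_vec)
    then show "coord_fun c v = coord_fun c ?v" using complex_eq[of "coord_fun c v"] by (simp add: mult.commute)
  qed
  then have "dd v f x = dd ?v f x" by simp
  also have "\<dots> = (\<Sum>c\<in>UNIV. Re (coord_fun c v) * dd (coord_vec c 1) f x + Im (coord_fun c v) * dd (coord_vec c \<i>) f x)"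
    unfolding dd_sum_dir[OF f] dd_add_dir[OF f] dd_scale_dir[OF f] ..
  also have "\<dots> = (\<Sum>s\<in>UNIV. cov s v * wirtinger s f x)"
    unfolding sum_idx
  proof (rule sum.cong[OF refl])
    fix c
    define z where "z = coord_fun c v"
    have z: "z = Re z + \<i> * Im z" "cnj z = Re z - \<i> * Im z" by (simp_all add: complex_eq_iff)
    have "(a + \<i> * b) * (1 / 2 * (p + - \<i> * q)) + (a - \<i> * b) * (1 / 2 * (p + \<i> * q)) = a * p + b * q"
      for a b p q :: complex
      by (simp add: field_simps)
    from this[of "Re z" "Im z", folded z]
    have "z * (1 / 2 * (p + - \<i> * q)) + cnj z * (1 / 2 * (p + \<i> * q)) = of_real (Re z) * p + of_real (Im z) * q" for p q :: complex .
    then show "Re (coord_fun c v) * dd (coord_vec c 1) f x + Im (coord_fun c v) * dd (coord_vec c \<i>) f x =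
        cov (True, c) v * wirtinger (True, c) f x + cov (False, c) v * wirtinger (False, c) f x"
      by (simp add: cov_def wirtinger_def z_def)
  qed
  finally show ?thesis .
qed

text \<open>The coefficient of a covector at the wedge of the \<^const>\<open>cov\<close> over a list is obtained by inserting
  the complex dual vectors, expanded by multilinearity into real vectors.\<close>

primrec coeff_list :: "('n::finite, 'm::finite) idx list \<Rightarrow> ('n, 'm) grp covector \<Rightarrow> complex"
  where
    "coeff_list [] \<alpha> = \<alpha> []"
  | "coeff_list (s # L) \<alpha> = 1 / 2 * (coeff_list L (\<lambda>vs. \<alpha> (coord_vec (snd s) 1 # vs)) +
      (if fst s then - \<i> else \<i>) * coeff_list L (\<lambda>vs. \<alpha> (coord_vec (snd s) \<i> # vs)))"

lemma coeff_list_cong: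
  "(\<And>vs. length vs = length L \<Longrightarrow> \<alpha> vs = \<beta> vs) \<Longrightarrow> coeff_list L \<alpha> = coeff_list L \<beta>"
proof (induction L arbitrary: \<alpha> \<beta>)
  case (Cons s L)
  have "coeff_list L (\<lambda>vs. \<alpha> (v # vs)) = coeff_list L (\<lambda>vs. \<beta> (v # vs))" for v
    by (rule Cons.IH) (simp add: Cons.prems)
  then show ?case by simp
qed simp

lemma coeff_list_add: "coeff_list L (\<lambda>vs. \<alpha> vs + \<beta> vs) = coeff_list L \<alpha> + coeff_list L \<beta>"
  by (induction L arbitrary: \<alpha> \<beta>) (simp_all add: algebra_simps add_divide_distrib)

lemma coeff_list_cmult: "coeff_list L (\<lambda>vs. c * \<alpha> vs) = c * coeff_list L \<alpha>"
  by (induction L arbitrary: \<alpha>) (simp_all add: algebra_simps)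

lemma coeff_list_zero: "coeff_list L (\<lambda>vs. 0) = 0"
  by (induction L) simp_all

lemma coeff_list_sum: "coeff_list L (\<lambda>vs. \<Sum>i\<in>I. c i * \<alpha> i vs) = (\<Sum>i\<in>I. c i * coeff_list L (\<alpha> i))"
  by (induction I rule: infinite_finite_induct) (simp_all add: coeff_list_zero coeff_list_add coeff_list_cmult)

lemma smooth_coeff_list: "(\<And>vs. smooth (\<lambda>x. \<omega> x vs)) \<Longrightarrow> smooth (\<lambda>x. coeff_list L (\<omega> x))"
proof (induction L arbitrary: \<omega>)
  case (Cons s L)
  then show ?case unfolding coeff_list.simps by (intro smooth_cmult smooth_add Cons.IH Cons.prems)
qed simp

lemma coeff_list_wedge:
  assumes "length as = Suc (length L)"
  shows "coeff_list (s # L) (wedge as) = (\<Sum>i<length as. (-1) ^ i *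
    (1 / 2 * ((as ! i) (coord_vec (snd s) 1) + (if fst s then - \<i> else \<i>) * (as ! i) (coord_vec (snd s) \<i>))) *
    coeff_list L (wedge (delete_nth i as)))"
proof -
  have "coeff_list L (\<lambda>vs. wedge as (v # vs)) =
      (\<Sum>i<length as. ((-1) ^ i * (as ! i) v) * coeff_list L (wedge (delete_nth i as)))" for v
    unfolding coeff_list_sum[symmetric]
    by (rule coeff_list_cong) (simp add: wedge_column_expansion assms)
  then show ?thesis
    by (simp add: sum_distrib_left sum.distrib[symmetric] algebra_simps add_divide_distrib)
qed

lemma cov_dual:
  "1 / 2 * (cov t (coord_vec (snd s) 1) + (if fst s then - \<i> else \<i>) * cov t (coord_vec (snd s) \<i>)) =
    (if s = t then 1 else 0)"
  by (cases s; cases t) (auto simp: cov_def coord_coord_vec)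

text \<open>Expanding in the first vector selects the position of s in \<open>M\<close>. If it were
  not the first, the head of \<open>M\<close> would precede s in \<open>M\<close> and yet belong to
  the tail of the other list, whose elements come after s.\<close>

lemma coeff_list_basis:
  "sorted_idx L \<Longrightarrow> sorted_idx M \<Longrightarrow> coeff_list L (wedge (map cov M)) = (if L = M then 1 else 0)"
proof (induction L arbitrary: M)
  case Nil
  then show ?case by (auto simp: wedge_def)
next
  case (Cons s L)
  show ?case
  proof (cases "length M = Suc (length L)")
    case True
    have sorted_delete: "sorted_idx (delete_nth i M)" if "i < length M" for i
    proof -
      have "sorted_idx (take i M @ M ! i # drop (Suc i) M)"
        using Cons.prems(2) id_take_nth_drop[OF that] by metis
      then show ?thesis by (simp add: delete_nth_def sorted_wrt_append)
    qed
    have "coeff_list (s # L) (wedge (map cov M)) =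
        (\<Sum>i<length M. (-1) ^ i * (if s = M ! i then 1 else 0) * (if L = delete_nth i M then 1 else 0))"
    proof -
      have len: "length (map cov M) = Suc (length L)" using True by simp
      show ?thesis
        unfolding coeff_list_wedge[OF len, of s] length_map
      proof (rule sum.cong[OF refl])
        fix i assume "i \<in> {..<length M}"
        then have i: "i < length M" by simp
        have L: "sorted_idx L" using Cons.prems(1) by simp
        show "(- 1) ^ i * (1 / 2 * ((map cov M ! i) (coord_vec (snd s) 1) +
            (if fst s then - \<i> else \<i>) * (map cov M ! i) (coord_vec (snd s) \<i>))) *
            coeff_list L (wedge (delete_nth i (map cov M))) =
          (- 1) ^ i * (if s = M ! i then 1 else 0) * (if L = delete_nth i M then 1 else 0)"
          unfolding nth_map[OF i] cov_dual map_delete_nth[symmetric] Cons.IH[OF L sorted_delete[OF i]] ..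
      qed
    qed
    also have "\<dots> = (if s # L = M then 1 else 0)"
    proof (cases "s # L = M")
      case eq: True
      have M0: "0 < length M" "M ! 0 = s" unfolding eq[symmetric] by simp_all
      have ne: "i = 0" if "i < length M" "s = M ! i" for i
        using nth_eq_iff_index_eq[OF sorted_idx_distinct[OF Cons.prems(2)] that(1) M0(1)] that(2) M0(2) by simp
      have "(\<Sum>i<length M. (-1) ^ i * (if s = M ! i then 1 else 0) * (if L = delete_nth i M then 1 else 0)) =
          (\<Sum>i<length M. if i = 0 then 1 else 0 :: complex)"
      proof (rule sum.cong[OF refl])
        fix i assume "i \<in> {..<length M}"
        then show "(-1) ^ i * (if s = M ! i then 1 else 0) * (if L = delete_nth i M then 1 else 0) =
            (if i = 0 then 1 else 0 :: complex)"
          using ne[of i] eq by (cases "i = 0") auto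
      qed
      then show ?thesis using eq True by simp
    next
      case neq: False
      have "\<not> (s = M ! i \<and> L = delete_nth i M)" if i: "i < length M" for i
      proof
        assume h: "s = M ! i \<and> L = delete_nth i M"
        obtain a M' where M: "M = a # M'" using True by (cases M) auto
        show False
        proof (cases i)
          case 0
          then show ?thesis using h M neq by simp
        next
          case (Suc k)
          then have "a \<in> set L" using h M by simp
          then have "to_nat s < to_nat a" using Cons.prems(1) by auto
          moreover have "to_nat a < to_nat s" using Cons.prems(2) M h i Suc by auto
          ultimately show False by simp
        qed
      qed
      then have "(\<Sum>i<length M. (-1) ^ i * (if s = M ! i then 1 else 0) * (if L = delete_nth i M then 1 else 0)) = (0 :: complex)"
        by (intro sum.neutral) auto
      then show ?thesis using neq by simp
    qed
    finally show ?thesis .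
  next
    case False
    have "coeff_list (s # L) (wedge (map cov M)) = coeff_list (s # L) (\<lambda>vs. 0)"
      using False by (intro coeff_list_cong) (simp add: wedge_length)
    then show ?thesis using False by (auto simp: coeff_list_zero)
  qed
qed

definition basis_cov :: "('n::finite, 'm::finite) idx set \<Rightarrow> ('n, 'm) grp covector"
  where "basis_cov C = wedge (map cov (enum_set C))"

definition cov_coeff :: "('n::finite, 'm::finite) idx set \<Rightarrow> ('n, 'm) grp covector \<Rightarrow> complex"
  where "cov_coeff C = coeff_list (enum_set C)"

lemma coeff_basis: "cov_coeff C (basis_cov D) = (if C = D then 1 else 0)"
proof -
  have "enum_set C = enum_set D \<longleftrightarrow> C = D" by (metis set_enum_set)
  then show ?thesis unfolding cov_coeff_def basis_cov_def by (simp add: coeff_list_basis[OF sorted_enum_set sorted_enum_set])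
qed

definition comb :: "('n::finite, 'm::finite) idx set set \<Rightarrow> (('n, 'm) idx set \<Rightarrow> complex) \<Rightarrow> ('n, 'm) grp covector"
  where "comb T a vs = (\<Sum>C\<in>T. a C * basis_cov C vs)"

lemma coeff_comb: "cov_coeff C (comb T a) = (if C \<in> T then a C else 0)"
proof -
  have "cov_coeff C (comb T a) = (\<Sum>D\<in>T. a D * cov_coeff C (basis_cov D))"
    unfolding comb_def[abs_def] cov_coeff_def by (rule coeff_list_sum)
  then show ?thesis by (simp add: coeff_basis if_distrib[of "\<lambda>z. _ * z"] cong: if_cong)
qed

section \<open>Bidegrees and the complex structure in coordinates\<close>

definition bidegree_sets :: "nat \<Rightarrow> nat \<Rightarrow> (bool \<times> 'c::finite) set set"
  where "bidegree_sets p q = {C. card {s \<in> C. fst s} = p \<and> card {s \<in> C. \<not> fst s} = q}"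

definition psi_factor :: "real \<Rightarrow> ('n::finite, 'm::finite) grp \<Rightarrow> ('n, 'm) idx \<Rightarrow> complex"
  where "psi_factor lam x s = (case snd s of Inl i \<Rightarrow> 1 | Inr j \<Rightarrow>
    (let z = (if odd_index j then exp (- of_real lam * a_fun (fst x)) else exp (of_real lam * cnj (a_fun (fst x))))
     in if fst s then z else cnj z))"

definition idx_list :: "('n \<times> bool) list \<Rightarrow> ('m \<times> bool) list \<Rightarrow> ('n \<times> bool) list \<Rightarrow> ('m \<times> bool) list \<Rightarrow>
    ('n, 'm) idx list"
  where "idx_list I J K L = map (\<lambda>i. (True, Inl i)) I @ map (\<lambda>j. (True, Inr j)) J @
    map (\<lambda>i. (False, Inl i)) K @ map (\<lambda>j. (False, Inr j)) L"

lemma coframe_form_eq: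
  "coframe_form lam I J K L x vs =
    prod_list (map (psi_factor lam x) (idx_list I J K L)) * wedge (map cov (idx_list I J K L)) vs"
proof -
  have "coframe_form lam I J K L x = wedge (map (\<lambda>s v. psi_factor lam x s * cov s v) (idx_list I J K L))"
    unfolding coframe_form_def idx_list_def
    by (simp add: comp_def phi_def[abs_def] psi_def[abs_def] psi_factor_def cov_def coord_fun_def Let_def if_distrib[of cnj])
  then show ?thesis by (simp add: wedge_scale)
qed

lemma psi_factor_nonzero: "prod_list (map (psi_factor lam x) A) \<noteq> 0"
  by (induction A) (auto simp: psi_factor_def Let_def split: sum.splits)

lemma distinct_idx_list:
  "distinct (idx_list I J K L) \<longleftrightarrow> distinct I \<and> distinct J \<and> distinct K \<and> distinct L"
  by (auto simp: idx_list_def distinct_map inj_on_def)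

lemma idx_list_bidegree:
  assumes "distinct (idx_list I J K L)"
  shows "set (idx_list I J K L) \<in> bidegree_sets p q \<longleftrightarrow> length I + length J = p \<and> length K + length L = q"
proof -
  let ?A = "map (\<lambda>i. (True, Inl i)) I @ map (\<lambda>j. (True, Inr j)) J"
  let ?B = "map (\<lambda>i. (False, Inl i)) K @ map (\<lambda>j. (False, Inr j)) L"
  have "{s \<in> set (idx_list I J K L). fst s} = set ?A" "{s \<in> set (idx_list I J K L). \<not> fst s} = set ?B"
    by (auto simp: idx_list_def)
  moreover have "distinct ?A" "distinct ?B" using assms by (auto simp: idx_list_def)
  then have "card (set ?A) = length I + length J" "card (set ?B) = length K + length L"
    by (simp_all only: distinct_card length_append length_map)
  ultimately show ?thesis unfolding bidegree_sets_def mem_Collect_eq by (simp only:)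
qed

lemma multi_indices_bidegree:
  "(I, J, K, L) \<in> multi_indices p q \<longleftrightarrow>
    distinct (idx_list I J K L) \<and> set (idx_list I J K L) \<in> bidegree_sets p q"
  using idx_list_bidegree[of I J K L p q] by (auto simp: multi_indices_def distinct_idx_list)

lemma ex_multi_indices:
  fixes C :: "('n::finite, 'm::finite) idx set"
  assumes "C \<in> bidegree_sets p q"
  obtains I J K L where "(I, J, K, L) \<in> multi_indices p q" "set (idx_list I J K L) = C"
proof -
  define I where "I = enum_set {i. (True, Inl i) \<in> C}"
  define J where "J = enum_set {i. (True, Inr i) \<in> C}"
  define K where "K = enum_set {i. (False, Inl i) \<in> C}"
  define L where "L = enum_set {i. (False, Inr i) \<in> C}"
  have "s \<in> set (idx_list I J K L) \<longleftrightarrow> s \<in> C" for s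
    by (cases s; cases "fst s"; cases "snd s") (auto simp: idx_list_def I_def J_def K_def L_def)
  then have "set (idx_list I J K L) = C" by auto
  moreover have "distinct (idx_list I J K L)"
    by (simp add: distinct_idx_list I_def J_def K_def L_def distinct_enum_set)
  ultimately show ?thesis using that assms multi_indices_bidegree by blast
qed

lemma wedge_idx_list:
  assumes "(I, J, K, L) \<in> multi_indices p q"
  obtains c where "c \<noteq> 0" "\<And>vs. wedge (map cov (idx_list I J K L)) vs = c * basis_cov (set (idx_list I J K L)) vs"
proof -
  have "distinct (idx_list I J K L)" using assms by (simp add: multi_indices_bidegree)
  from wedge_distinct_list[OF this, of cov] obtain c where c: "c = 1 \<or> c = - 1"
    "\<forall>vs. wedge (map cov (idx_list I J K L)) vs = c * wedge (map cov (enum_set (set (idx_list I J K L)))) vs"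
    by (elim exE conjE)
  show ?thesis
  proof (rule that)
    show "c \<noteq> 0" using c(1) by auto
    show "wedge (map cov (idx_list I J K L)) vs = c * basis_cov (set (idx_list I J K L)) vs" for vs
      unfolding basis_cov_def by (rule spec[OF c(2)])
  qed
qed

lemma sum_fun_apply: "(\<Sum>i\<in>I. f i) x = (\<Sum>i\<in>I. f i x)"
  by (induction I rule: infinite_finite_induct) simp_all

lemma comb_in_span:
  assumes "\<And>C. C \<in> T \<Longrightarrow> basis_cov C \<in> covector.span S"
  shows "comb T a \<in> covector.span S"
proof -
  have "comb T a = (\<Sum>C\<in>T. covector_scale (a C) (basis_cov C))"
    by (simp add: fun_eq_iff comb_def sum_fun_apply covector_scale_def)
  then show ?thesis using assms by (auto intro!: covector.span_sum covector.span_scale)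
qed

lemma comb_zero: "comb T (\<lambda>C. 0) = 0"
  by (simp add: fun_eq_iff comb_def)

lemma comb_add: "comb T a + comb T b = comb T (\<lambda>C. a C + b C)"
  by (simp add: fun_eq_iff comb_def distrib_right sum.distrib)

lemma comb_scale: "covector_scale c (comb T a) = comb T (\<lambda>C. c * a C)"
  by (simp add: fun_eq_iff comb_def covector_scale_def sum_distrib_left mult.assoc)

lemma comb_subspace: "covector.subspace (range (comb T))"
  unfolding covector.subspace_def
proof (intro conjI ballI allI)
  show "0 \<in> range (comb T)" by (rule range_eqI) (rule comb_zero[symmetric])
  show "x + y \<in> range (comb T)" if "x \<in> range (comb T)" "y \<in> range (comb T)" for x y
    using that by (auto simp: comb_add)
  show "covector_scale c x \<in> range (comb T)" if "x \<in> range (comb T)" for c x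
    using that by (auto simp: comb_scale)
qed

text \<open>At each point the coframe differs from the coordinate differentials by nonzero factors
  only. So the complex structure is the standard one of the coordinates w and z, and the space
  depends neither on \<open>lam\<close> nor on \<open>x\<close>.\<close>

lemma bidegree_space_eq: "bidegree_space lam p q x = range (comb (bidegree_sets p q))"
proof
  show "bidegree_space lam p q x \<subseteq> range (comb (bidegree_sets p q))"
    unfolding bidegree_space_def
  proof (rule covector.span_minimal[OF _ comb_subspace], safe)
    fix I :: "('a \<times> bool) list" and J :: "('b \<times> bool) list" and K L
    assume m: "(I, J, K, L) \<in> multi_indices p q"
    let ?C = "set (idx_list I J K L)"
    obtain c where c: "\<And>vs. wedge (map cov (idx_list I J K L)) vs = c * basis_cov ?C vs"
      using wedge_idx_list[OF m] by metis
    have "coframe_form lam I J K L x = comb (bidegree_sets p q)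
        (\<lambda>D. if D = ?C then prod_list (map (psi_factor lam x) (idx_list I J K L)) * c else 0)"
      using m unfolding multi_indices_bidegree
      by (simp add: fun_eq_iff coframe_form_eq c comb_def if_distrib[of "\<lambda>z. z * _"] cong: if_cong)
    then show "coframe_form lam I J K L x \<in> range (comb (bidegree_sets p q))" by simp
  qed
  have "basis_cov C \<in> bidegree_space lam p q x" if C: "C \<in> bidegree_sets p q" for C :: "('a, 'b) idx set"
  proof -
    obtain I J K L where m: "(I, J, K, L) \<in> multi_indices p q" "set (idx_list I J K L) = C"
      using ex_multi_indices[OF C] .
    obtain c where c: "c \<noteq> 0" "\<And>vs. wedge (map cov (idx_list I J K L)) vs = c * basis_cov C vs"
      using wedge_idx_list[OF m(1)] m(2) by metis
    let ?k = "prod_list (map (psi_factor lam x) (idx_list I J K L)) * c"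
    have "?k \<noteq> 0" using c(1) psi_factor_nonzero by simp
    then have eq: "basis_cov C = covector_scale (1 / ?k) (coframe_form lam I J K L x)"
      by (simp add: fun_eq_iff covector_scale_def coframe_form_eq c(2))
    have "coframe_form lam I J K L x \<in> bidegree_space lam p q x"
      unfolding bidegree_space_def using m(1) by (blast intro: covector.span_base)
    then show ?thesis unfolding eq bidegree_space_def by (rule covector.span_scale)
  qed
  then show "range (comb (bidegree_sets p q)) \<subseteq> bidegree_space lam p q x"
    using comb_in_span unfolding bidegree_space_def by auto
qed

lemma bidegree_part_comb:
  fixes \<omega> :: "('n::finite, 'm::finite) grp form"
  assumes \<omega>: "\<omega> x = comb UNIV a"
  shows "bidegree_part lam p q \<omega> x = comb (bidegree_sets p q) a"
  unfolding bidegree_part_def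
proof (rule the_equality)
  let ?T = "bidegree_sets p q :: ('n, 'm) idx set set"
  let ?S = "\<Union>(r, s)\<in>- {(p, q)}. bidegree_space lam r s x"
  have diff: "comb UNIV a - comb ?T a = comb (- ?T) a"
  proof -
    have "(\<Sum>C\<in>UNIV. a C * basis_cov C vs) = (\<Sum>C\<in>UNIV - ?T. a C * basis_cov C vs) + (\<Sum>C\<in>?T. a C * basis_cov C vs)" for vs
      by (rule sum.subset_diff) auto
    then show ?thesis by (simp add: fun_eq_iff comb_def Compl_eq_Diff_UNIV)
  qed
  have "comb (- ?T) a \<in> covector.span ?S"
  proof (rule comb_in_span, rule covector.span_base)
    fix C :: "('n, 'm) idx set" assume C: "C \<in> - ?T"
    let ?r = "card {s \<in> C. fst s}" and ?s = "card {s \<in> C. \<not> fst s}"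
    have "C \<in> bidegree_sets ?r ?s" by (simp add: bidegree_sets_def)
    then have "basis_cov C = comb (bidegree_sets ?r ?s) (\<lambda>D. if D = C then 1 else 0)"
      by (simp add: fun_eq_iff comb_def if_distrib[of "\<lambda>z. z * _"] cong: if_cong)
    then have "basis_cov C \<in> bidegree_space lam ?r ?s x" unfolding bidegree_space_eq by simp
    moreover have "(?r, ?s) \<noteq> (p, q)" using C by (auto simp: bidegree_sets_def)
    ultimately show "basis_cov C \<in> ?S" by blast
  qed
  then show "comb ?T a \<in> bidegree_space lam p q x \<and> \<omega> x - comb ?T a \<in> covector.span ?S"
    unfolding \<omega> diff bidegree_space_eq by simp
  fix \<alpha> assume \<alpha>: "\<alpha> \<in> bidegree_space lam p q x \<and> \<omega> x - \<alpha> \<in> covector.span ?S"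
  then obtain b where b: "\<alpha> = comb ?T b" unfolding bidegree_space_eq by auto
  \<comment> \<open>\<open>cov_coeff C\<close> annihilates all other bidegrees, so it reads the
    coefficient off any admissible (p,q)-component; this gives uniqueness.\<close>
  have "a C = b C" if C: "C \<in> ?T" for C
  proof -
    have "covector.subspace {\<beta>. cov_coeff C \<beta> = 0}"
      unfolding covector.subspace_def cov_coeff_def covector_scale_def
      by (simp add: coeff_list_cmult coeff_list_add plus_fun_def zero_fun_def coeff_list_zero)
    moreover have "?S \<subseteq> {\<beta>. cov_coeff C \<beta> = 0}"
    proof
      fix \<beta> assume "\<beta> \<in> ?S"
      then obtain r s b where rs: "(r, s) \<noteq> (p, q)" "\<beta> = comb (bidegree_sets r s) b"
        unfolding bidegree_space_eq by auto
      have "C \<notin> bidegree_sets r s" using C rs(1) by (auto simp: bidegree_sets_def)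
      then show "\<beta> \<in> {\<beta>. cov_coeff C \<beta> = 0}" by (simp add: rs coeff_comb)
    qed
    ultimately have "covector.span ?S \<subseteq> {\<beta>. cov_coeff C \<beta> = 0}" by (rule covector.span_minimal[rotated])
    then have "cov_coeff C (comb UNIV a - comb ?T b) = 0" using \<alpha> \<omega> b by auto
    moreover have "cov_coeff C (comb UNIV a - comb ?T b) = cov_coeff C (comb UNIV a) - cov_coeff C (comb ?T b)"
      using coeff_list_add[of "enum_set C" "comb UNIV a" "\<lambda>vs. - 1 * comb ?T b vs"]
        coeff_list_cmult[of "enum_set C" "- 1" "comb ?T b"]
      by (simp add: cov_coeff_def fun_diff_def)
    ultimately show ?thesis using C by (simp add: coeff_comb)
  qed
  then show "\<alpha> = comb ?T a" unfolding b by (simp add: fun_eq_iff comb_def)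
qed

section \<open>Forms as cochains\<close>

text \<open>The exponent of \<open>lam * w_sum\<close> in \<beta>_j \<psi>^j and in \<gamma>_l times
  the conjugate of \<psi>^l: for both it depends only on the parity of the index. Left translation
  by lattice elements scales the corresponding differential with the opposite exponent.\<close>

definition idx_sign :: "('n, 'm) idx \<Rightarrow> real"
  where "idx_sign s = (case snd s of Inl i \<Rightarrow> 0 | Inr j \<Rightarrow> if odd_index j then - 1 else 1)"

definition w_sum :: "('n::finite, 'm::finite) grp \<Rightarrow> complex"
  where "w_sum x = (\<Sum>i\<in>UNIV. fst x $ i)"

text \<open>The factor by which \<open>\<beta>\<^sub>J \<gamma>\<^sub>L \<phi>\<^sup>I \<and> \<psi>\<^sup>J \<and> \<dots>\<close> differs from the wedge of coordinate
  differentials; it is holomorphic.\<close>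

definition twist :: "real \<Rightarrow> ('n, 'm) idx set \<Rightarrow> ('n::finite, 'm::finite) grp \<Rightarrow> complex"
  where "twist lam C x = exp (of_real (lam * (\<Sum>s\<in>C. idx_sign s)) * w_sum x)"

text \<open>The exponential is the quotient of the twists of \<open>C - {s}\<close> and
  \<open>C\<close>, so for conjugate indices s this is the antiholomorphic derivative expressed in
  the twisted frame. In base directions the exponential is 1.\<close>

definition zop :: "real \<Rightarrow> ('n, 'm) idx \<Rightarrow> (('n::finite, 'm::finite) grp \<Rightarrow> complex) \<Rightarrow> ('n, 'm) grp \<Rightarrow> complex"
  where "zop lam s f x = exp (- of_real (lam * idx_sign s) * w_sum x) * wirtinger s f x"

text \<open>Coefficients refer to the frame \<open>twist * basis_cov\<close>. Lattice elements
  preserve this frame, so invariant forms have invariant coefficients, and constant coefficients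
  give B.\<close>

definition form_of :: "real \<Rightarrow> nat \<Rightarrow> nat \<Rightarrow> (('n, 'm) idx set \<Rightarrow> ('n::finite, 'm::finite) grp \<Rightarrow> complex) \<Rightarrow> ('n, 'm) grp form"
  where "form_of lam p q f x = comb (bidegree_sets p q) (\<lambda>C. f C x * twist lam C x)"

lemma bounded_linear_w_sum: "bounded_linear w_sum"
proof -
  have "bounded_linear (\<lambda>x. \<Sum>i\<in>UNIV. coord_fun (Inl i) x)"
    by (rule bounded_linear_sum) (rule bounded_linear_coord_fun)
  then show ?thesis by (simp add: w_sum_def[abs_def] coord_fun_def)
qed

lemma smooth_exp_w_sum: "smooth (\<lambda>x. exp (c * w_sum x))"
  by (intro smooth_exp smooth_cmult smooth_linear bounded_linear_w_sum)

lemma smooth_twist: "smooth (twist lam C)"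
  unfolding twist_def[abs_def] by (rule smooth_exp_w_sum)

lemma twist_nonzero: "twist lam C x \<noteq> 0"
  by (simp add: twist_def)

lemma w_sum_coord_vec: "w_sum (coord_vec c z) = (case c of Inl i \<Rightarrow> z | Inr j \<Rightarrow> 0)"
  by (cases c) (simp_all add: w_sum_def coord_vec_def axis_def)

lemma dd_exp_w_sum: "dd v (\<lambda>x. exp (c * w_sum x)) x = c * w_sum v * exp (c * w_sum x)"
proof (rule dd_eqI)
  have "((\<lambda>x. c * w_sum x) has_derivative (\<lambda>v. c * w_sum v)) (at x)"
    by (rule has_derivative_mult_right[OF bounded_linear_imp_has_derivative[OF bounded_linear_w_sum]])
  from has_derivative_compose[OF this DERIV_exp[of "c * w_sum x", unfolded has_field_derivative_def]]
  show "((\<lambda>x. exp (c * w_sum x)) has_derivative (\<lambda>v. c * w_sum v * exp (c * w_sum x))) (at x)"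
    by (simp add: mult_ac)
qed

lemma wirtinger_exp_w_sum:
  "\<not> fst s \<Longrightarrow> wirtinger s (\<lambda>x. exp (c * w_sum x)) x = 0"
  by (simp add: wirtinger_def dd_exp_w_sum w_sum_coord_vec mult_ac split: sum.splits)

lemma wirtinger_mult:
  assumes "smooth f" "smooth g"
  shows "wirtinger s (\<lambda>x. f x * g x) x = f x * wirtinger s g x + wirtinger s f x * g x"
  unfolding wirtinger_def dd_mult_fun[OF assms] by (simp add: field_simps)

lemma wirtinger_twist:
  assumes f: "smooth f" and s: "\<not> fst s" "s \<in> C"
  shows "wirtinger s (\<lambda>x. f x * twist lam (C - {s}) x) x = zop lam s f x * twist lam C x"
proof -
  have "(\<Sum>s\<in>C. idx_sign s) = idx_sign s + (\<Sum>s\<in>C - {s}. idx_sign s)"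
    using s(2) by (simp add: sum.remove)
  then have "twist lam (C - {s}) x = exp (- of_real (lam * idx_sign s) * w_sum x) * twist lam C x"
    by (simp add: twist_def flip: exp_add) (simp add: algebra_simps)
  moreover have "wirtinger s (twist lam (C - {s})) x = 0"
    unfolding twist_def[abs_def] by (rule wirtinger_exp_w_sum[OF s(1)])
  ultimately show ?thesis
    unfolding wirtinger_mult[OF f smooth_twist] by (simp add: zop_def)
qed

text \<open>The alternating sum over the arguments in \<open>ext_d\<close> is the row expansion of
  \<open>cov s\<close> wedged with a basis covector; sorting s into place then brings in
  \<open>ksign\<close>.\<close>

lemma ext_d_comb:
  fixes h :: "('n::finite, 'm::finite) idx set \<Rightarrow> ('n, 'm) grp \<Rightarrow> complex"
  assumes h: "\<And>C. smooth (h C)"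
  shows "ext_d (\<lambda>x. comb T (\<lambda>C. h C x)) x = comb UNIV (\<lambda>D. \<Sum>s | s \<in> D \<and> D - {s} \<in> T.
    ksign s (D - {s}) * wirtinger s (h (D - {s})) x)"
proof
  fix vs
  have "ext_d (\<lambda>x. comb T (\<lambda>C. h C x)) x vs =
      (\<Sum>i<length vs. (- 1) ^ i * dd (vs ! i) (\<lambda>y. \<Sum>C\<in>T. basis_cov C (delete_nth i vs) * h C y) x)"
    unfolding ext_d_def comb_def dd_def delete_nth_def by (simp add: mult.commute)
  also have "\<dots> = (\<Sum>i<length vs. (- 1) ^ i * (\<Sum>C\<in>T. basis_cov C (delete_nth i vs) * (\<Sum>s\<in>UNIV. cov s (vs ! i) * wirtinger s (h C) x)))"
  proof (intro sum.cong refl arg_cong2[of _ _ _ _ "(*)"])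
    fix i
    have "dd v (\<lambda>y. \<Sum>C\<in>T. c C * h C y) = (\<lambda>y. \<Sum>C\<in>T. c C * dd v (h C) y)" for v and c :: "_ \<Rightarrow> complex"
      by (induction T rule: infinite_finite_induct)
        (simp_all add: dd_const dd_add_fun dd_cmult smooth_cmult smooth_sum h)
    then show "dd (vs ! i) (\<lambda>y. \<Sum>C\<in>T. basis_cov C (delete_nth i vs) * h C y) x =
        (\<Sum>C\<in>T. basis_cov C (delete_nth i vs) * (\<Sum>s\<in>UNIV. cov s (vs ! i) * wirtinger s (h C) x))"
      by (simp add: dd_wirtinger[OF h])
  qed
  also have "\<dots> = (\<Sum>i<length vs. \<Sum>C\<in>T. \<Sum>s\<in>UNIV. wirtinger s (h C) x *
      ((- 1) ^ i * cov s (vs ! i) * basis_cov C (delete_nth i vs)))"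
    by (simp add: sum_distrib_left mult_ac)
  also have "\<dots> = (\<Sum>C\<in>T. \<Sum>i<length vs. \<Sum>s\<in>UNIV. wirtinger s (h C) x *
      ((- 1) ^ i * cov s (vs ! i) * basis_cov C (delete_nth i vs)))"
    by (rule sum.swap)
  also have "\<dots> = (\<Sum>C\<in>T. \<Sum>s\<in>UNIV. wirtinger s (h C) x * wedge (map cov (s # enum_set C)) vs)"
    unfolding basis_cov_def list.map wedge_row_expansion_all[symmetric] sum_distrib_left
    by (intro sum.cong refl sum.swap)
  also have "\<dots> = (\<Sum>C\<in>T. \<Sum>s\<in>- C. ksign s C * wirtinger s (h C) x * basis_cov (insert s C) vs)"
    unfolding wedge_Cons_enum_set basis_cov_def
    by (intro sum.cong refl sum.mono_neutral_cong_right) auto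
  also have "\<dots> = (\<Sum>(C, s)\<in>(SIGMA C:T. - C). ksign s C * wirtinger s (h C) x * basis_cov (insert s C) vs)"
    by (rule sum.Sigma) auto
  also have "\<dots> = (\<Sum>(D, s)\<in>(SIGMA D:UNIV. {s. s \<in> D \<and> D - {s} \<in> T}).
      ksign s (D - {s}) * wirtinger s (h (D - {s})) x * basis_cov D vs)"
    by (rule sum.reindex_bij_witness[where i = "\<lambda>(D, s). (D - {s}, s)" and j = "\<lambda>(C, s). (insert s C, s)"])
      (auto simp: insert_absorb)
  also have "\<dots> = (\<Sum>D\<in>UNIV. \<Sum>s | s \<in> D \<and> D - {s} \<in> T. ksign s (D - {s}) * wirtinger s (h (D - {s})) x * basis_cov D vs)"
    by (rule sum.Sigma[symmetric]) auto
  finally show "ext_d (\<lambda>x. comb T (\<lambda>C. h C x)) x vs = comb UNIV (\<lambda>D. \<Sum>s | s \<in> D \<and> D - {s} \<in> T.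
      ksign s (D - {s}) * wirtinger s (h (D - {s})) x) vs"
    by (simp add: comb_def sum_distrib_right)
qed

definition antihol :: "('n, 'm) idx set"
  where "antihol = {s. \<not> fst s}"

lemma bidegree_remove:
  fixes D :: "('n::finite, 'm::finite) idx set"
  assumes D: "D \<in> bidegree_sets p (Suc q)" and s: "s \<in> D"
  shows "D - {s} \<in> bidegree_sets p q \<longleftrightarrow> s \<in> antihol"
proof (cases "fst s")
  case True
  have "{t \<in> D - {s}. \<not> fst t} = {t \<in> D. \<not> fst t}" using True by auto
  then show ?thesis using D True by (simp add: bidegree_sets_def antihol_def)
next
  case False
  have "{t \<in> D - {s}. \<not> fst t} = {t \<in> D. \<not> fst t} - {s}" "{t \<in> D - {s}. fst t} = {t \<in> D. fst t}"
    using False by auto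
  then show ?thesis using D False s by (simp add: bidegree_sets_def antihol_def)
qed

text \<open>Taking the (p, q + 1)-part keeps exactly the conjugate indices, and the holomorphic
  twist is not differentiated by them. The result is the Koszul differential of the
  coefficients.\<close>

lemma dbar_form_of:
  fixes f :: "('n::finite, 'm::finite) idx set \<Rightarrow> ('n, 'm) grp \<Rightarrow> complex"
  assumes f: "\<And>C. smooth (f C)"
  shows "dbar lam p q (form_of lam p q f) = form_of lam p (Suc q)
    (\<lambda>D x. \<Sum>s\<in>D \<inter> antihol. ksign s (D - {s}) * zop lam s (f (D - {s})) x)"
proof
  fix x
  let ?a = "\<lambda>D. \<Sum>s | s \<in> D \<and> D - {s} \<in> bidegree_sets p q.
    ksign s (D - {s}) * wirtinger s (\<lambda>x. f (D - {s}) x * twist lam (D - {s}) x) x"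
  have "ext_d (form_of lam p q f) x = comb UNIV ?a"
    unfolding form_of_def[abs_def] by (rule ext_d_comb) (intro smooth_mult f smooth_twist)
  then have "dbar lam p q (form_of lam p q f) x = comb (bidegree_sets p (Suc q)) ?a"
    unfolding dbar_def by (rule bidegree_part_comb)
  also have "\<dots> = comb (bidegree_sets p (Suc q))
      (\<lambda>D. (\<Sum>s\<in>D \<inter> antihol. ksign s (D - {s}) * zop lam s (f (D - {s})) x) * twist lam D x)"
  proof
    fix vs
    have "?a D = (\<Sum>s\<in>D \<inter> antihol. ksign s (D - {s}) * zop lam s (f (D - {s})) x) * twist lam D x"
      if D: "D \<in> bidegree_sets p (Suc q)" for D
    proof -
      have "{s. s \<in> D \<and> D - {s} \<in> bidegree_sets p q} = D \<inter> antihol"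
        using bidegree_remove[OF D] by auto
      then show ?thesis
        by (auto simp: sum_distrib_right wirtinger_twist[OF f] antihol_def mult.assoc intro!: sum.cong)
    qed
    then show "comb (bidegree_sets p (Suc q)) ?a vs = comb (bidegree_sets p (Suc q))
        (\<lambda>D. (\<Sum>s\<in>D \<inter> antihol. ksign s (D - {s}) * zop lam s (f (D - {s})) x) * twist lam D x) vs"
      by (simp add: comb_def)
  qed
  finally show "dbar lam p q (form_of lam p q f) x = form_of lam p (Suc q)
    (\<lambda>D x. \<Sum>s\<in>D \<inter> antihol. ksign s (D - {s}) * zop lam s (f (D - {s})) x) x"
    by (simp add: form_of_def)
qed

section \<open>Invariant forms as families of invariant functions\<close>

definition invariant_funs :: "real \<Rightarrow> ('n::finite, 'm::finite) grp set \<Rightarrow> (('n, 'm) grp \<Rightarrow> complex) set"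
  where "invariant_funs lam \<Gamma> = {f. smooth f \<and> (\<forall>\<gamma>\<in>\<Gamma>. \<forall>x. f (gmult lam \<gamma> x) = f x)}"

lemma diagonal_mult: "diagonal d *v v = (\<chi> i. d i * v $ i)"
  by (simp add: diagonal_def matrix_vector_mult_def Finite_Cartesian_Product.vec_eq_iff if_distrib[of "\<lambda>z. z * _"] cong: if_cong)

definition left_lin :: "real \<Rightarrow> ('n::finite, 'm::finite) grp \<Rightarrow> ('n, 'm) grp \<Rightarrow> ('n, 'm) grp"
  where "left_lin lam \<gamma> v = (fst v, rho lam (fst \<gamma>) *v snd v)"

lemma gmult_left_lin: "gmult lam \<gamma> x = \<gamma> + left_lin lam \<gamma> x"
  by (simp add: gmult_def left_lin_def prod_eq_iff add.commute)

lemma bounded_linear_left_lin: "bounded_linear (left_lin lam \<gamma>)"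
  unfolding left_lin_def[abs_def]
  by (intro bounded_linear_Pair bounded_linear_fst bounded_linear_compose[OF matrix_vector_mul_bounded_linear bounded_linear_snd])

lemma gmult_derivative: "frechet_derivative (gmult lam \<gamma>) (at x) = left_lin lam \<gamma>"
proof -
  have "(gmult lam \<gamma> has_derivative left_lin lam \<gamma>) (at x)"
    unfolding gmult_left_lin[abs_def]
    using bounded_linear_imp_has_derivative[OF bounded_linear_left_lin, of lam \<gamma> "at x"]
    by (auto intro!: derivative_eq_intros)
  then show ?thesis by (rule frechet_derivative_at[symmetric])
qed

lemma basis_cov_scale:
  assumes "\<And>s v. cov s (L v) = c s * cov s v"
  shows "basis_cov C (map L vs) = (\<Prod>s\<in>C. c s) * basis_cov C vs"
proof -
  have "basis_cov C (map L vs) = wedge (map (\<lambda>s v. c s * cov s v) (enum_set C)) vs"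
    unfolding basis_cov_def wedge_map by (simp add: comp_def assms)
  also have "\<dots> = prod_list (map c (enum_set C)) * basis_cov C vs"
    unfolding basis_cov_def by (rule wedge_scale)
  also have "prod_list (map c (enum_set C)) = (\<Prod>s\<in>C. c s)"
    using prod.distinct_set_conv_list[OF distinct_enum_set, of c C] by simp
  finally show ?thesis .
qed

text \<open>The condition on \<open>\<Gamma>\<close> expresses that the functions \<open>\<beta>\<close> and \<open>\<gamma>\<close> are trivial on the lattice.\<close>

context
  fixes lam :: real and \<Gamma> :: "('n::finite, 'm::finite) grp set"
  assumes \<Gamma>: "\<And>\<gamma>. \<gamma> \<in> \<Gamma> \<Longrightarrow> \<exists>r::real. exp (of_real lam * a_fun (fst \<gamma>)) = exp (of_real r) \<and>
    exp (of_real lam * w_sum \<gamma>) = exp (of_real r)"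
begin

text \<open>Left translation scales the differential with index s by exp (-r
  \<open>idx_sign s\<close>), while \<open>w_sum\<close> shifts by \<open>w_sum \<gamma>\<close> and
  the twist gains the reciprocal factor.\<close>

lemma twist_gmult:
  assumes \<gamma>: "\<gamma> \<in> \<Gamma>"
  shows "basis_cov C (map (left_lin lam \<gamma>) vs) * twist lam C (gmult lam \<gamma> x) = basis_cov C vs * twist lam C x"
proof -
  obtain r :: real where r: "exp (of_real lam * a_fun (fst \<gamma>)) = exp (of_real r)"
    "exp (of_real lam * w_sum \<gamma>) = exp (of_real r)" using \<Gamma>[OF \<gamma>] by blast
  have r': "exp (- of_real lam * cnj (a_fun (fst \<gamma>))) = exp (- of_real r)"
  proof -
    have "exp (- of_real lam * cnj (a_fun (fst \<gamma>))) = inverse (cnj (exp (of_real lam * a_fun (fst \<gamma>))))"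
      by (simp add: exp_cnj exp_minus)
    then show ?thesis unfolding r(1) by (simp add: exp_cnj exp_minus)
  qed
  define c where "c s = complex_of_real (exp (- r * idx_sign s))" for s :: "('n, 'm) idx"
  have "cov s (left_lin lam \<gamma> v) = c s * cov s v" for s and v :: "('n, 'm) grp"
    using r(1) r' exp_of_real[of "- r", where 'a = complex, unfolded of_real_minus] by (cases s; cases "snd s")
      (auto simp: cov_def coord_fun_def left_lin_def rho_def diagonal_mult c_def idx_sign_def exp_of_real exp_cnj)
  then have b: "basis_cov C (map (left_lin lam \<gamma>) vs) = (\<Prod>s\<in>C. c s) * basis_cov C vs"
    by (rule basis_cov_scale)
  have "(\<Prod>s\<in>C. c s) = exp (of_real (- r * (\<Sum>s\<in>C. idx_sign s)))"
  proof -
    have "(\<Prod>s\<in>C. c s) = of_real (\<Prod>s\<in>C. exp (- r * idx_sign s))" by (simp add: c_def)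
    also have "\<dots> = of_real (exp (- r * (\<Sum>s\<in>C. idx_sign s)))"
      unfolding sum_distrib_left by (subst exp_sum) auto
    finally show ?thesis by (simp only: exp_of_real)
  qed
  moreover have "twist lam C (gmult lam \<gamma> x) = exp (of_real (r * (\<Sum>s\<in>C. idx_sign s))) * twist lam C x"
  proof -
    define e where "e = (\<Sum>s\<in>C. idx_sign s)"
    have w: "w_sum (gmult lam \<gamma> x) = w_sum \<gamma> + w_sum x" by (simp add: w_sum_def gmult_def sum.distrib)
    have "exp (of_real (lam * e) * w_sum \<gamma>) = exp (of_real (r * e))" 
    proof -
      obtain n where "of_real lam * w_sum \<gamma> = of_real r + of_int (2 * n) * pi * \<i>"
        using r(2) unfolding exp_eq by blast
      \<comment> \<open>Only the value of \<open>exp (lam * w_sum \<gamma>)\<close> is known, not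
        its exponent; it determines the power for integer \<open>e\<close>.\<close>
      have "e \<in> \<int>"
        unfolding e_def idx_sign_def by (intro Ints_sum) (auto split: sum.splits)
      then obtain k where k: "e = of_int k" by (elim Ints_cases)
      have "exp (of_real (lam * e) * w_sum \<gamma>) = exp (of_real lam * w_sum \<gamma>) powi k"
        unfolding k by (simp add: exp_power_int mult_ac)
      also have "\<dots> = exp (of_real (r * e))"
        unfolding r(2) k by (simp add: exp_power_int mult_ac)
      finally show ?thesis .
    qed
    then show ?thesis unfolding twist_def w e_def[symmetric] by (simp add: distrib_left exp_add)
  qed
  ultimately show ?thesis unfolding b by (simp add: exp_minus)
qed

lemma pullback_form_of:
  assumes \<gamma>: "\<gamma> \<in> \<Gamma>"
  shows "pullback (gmult lam \<gamma>) (form_of lam p q f) = form_of lam p q (\<lambda>C x. f C (gmult lam \<gamma> x))"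
proof (intro ext)
  fix x vs
  have eq: "f C (gmult lam \<gamma> x) * twist lam C (gmult lam \<gamma> x) * basis_cov C (map (left_lin lam \<gamma>) vs) =
      f C (gmult lam \<gamma> x) * twist lam C x * basis_cov C vs" for C
    using twist_gmult[OF \<gamma>, of C vs x] by (simp add: mult_ac)
  show "pullback (gmult lam \<gamma>) (form_of lam p q f) x vs = form_of lam p q (\<lambda>C x. f C (gmult lam \<gamma> x)) x vs"
    unfolding pullback_def form_of_def comb_def gmult_derivative by (intro sum.cong refl eq)
qed

lemma forms_eq: "forms lam \<Gamma> p q = {form_of lam p q f | f. \<forall>C. f C \<in> invariant_funs lam \<Gamma>}"
proof safe
  fix f :: "('n, 'm) idx set \<Rightarrow> ('n, 'm) grp \<Rightarrow> complex"
  assume f: "\<forall>C. f C \<in> invariant_funs lam \<Gamma>"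
  have "smooth_form (form_of lam p q f)"
    unfolding smooth_form_def form_of_def comb_def
    using f by (intro allI smooth_sum smooth_mult smooth_const smooth_twist) (auto simp: invariant_funs_def)
  moreover have "form_of lam p q f x \<in> bidegree_space lam p q x" for x
    unfolding bidegree_space_eq form_of_def by simp
  moreover have "pullback (gmult lam \<gamma>) (form_of lam p q f) = form_of lam p q f" if "\<gamma> \<in> \<Gamma>" for \<gamma>
  proof -
    have "(\<lambda>C x. f C (gmult lam \<gamma> x)) = f"
      using f that unfolding invariant_funs_def by blast
    then show ?thesis unfolding pullback_form_of[OF that] by simp
  qed
  ultimately show "form_of lam p q f \<in> forms lam \<Gamma> p q" unfolding forms_def by blast
next
  fix \<omega> assume \<omega>: "\<omega> \<in> forms lam \<Gamma> p q"
  let ?T = "bidegree_sets p q :: ('n, 'm) idx set set"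
  \<comment> \<open>The coefficients are divided by the twist. For sets of another bidegree they are
    0, so every \<open>f C\<close> is invariant.\<close>
  define f where "f C x = cov_coeff C (\<omega> x) * inverse (twist lam C x)" for C :: "('n, 'm) idx set" and x :: "('n, 'm) grp"
  have eq: "\<omega> = form_of lam p q f"
  proof
    fix x
    obtain a where a: "\<omega> x = comb ?T a"
      using \<omega> bidegree_space_eq unfolding forms_def by blast
    have "f C x * twist lam C x = a C" if "C \<in> ?T" for C
      using that by (simp add: f_def a coeff_comb twist_nonzero)
    then show "\<omega> x = form_of lam p q f x"
      unfolding a form_of_def by (simp add: fun_eq_iff comb_def)
  qed
  have "f C \<in> invariant_funs lam \<Gamma>" for C
  proof -
    have "smooth (\<lambda>x. cov_coeff C (\<omega> x))"
      using \<omega> unfolding cov_coeff_def forms_def smooth_form_def by (intro smooth_coeff_list) simp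
    then have "smooth (f C)"
      unfolding f_def[abs_def] by (intro smooth_mult smooth_inverse smooth_twist twist_nonzero)
    moreover have "f C (gmult lam \<gamma> x) = f C x" if \<gamma>: "\<gamma> \<in> \<Gamma>" for \<gamma> x
    proof (cases "C \<in> ?T")
      case True
      have "form_of lam p q (\<lambda>C x. f C (gmult lam \<gamma> x)) = form_of lam p q f"
        using \<omega> \<gamma> pullback_form_of[OF \<gamma>, of p q f] unfolding eq[symmetric] forms_def by simp
      then have "cov_coeff C (form_of lam p q (\<lambda>C x. f C (gmult lam \<gamma> x)) x) = cov_coeff C (form_of lam p q f x)"
        by simp
      then show ?thesis using True by (simp add: form_of_def coeff_comb twist_nonzero)
    next
      case False
      have "cov_coeff C (\<omega> y) = 0" for y
        unfolding eq form_of_def coeff_comb using False by simp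
      then show ?thesis by (simp add: f_def)
    qed
    ultimately show ?thesis by (simp add: invariant_funs_def)
  qed
  then show "\<exists>f. \<omega> = form_of lam p q f \<and> (\<forall>C. f C \<in> invariant_funs lam \<Gamma>)" using eq by blast
qed

end

section \<open>The space B in the twisted frame\<close>

lemma form_of_cong:
  "(\<And>C. C \<in> bidegree_sets p q \<Longrightarrow> f C = g C) \<Longrightarrow> form_of lam p q f = form_of lam p q g"
  by (simp add: fun_eq_iff form_of_def comb_def)

lemma form_of_inject:
  assumes "form_of lam p q f = form_of lam p q g" "C \<in> bidegree_sets p q"
  shows "f C = g C"
proof
  fix x
  have "cov_coeff C (form_of lam p q f x) = cov_coeff C (form_of lam p q g x)" unfolding assms(1) ..
  then show "f C x = g C x" using assms(2) by (simp add: form_of_def coeff_comb twist_nonzero)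
qed

lemma form_of_add: "form_of lam p q f + form_of lam p q g = form_of lam p q (\<lambda>C x. f C x + g C x)"
  by (simp add: fun_eq_iff form_of_def comb_def distrib_right sum.distrib)

lemma form_of_scale: "form_scale c (form_of lam p q f) = form_of lam p q (\<lambda>C x. c * f C x)"
  by (simp add: fun_eq_iff form_of_def comb_def form_scale_def sum_distrib_left mult.assoc)

lemma form_of_zero: "form_of lam p q (\<lambda>C x. 0) = 0"
  by (simp add: fun_eq_iff form_of_def comb_def)

text \<open>\<beta>_j exchanges the conjugated summands in the exponent of \<psi>^j for unconjugated
  ones, and \<gamma>_l does the same for the conjugate of \<psi>^l; what remains is a multiple of
  the holomorphic \<open>w_sum\<close>.\<close>

lemma B_generator:
  assumes "distinct (idx_list I J K L)"
  shows "(\<Prod>j\<in>set J. beta_fun lam j x) * (\<Prod>l\<in>set L. gamma_fun lam l x) * prod_list (map (psi_factor lam x) (idx_list I J K L)) =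
    twist lam (set (idx_list I J K L)) x"
proof -
  have d: "distinct J" "distinct L" using assms by (simp_all add: distinct_idx_list)
  have w: "w_sum x = (\<Sum>i | odd_index i. fst x $ i) + (\<Sum>i | \<not> odd_index i. fst x $ i)"
    "a_fun (fst x) = (\<Sum>i | odd_index i. fst x $ i) + (\<Sum>i | \<not> odd_index i. cnj (fst x $ i))"
  proof -
    have U: "(UNIV :: ('a \<times> bool) set) = {i. odd_index i} \<union> {i. \<not> odd_index i}" by auto
    show "w_sum x = (\<Sum>i | odd_index i. fst x $ i) + (\<Sum>i | \<not> odd_index i. fst x $ i)"
      unfolding w_sum_def by (subst U, subst sum.union_disjoint) auto
    show "a_fun (fst x) = (\<Sum>i | odd_index i. fst x $ i) + (\<Sum>i | \<not> odd_index i. cnj (fst x $ i))"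
      unfolding a_fun_def by (subst U, subst sum.union_disjoint) auto
  qed
  have b: "beta_fun lam j x * psi_factor lam x (True, Inr j) = exp (of_real (lam * idx_sign (True, Inr j :: ('a, 'b) coord)) * w_sum x)" for j
    by (simp add: beta_fun_def psi_factor_def idx_sign_def Let_def w_diff_def w sum_subtractf algebra_simps flip: exp_add)
  have g: "gamma_fun lam l x * psi_factor lam x (False, Inr l) = exp (of_real (lam * idx_sign (False, Inr l :: ('a, 'b) coord)) * w_sum x)" for l
    by (simp add: gamma_fun_def psi_factor_def idx_sign_def Let_def w_diff_def w sum_subtractf algebra_simps exp_cnj flip: exp_add)
  have one: "prod_list (map (\<lambda>i. psi_factor lam x (h, Inl i)) I) = 1" for h I
    by (induction I) (simp_all add: psi_factor_def)
  have "(\<Prod>j\<in>set J. beta_fun lam j x) * (\<Prod>l\<in>set L. gamma_fun lam l x) * prod_list (map (psi_factor lam x) (idx_list I J K L)) =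
      ((\<Prod>j\<in>set J. beta_fun lam j x) * (\<Prod>j\<in>set J. psi_factor lam x (True, Inr j))) *
      ((\<Prod>l\<in>set L. gamma_fun lam l x) * (\<Prod>l\<in>set L. psi_factor lam x (False, Inr l)))"
    unfolding idx_list_def
    by (simp add: one prod.distinct_set_conv_list[OF d(1)] prod.distinct_set_conv_list[OF d(2)] comp_def)
  also have "\<dots> = (\<Prod>j\<in>set J. exp (of_real (lam * idx_sign (True, Inr j :: ('a, 'b) coord)) * w_sum x)) *
      (\<Prod>l\<in>set L. exp (of_real (lam * idx_sign (False, Inr l :: ('a, 'b) coord)) * w_sum x))"
    unfolding prod.distrib[symmetric] b g ..
  also have "\<dots> = exp ((\<Sum>j\<in>set J. of_real (lam * idx_sign (True, Inr j :: ('a, 'b) coord)) * w_sum x) +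
      (\<Sum>l\<in>set L. of_real (lam * idx_sign (False, Inr l :: ('a, 'b) coord)) * w_sum x))"
    by (simp add: exp_add exp_sum)
  also have "\<dots> = twist lam (set (idx_list I J K L)) x"
  proof -
    have "(\<Sum>s\<in>set (idx_list I J K L). idx_sign s) =
        (\<Sum>j\<in>set J. idx_sign (True, Inr j :: ('a, 'b) coord)) + (\<Sum>l\<in>set L. idx_sign (False, Inr l :: ('a, 'b) coord))"
      unfolding sum.distinct_set_conv_list[OF assms] sum.distinct_set_conv_list[OF d(1)] sum.distinct_set_conv_list[OF d(2)]
      by (simp add: idx_list_def comp_def idx_sign_def sum_list_triv)
    then show ?thesis
      by (simp add: twist_def sum_distrib_left sum_distrib_right distrib_left distrib_right)
  qed
  finally show ?thesis .
qed

lemma B_space_eq: "B_space lam p q = {form_of lam p q (\<lambda>C x. c C) | c. True}"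
proof -
  let ?G = "{\<lambda>x vs. (\<Prod>j\<in>set J. beta_fun lam j x) * (\<Prod>l\<in>set L. gamma_fun lam l x) *
     coframe_form lam I J K L x vs | I J K L. (I, J, K, L) \<in> multi_indices p q}"
  let ?R = "{form_of lam p q (\<lambda>C x. c C) | c. True} :: ('a, 'b) grp form set"
  have gen: "(\<lambda>(x :: ('a, 'b) grp) vs. (\<Prod>j\<in>set J. beta_fun lam j x) * (\<Prod>l\<in>set L. gamma_fun lam l x) * coframe_form lam I J K L x vs) =
      (\<lambda>x vs. k * (twist lam C x * basis_cov C vs))"
    if "distinct (idx_list I J K L)" "C = set (idx_list I J K L)"
      "\<And>vs. wedge (map cov (idx_list I J K L)) vs = k * basis_cov C vs"
    for I K :: "('a \<times> bool) list" and J L :: "('b \<times> bool) list" and C k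
  proof (intro ext)
    fix x :: "('a, 'b) grp" and vs
    let ?b = "(\<Prod>j\<in>set J. beta_fun lam j x) * (\<Prod>l\<in>set L. gamma_fun lam l x)"
    have "?b * (P * (k * b)) = k * (?b * P * b)" for P b by (simp only: mult_ac)
    from this[of "prod_list (map (psi_factor lam x) (idx_list I J K L))" "basis_cov C vs"]
    show "?b * coframe_form lam I J K L x vs = k * (twist lam C x * basis_cov C vs)"
      unfolding coframe_form_eq that(3) B_generator[OF that(1)] that(2)[symmetric] .
  qed
  show ?thesis
  proof
    show "B_space lam p q \<subseteq> ?R"
      unfolding B_space_def
    proof (rule form.span_minimal)
      show "form.subspace ?R"
        unfolding form.subspace_def
      proof (intro conjI ballI allI)
        show "0 \<in> ?R"
          by (rule CollectI, rule exI[of _ "\<lambda>C. 0"], rule conjI[OF form_of_zero[symmetric] TrueI])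
        show "x + y \<in> ?R" if xy: "x \<in> ?R" "y \<in> ?R" for x y
        proof -
          obtain c d where "x = form_of lam p q (\<lambda>C x. c C)" "y = form_of lam p q (\<lambda>C x. d C)"
            using xy by blast
          then have "x + y = form_of lam p q (\<lambda>C x. c C + d C)" by (simp only: form_of_add)
          then show ?thesis by (intro CollectI exI[of _ "\<lambda>C. c C + d C"] conjI TrueI)
        qed
        show "form_scale k x \<in> ?R" if x: "x \<in> ?R" for k x
        proof -
          obtain c where "x = form_of lam p q (\<lambda>C x. c C)" using x by blast
          then have "form_scale k x = form_of lam p q (\<lambda>C x. k * c C)" by (simp only: form_of_scale)
          then show ?thesis by (intro CollectI exI[of _ "\<lambda>C. k * c C"] conjI TrueI)
        qed
      qed
      show "?G \<subseteq> ?R"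
      proof safe
        fix I J K L assume m: "(I, J, K, L) \<in> (multi_indices p q :: (('a \<times> bool) list \<times> ('b \<times> bool) list \<times> _) set)"
        define C where "C = set (idx_list I J K L)"
        obtain k where k: "\<And>vs. wedge (map cov (idx_list I J K L)) vs = k * basis_cov C vs"
          using wedge_idx_list[OF m] unfolding C_def by metis
        have d: "distinct (idx_list I J K L)" and C: "C \<in> bidegree_sets p q"
          using m by (auto simp: multi_indices_bidegree C_def)
        have eq: "(\<lambda>x vs. k * (twist lam C x * basis_cov C vs)) = form_of lam p q (\<lambda>D x. if D = C then k else 0)"
        proof (intro ext)
          fix x vs
          have "form_of lam p q (\<lambda>D x. if D = C then k else 0) x vs =
              (\<Sum>D\<in>bidegree_sets p q. if D = C then k * twist lam C x * basis_cov C vs else 0)"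
            unfolding form_of_def comb_def by (rule sum.cong) auto
          also have "\<dots> = k * twist lam C x * basis_cov C vs"
            using C by (subst sum.delta) auto
          finally show "k * (twist lam C x * basis_cov C vs) = form_of lam p q (\<lambda>D x. if D = C then k else 0) x vs"
            by (simp only: mult.assoc)
        qed
        show "\<exists>c. (\<lambda>x vs. (\<Prod>j\<in>set J. beta_fun lam j x) * (\<Prod>l\<in>set L. gamma_fun lam l x) * coframe_form lam I J K L x vs) =
            form_of lam p q (\<lambda>C x. c C) \<and> True"
          by (rule exI[of _ "\<lambda>D. if D = C then k else 0"], rule conjI[OF _ TrueI],
              rule trans[OF gen[OF d C_def k] eq])
      qed
    qed
    show "?R \<subseteq> B_space lam p q"
    proof safe
      fix c :: "('a, 'b) idx set \<Rightarrow> complex"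
      have "(\<lambda>x vs. twist lam C x * basis_cov C vs) \<in> B_space lam p q" if C: "C \<in> bidegree_sets p q" for C :: "('a, 'b) idx set"
      proof -
        obtain I J K L where m: "(I, J, K, L) \<in> multi_indices p q" and CC: "C = set (idx_list I J K L)"
          using ex_multi_indices[OF C] by metis
        obtain k where k: "k \<noteq> 0" "\<And>vs. wedge (map cov (idx_list I J K L)) vs = k * basis_cov C vs"
          using wedge_idx_list[OF m] unfolding CC by metis
        have d: "distinct (idx_list I J K L)" using m by (auto simp: multi_indices_bidegree)
        have "(\<lambda>x vs. k * (twist lam C x * basis_cov C vs)) \<in> B_space lam p q"
          unfolding gen[OF d CC k(2), symmetric] B_space_def using m by (blast intro: form.span_base)
        then have "form_scale (1 / k) (\<lambda>x vs. k * (twist lam C x * basis_cov C vs)) \<in> B_space lam p q"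
          unfolding B_space_def by (rule form.span_scale)
        then show ?thesis using k(1) by (simp add: form_scale_def)
      qed
      then have "(\<Sum>C\<in>bidegree_sets p q. form_scale (c C) (\<lambda>x vs. twist lam C x * basis_cov C vs)) \<in> B_space lam p q"
        unfolding B_space_def by (intro form.span_sum form.span_scale) auto
      moreover have "form_of lam p q (\<lambda>C x. c C) = (\<Sum>C\<in>bidegree_sets p q. form_scale (c C) (\<lambda>x vs. twist lam C x * basis_cov C vs))"
        by (simp add: fun_eq_iff form_of_def comb_def form_scale_def sum_fun_apply mult.assoc)
      ultimately show "form_of lam p q (\<lambda>C x. c C) \<in> B_space lam p q" by simp
    qed
  qed
qed

section \<open>The lattice\<close>

definition real_matrix :: "int ^ 'a ^ 'b \<Rightarrow> real ^ 'a ^ 'b"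
  where "real_matrix M = (\<chi> i j. of_int (M $ i $ j))"

lemma matrix_inverse:
  fixes A :: "real ^ 'a::finite ^ 'a"
  assumes "invertible A"
  shows "A ** matrix_inv A = mat 1" "matrix_inv A ** A = mat 1"
  using someI_ex[OF assms[unfolded invertible_def]] unfolding matrix_inv_def by blast+

lemma det_real_matrix: "det (real_matrix M) = of_int (det M)"
  by (simp add: Determinants.det_def real_matrix_def)

lemma real_matrix_mult: "real_matrix (A ** B) = real_matrix A ** real_matrix B"
  by (simp add: real_matrix_def matrix_matrix_mult_def Finite_Cartesian_Product.vec_eq_iff)

text \<open>By Cramer's rule the entries of the inverse are determinants of integer matrices.\<close>

lemma integer_inverse:
  fixes M :: "int ^ 'a::finite ^ 'a"
  assumes "det M = 1"
  obtains Q where "real_matrix M ** real_matrix Q = mat 1"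
proof -
  let ?A = "real_matrix M"
  have dA: "det ?A = 1" using assms by (simp add: det_real_matrix)
  then have inv: "invertible ?A" by (simp add: invertible_det_nz)
  define B where "B = matrix_inv ?A"
  have AB: "?A ** B = mat 1" unfolding B_def by (rule matrix_inverse(1)[OF inv])
  define Q where "Q = (\<chi> k c. det (\<chi> i j. if j = k then (if i = c then 1 else 0) else M $ i $ j))"
  have "B $ k $ c = of_int (Q $ k $ c)" for k c
  proof -
    define x where "x = column c B"
    have "(?A *v x) $ i = (if i = c then 1 else 0)" for i
    proof -
      have "(?A *v x) $ i = (?A ** B) $ i $ c"
        by (simp add: x_def column_def matrix_vector_mult_def matrix_matrix_mult_def)
      then show ?thesis unfolding AB by (simp add: Finite_Cartesian_Product.mat_def)
    qed
    then have "(\<chi> i j. if j = k then (?A *v x) $ i else ?A $ i $ j) =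
        real_matrix (\<chi> i j. if j = k then (if i = c then 1 else 0) else M $ i $ j)"
      by (simp add: Finite_Cartesian_Product.vec_eq_iff real_matrix_def)
    moreover have "det (\<chi> i j. if j = k then (?A *v x) $ i else ?A $ i $ j) = x $ k * det ?A"
      by (rule cramer_lemma)
    ultimately have "x $ k = of_int (det (\<chi> i j. if j = k then (if i = c then 1 else 0) else M $ i $ j))"
      unfolding dA by (simp add: det_real_matrix)
    then show ?thesis by (simp add: x_def column_def Q_def)
  qed
  then have "real_matrix Q = B" by (simp add: real_matrix_def Finite_Cartesian_Product.vec_eq_iff)
  then show ?thesis using AB that by blast
qed

lemma diagonal_matrix_mult: "(diagonal d ** A) $ i $ j = d i * A $ i $ j"
  by (simp add: diagonal_def matrix_matrix_mult_def if_distrib[of "\<lambda>z. z * _"] cong: if_cong)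

locale solv_lattice =
  fixes M :: "int ^ ('m::finite \<times> bool) ^ ('m \<times> bool)"
    and P :: "real ^ ('m \<times> bool) ^ ('m \<times> bool)"
    and lam :: real
    and k :: "'n::finite \<times> bool \<Rightarrow> int"
    and mu :: "'n \<times> bool \<Rightarrow> real"
    and \<Gamma> :: "('n, 'm) grp set"
  assumes det_M: "det M = 1"
    and inv_P: "invertible P"
    and lam_nonzero: "lam \<noteq> 0"
    and conj: "P ** (\<chi> i j. of_int (M $ i $ j)) ** matrix_inv P =
         diagonal (\<lambda>j. if odd_index j then exp lam else exp (- lam))"
    and k_nonzero: "\<And>i. k i \<noteq> 0"
    and mu: "\<And>i. mu i = 2 * of_int (k i) * pi / lam"
    and \<Gamma>_def: "\<Gamma> = Gamma_lattice mu P"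
begin

lemma mu_nonzero: "mu i \<noteq> 0"
  using mu[of i] k_nonzero[of i] lam_nonzero by simp

definition stretch :: "int \<Rightarrow> 'm \<times> bool \<Rightarrow> real"
  where "stretch N i = exp ((if odd_index i then lam else - lam) * of_int N)"

text \<open>The action of the N-th power of M on the fibre, in the coordinates z that diagonalise
  it.\<close>

definition monodromy :: "int \<Rightarrow> ('n, 'm) grp \<Rightarrow> ('n, 'm) grp"
  where "monodromy N x = (fst x, \<chi> i. of_real (stretch N i) * snd x $ i)"

lemma stretch_add: "stretch (N + N') i = stretch N i * stretch N' i"
  by (simp add: stretch_def distrib_left exp_add)

lemma stretch_0 [simp]: "stretch 0 i = 1"
  by (simp add: stretch_def)

lemma monodromy_lin: "monodromy N (monodromy N' x) = monodromy (N + N') x"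
  by (simp add: monodromy_def stretch_add Finite_Cartesian_Product.vec_eq_iff)

lemma monodromy_0 [simp]: "monodromy 0 x = x"
  by (simp add: monodromy_def prod_eq_iff Finite_Cartesian_Product.vec_eq_iff)

lemma bounded_linear_monodromy: "bounded_linear (monodromy N)"
proof -
  have "linear (monodromy N)"
    by (rule linearI) (simp_all add: monodromy_def prod_eq_iff Finite_Cartesian_Product.vec_eq_iff distrib_left)
  then show ?thesis by (simp add: linear_conv_bounded_linear)
qed

lemma coord_fun_monodromy: "coord_fun c (monodromy N x) = of_real (case c of Inl i \<Rightarrow> 1 | Inr j \<Rightarrow> stretch N j) * coord_fun c x"
  by (cases c) (simp_all add: coord_fun_def monodromy_def)

lemma diag_P: "diagonal (stretch 1) ** P = P ** real_matrix M"
proof -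
  have "diagonal (stretch 1) = P ** real_matrix M ** matrix_inv P"
    unfolding real_matrix_def conj by (simp add: diagonal_def stretch_def Finite_Cartesian_Product.vec_eq_iff)
  then have "diagonal (stretch 1) ** P = P ** real_matrix M ** (matrix_inv P ** P)"
    by (simp only: matrix_mul_assoc)
  then show ?thesis by (simp add: matrix_inverse(2)[OF inv_P])
qed

lemma diag_P': "\<exists>Q. diagonal (stretch (- 1)) ** P = P ** real_matrix Q"
proof -
  obtain Q where Q: "real_matrix M ** real_matrix Q = mat 1" using integer_inverse[OF det_M] .
  have "diagonal (stretch (- 1)) ** (diagonal (stretch 1) ** P) = P"
    using stretch_add[of "- 1" 1]
    by (simp add: Finite_Cartesian_Product.vec_eq_iff diagonal_matrix_mult mult.assoc[symmetric])
  then have "diagonal (stretch (- 1)) ** P ** real_matrix M = P"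
    unfolding diag_P by (simp only: matrix_mul_assoc)
  then have "diagonal (stretch (- 1)) ** P ** (real_matrix M ** real_matrix Q) = P ** real_matrix Q"
    by (simp only: matrix_mul_assoc)
  then show ?thesis unfolding Q by (auto simp: matrix_mul_rid)
qed

text \<open>In the basis P the stretching is a power of M, and all powers, also negative ones, are
  integer matrices because det M = 1. Hence \<open>monodromy N\<close> maps the fibre lattice into
  itself.\<close>

lemma int_conjugate: "\<exists>Q. diagonal (stretch N) ** P = P ** real_matrix Q"
proof (induction N rule: int_induct[where k = 0])
  case base
  have "diagonal (stretch 0) ** P = P ** mat 1"
    by (simp add: Finite_Cartesian_Product.vec_eq_iff diagonal_matrix_mult)
  moreover have "real_matrix (mat 1) = (mat 1 :: real ^ ('m \<times> bool) ^ ('m \<times> bool))"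
    by (simp add: real_matrix_def Finite_Cartesian_Product.mat_def Finite_Cartesian_Product.vec_eq_iff)
  ultimately show ?case by metis
next
  case (step1 N)
  then obtain Q where Q: "diagonal (stretch N) ** P = P ** real_matrix Q" by blast
  have "diagonal (stretch (N + 1)) ** P = diagonal (stretch N) ** (diagonal (stretch 1) ** P)"
    by (simp add: Finite_Cartesian_Product.vec_eq_iff diagonal_matrix_mult stretch_add mult.assoc)
  also have "\<dots> = P ** real_matrix (Q ** M)"
    unfolding diag_P real_matrix_mult matrix_mul_assoc Q ..
  finally show ?case by blast
next
  case (step2 N)
  then obtain Q where Q: "diagonal (stretch N) ** P = P ** real_matrix Q" by blast
  obtain M' where M': "diagonal (stretch (- 1)) ** P = P ** real_matrix M'" using diag_P' by blast
  have "diagonal (stretch (N - 1)) ** P = diagonal (stretch N) ** (diagonal (stretch (- 1)) ** P)"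
    using stretch_add[of N "- 1"]
    by (simp add: Finite_Cartesian_Product.vec_eq_iff diagonal_matrix_mult mult.assoc)
  also have "\<dots> = P ** real_matrix (Q ** M')"
    unfolding M' real_matrix_mult matrix_mul_assoc Q ..
  finally show ?case by blast
qed

section \<open>Lattice directions in fibre and base\<close>

definition pvec :: "'m \<times> bool \<Rightarrow> complex ^ ('m \<times> bool)"
  where "pvec j = (\<chi> i. of_real (P $ i $ j))"

text \<open>Because P is real, the second direction is \<i> times the first, so the fibre torus
  splits into elliptic curves with periods 1 and \<i>. The parameter N moves the basis by the
  monodromy, which yields lattice vectors again.\<close>

definition fdir :: "int \<Rightarrow> 'm \<times> bool \<Rightarrow> ('n, 'm) grp \<times> ('n, 'm) grp"
  where "fdir N j = (monodromy N (0, pvec j), monodromy N (0, \<chi> i. \<i> * pvec j $ i))"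

definition bdir :: "'n \<times> bool \<Rightarrow> ('n, 'm) grp \<times> ('n, 'm) grp"
  where "bdir i = (coord_vec (Inl i) 1, coord_vec (Inl i) (\<i> * of_real (mu i)))"

lemma fdir_monodromy: "(\<lambda>j. (monodromy N (fst (fdir N' j)), monodromy N (snd (fdir N' j)))) = fdir (N + N')"
  by (simp add: fun_eq_iff fdir_def monodromy_lin)

lemma bdir_monodromy: "(\<lambda>j. (monodromy N (fst (bdir j)), monodromy N (snd (bdir j)))) = bdir"
  by (simp add: fun_eq_iff bdir_def monodromy_def coord_vec_def prod_eq_iff Finite_Cartesian_Product.vec_eq_iff)

definition fibre :: "('n, 'm) grp set"
  where "fibre = {x. fst x = 0}"

definition base :: "('n, 'm) grp set"
  where "base = {x. snd x = 0}"

lemma subspace_fibre: "subspace fibre" and subspace_base: "subspace base"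
  by (auto simp: subspace_def fibre_def base_def)

lemma fdir_fibre: "fst (fdir N j) \<in> fibre" "snd (fdir N j) \<in> fibre"
  by (simp_all add: fdir_def fibre_def monodromy_def)

lemma bdir_base: "fst (bdir i) \<in> base" "snd (bdir i) \<in> base"
  by (simp_all add: bdir_def base_def coord_vec_def)

lemma P_zero: "P *v (\<chi> l. 0) = 0"
  by (simp add: Finite_Cartesian_Product.vec_eq_iff matrix_vector_mult_def)

lemma Gamma_fibreI: "v \<in> Gamma_fibre P \<Longrightarrow> (0, v) \<in> \<Gamma>"
proof -
  assume "v \<in> Gamma_fibre P"
  moreover have "(0 :: complex ^ ('n \<times> bool)) \<in> Gamma_base mu"
    unfolding Gamma_base_def
    by (rule CollectI, rule exI[of _ 0], rule exI[of _ 0]) (simp add: Finite_Cartesian_Product.vec_eq_iff)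
  ultimately show ?thesis by (simp add: \<Gamma>_def Gamma_lattice_def)
qed

lemma Gamma_baseI: "v \<in> Gamma_base mu \<Longrightarrow> (v, 0) \<in> \<Gamma>"
proof -
  assume "v \<in> Gamma_base mu"
  moreover have "(0 :: complex ^ ('m \<times> bool)) \<in> Gamma_fibre P"
    unfolding Gamma_fibre_def
    by (rule CollectI, rule exI[of _ 0], rule exI[of _ 0])
      (simp add: Finite_Cartesian_Product.vec_eq_iff P_zero)
  ultimately show ?thesis by (simp add: \<Gamma>_def Gamma_lattice_def)
qed

lemma fdir_lattice: "fst (fdir N j) \<in> \<Gamma>" "snd (fdir N j) \<in> \<Gamma>"
proof -
  obtain Q where Q: "diagonal (stretch N) ** P = P ** real_matrix Q" using int_conjugate by blast
  have eq: "stretch N i * P $ i $ j = (P *v (\<chi> l. of_int (column j Q $ l))) $ i" for i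
    using arg_cong[OF Q, of "\<lambda>A. A $ i $ j"]
    unfolding diagonal_matrix_mult
    by (simp add: matrix_matrix_mult_def matrix_vector_mult_def real_matrix_def column_def)
  have z: "P *v (\<chi> l. of_int ((0 :: int ^ ('m \<times> bool)) $ l)) = 0"
    by (simp add: P_zero)
  have "snd (fst (fdir N j)) \<in> Gamma_fibre P"
    unfolding Gamma_fibre_def
    by (rule CollectI, rule exI[of _ "column j Q"], rule exI[of _ 0], rule conjI[OF _ TrueI])
      (simp add: fdir_def monodromy_def pvec_def Finite_Cartesian_Product.vec_eq_iff P_zero eq[symmetric])
  then show "fst (fdir N j) \<in> \<Gamma>" using Gamma_fibreI fdir_fibre(1)[of N j] unfolding fibre_def
    by (metis (mono_tags, lifting) mem_Collect_eq prod.collapse)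
  have "snd (snd (fdir N j)) \<in> Gamma_fibre P"
    unfolding Gamma_fibre_def
    by (rule CollectI, rule exI[of _ 0], rule exI[of _ "column j Q"], rule conjI[OF _ TrueI])
      (simp add: fdir_def monodromy_def pvec_def Finite_Cartesian_Product.vec_eq_iff P_zero eq[symmetric])
  then show "snd (fdir N j) \<in> \<Gamma>" using Gamma_fibreI fdir_fibre(2)[of N j] unfolding fibre_def
    by (metis (mono_tags, lifting) mem_Collect_eq prod.collapse)
qed

lemma bdir_lattice: "fst (bdir i) \<in> \<Gamma>" "snd (bdir i) \<in> \<Gamma>"
proof -
  have "fst (fst (bdir i)) \<in> Gamma_base mu"
    unfolding Gamma_base_def
    by (rule CollectI, rule exI[of _ "axis i 1"], rule exI[of _ 0], rule conjI[OF _ TrueI])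
      (simp add: bdir_def coord_vec_def axis_def Finite_Cartesian_Product.vec_eq_iff)
  then show "fst (bdir i) \<in> \<Gamma>" using Gamma_baseI bdir_base(1)[of i] unfolding base_def
    by (metis (mono_tags, lifting) mem_Collect_eq prod.collapse)
  have "fst (snd (bdir i)) \<in> Gamma_base mu"
    unfolding Gamma_base_def
    by (rule CollectI, rule exI[of _ 0], rule exI[of _ "axis i 1"], rule conjI[OF _ TrueI])
      (simp add: bdir_def coord_vec_def axis_def Finite_Cartesian_Product.vec_eq_iff)
  then show "snd (bdir i) \<in> \<Gamma>" using Gamma_baseI bdir_base(2)[of i] unfolding base_def
    by (metis (mono_tags, lifting) mem_Collect_eq prod.collapse)
qed

lemma exp_period: "exp (of_real r + \<i> * of_real (2 * pi * of_int n)) = exp (complex_of_real r)"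
proof -
  have "exp (\<i> * of_real (2 * pi * of_int n)) = 1"
    using fexp_int(2)[of "- n"] by (simp add: fexp_def mult_ac)
  then show ?thesis by (simp add: exp_add)
qed

text \<open>The integer \<open>N\<close> is the power of \<open>M\<close> by which a lattice element acts on the fibre.\<close>

lemma lattice_action:
  assumes "\<gamma> \<in> \<Gamma>"
  obtains N :: int where "Re (a_fun (fst \<gamma>)) = of_int N"
    "exp (of_real lam * a_fun (fst \<gamma>)) = exp (of_real (lam * of_int N))"
    "exp (of_real lam * w_sum \<gamma>) = exp (of_real (lam * of_int N))"
    "\<And>x. gmult lam \<gamma> x = \<gamma> + monodromy N x"
proof -
  obtain a b where ab: "fst \<gamma> = (\<chi> i. of_int (a $ i) + \<i> * of_real (mu i) * of_int (b $ i))"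
    using assms by (auto simp: \<Gamma>_def Gamma_lattice_def Gamma_base_def)
  define N where "N = (\<Sum>i\<in>UNIV. a $ i)"
  \<comment> \<open>As \<open>mu\<close> is a multiple of 2 pi / lam, the imaginary parts of lam a
    and lam s at \<gamma> are 2 pi \<open>n1\<close> and 2 pi \<open>n2\<close>. Conjugation in a
    flips the sign for even indices, which is invisible after exponentiation; the real parts
    agree.\<close>
  define n1 where "n1 = (\<Sum>i\<in>UNIV. (if odd_index i then 1 else - 1) * k i * b $ i)"
  define n2 where "n2 = (\<Sum>i\<in>UNIV. k i * b $ i)"
  have lm: "complex_of_real lam * of_real (mu i) = of_real (2 * pi * of_int (k i))" for i
    using lam_nonzero unfolding of_real_mult[symmetric] mu by simp
  have a1: "a_fun (fst \<gamma>) = of_int N + \<i> * (\<Sum>i\<in>UNIV. (if odd_index i then 1 else - 1) * of_real (mu i) * of_int (b $ i))"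
    unfolding a_fun_def ab N_def of_int_sum sum_distrib_left sum.distrib[symmetric]
    by (rule sum.cong) (auto simp: mult_ac)
  have a2: "w_sum \<gamma> = of_int N + \<i> * (\<Sum>i\<in>UNIV. of_real (mu i) * of_int (b $ i))"
    unfolding w_sum_def ab N_def of_int_sum sum_distrib_left sum.distrib[symmetric]
    by (rule sum.cong) (auto simp: mult_ac)
  have l1: "complex_of_real lam * (\<Sum>i\<in>UNIV. (if odd_index i then 1 else - 1) * of_real (mu i) * of_int (b $ i)) = of_real (2 * pi * of_int n1)"
    unfolding n1_def of_int_sum of_real_sum sum_distrib_left
  proof (rule sum.cong[OF refl])
    fix i :: "'n \<times> bool"
    have "complex_of_real lam * ((if odd_index i then 1 else - 1) * of_real (mu i) * of_int (b $ i)) =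
        (if odd_index i then 1 else - 1) * (complex_of_real lam * of_real (mu i)) * of_int (b $ i)" by (simp add: mult_ac)
    also have "\<dots> = of_real (2 * pi * of_int ((if odd_index i then 1 else - 1) * k i * b $ i))"
      unfolding lm by simp
    finally show "complex_of_real lam * ((if odd_index i then 1 else - 1) * of_real (mu i) * of_int (b $ i)) =
        of_real (2 * pi * of_int ((if odd_index i then 1 else - 1) * k i * b $ i))" .
  qed
  have l2: "complex_of_real lam * (\<Sum>i\<in>UNIV. of_real (mu i) * of_int (b $ i)) = of_real (2 * pi * of_int n2)"
    unfolding n2_def of_int_sum of_real_sum sum_distrib_left mult.assoc[symmetric] lm by (simp add: mult.assoc)
  have e1: "exp (of_real lam * a_fun (fst \<gamma>)) = exp (of_real (lam * of_int N))"
  proof -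
    have "of_real lam * a_fun (fst \<gamma>) = of_real (lam * of_int N) + \<i> * of_real (2 * pi * of_int n1)"
      unfolding a1 l1[symmetric] by (simp add: algebra_simps)
    then show ?thesis by (simp only: exp_period)
  qed
  have e2: "exp (of_real lam * w_sum \<gamma>) = exp (of_real (lam * of_int N))"
  proof -
    have "of_real lam * w_sum \<gamma> = of_real (lam * of_int N) + \<i> * of_real (2 * pi * of_int n2)"
      unfolding a2 l2[symmetric] by (simp add: algebra_simps)
    then show ?thesis by (simp only: exp_period)
  qed
  have "Re (a_fun (fst \<gamma>)) = of_int N"
  proof -
    have "(\<Sum>i\<in>UNIV. (if odd_index i then 1 else - 1) * of_real (mu i) * of_int (b $ i)) =
        complex_of_real (\<Sum>i\<in>UNIV. (if odd_index i then 1 else - 1) * mu i * of_int (b $ i))"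
      by (auto intro!: sum.cong)
    then show ?thesis unfolding a1 by simp
  qed
  moreover have "gmult lam \<gamma> x = \<gamma> + monodromy N x" for x
  proof -
    have e3: "exp (- of_real lam * cnj (a_fun (fst \<gamma>))) = of_real (exp (- lam * of_int N))"
    proof -
      have "exp (- of_real lam * cnj (a_fun (fst \<gamma>))) = inverse (cnj (exp (of_real lam * a_fun (fst \<gamma>))))"
        by (simp add: exp_cnj exp_minus)
      also have "\<dots> = of_real (exp (- lam * of_int N))"
        unfolding e1 exp_of_real by (simp add: exp_minus)
      finally show ?thesis .
    qed
    have "left_lin lam \<gamma> x = monodromy N x"
      using e1 e3 unfolding exp_of_real
      by (simp add: left_lin_def monodromy_def rho_def diagonal_mult stretch_def Finite_Cartesian_Product.vec_eq_iff)
    then show ?thesis by (simp add: gmult_left_lin)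
  qed
  ultimately show ?thesis using that e1 e2 by blast
qed

abbreviation F :: "(('n, 'm) grp \<Rightarrow> complex) set"
  where "F \<equiv> invariant_funs lam \<Gamma>"

lemma F_smooth: "f \<in> F \<Longrightarrow> smooth f"
  by (simp add: invariant_funs_def)

lemma F_gmult: "f \<in> F \<Longrightarrow> \<gamma> \<in> \<Gamma> \<Longrightarrow> f (gmult lam \<gamma> x) = f x"
  unfolding invariant_funs_def by blast

lemma rho_0: "rho lam 0 *v v = v"
  by (simp add: rho_def diagonal_mult a_fun_def Finite_Cartesian_Product.vec_eq_iff cong: if_cong)

lemma F_fibre_translate:
  assumes "f \<in> F" "\<gamma> \<in> \<Gamma>" "\<gamma> \<in> fibre"
  shows "f (x + \<gamma>) = f x"
proof -
  have "gmult lam \<gamma> x = x + \<gamma>" using assms(3) by (simp add: gmult_def fibre_def rho_0 prod_eq_iff)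
  then show ?thesis using F_gmult[OF assms(1,2)] by metis
qed

lemma F_periods: "f \<in> F \<Longrightarrow> periods (fdir N) f"
  unfolding periods_def using F_fibre_translate fdir_lattice fdir_fibre by blast

end

section \<open>Commutation rules for Wirtinger derivatives\<close>

lemma convop_wirtinger:
  assumes T: "convop U T" and f: "smooth f"
  shows "T (wirtinger s f) = wirtinger s (T f)"
proof -
  note d = smooth_dd[OF f]
  have w: "wirtinger s h = (\<lambda>x. 1 / 2 * (dd (coord_vec (snd s) 1) h x +
    (if fst s then - \<i> else \<i>) * dd (coord_vec (snd s) \<i>) h x))" for h
    by (rule ext) (rule wirtinger_def)
  show ?thesis
    unfolding w convop_cmult[OF T smooth_add[OF d smooth_cmult[OF d]]]
      convop_add[OF T d smooth_cmult[OF d]] convop_cmult[OF T d] convop_dd[OF T f] ..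
qed

lemma convop_wirtinger_op:
  assumes U: "subspace U" and "\<And>z. coord_vec (snd s) z \<in> U"
  shows "convop U (wirtinger s)"
proof -
  have eq: "wirtinger s = (\<lambda>f x. 1 / 2 * (dd (coord_vec (snd s) 1) f x +
    (if fst s then - \<i> else \<i>) * dd (coord_vec (snd s) \<i>) f x))"
    by (intro ext) (rule wirtinger_def)
  show ?thesis
    unfolding eq
    by (rule convop_scale[OF convop_plus[OF convop_dd_op[OF U assms(2)] convop_scale[OF convop_dd_op[OF U assms(2)]]]])
qed

lemma wirtinger_commute: "smooth f \<Longrightarrow> wirtinger s (wirtinger t f) = wirtinger t (wirtinger s f)"
  by (rule convop_wirtinger[OF convop_wirtinger_op[OF subspace_UNIV]]) auto

lemma convop_sum:
  assumes T: "convop U T"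
  shows "(\<And>i. i \<in> I \<Longrightarrow> smooth (f i)) \<Longrightarrow> T (\<lambda>x. \<Sum>i\<in>I. c i * f i x) = (\<lambda>x. \<Sum>i\<in>I. c i * T (f i) x)"
proof (induction I rule: infinite_finite_induct)
  case (insert i I)
  have "T (\<lambda>x. c i * f i x + (\<Sum>i\<in>I. c i * f i x)) = (\<lambda>x. T (\<lambda>x. c i * f i x) x + T (\<lambda>x. \<Sum>i\<in>I. c i * f i x) x)"
    by (rule convop_add[OF T]) (use insert.prems in \<open>auto intro!: smooth_cmult smooth_sum\<close>)
  moreover have "T (\<lambda>x. c i * f i x) = (\<lambda>x. c i * T (f i) x)"
    by (rule convop_cmult[OF T]) (use insert.prems in auto)
  ultimately show ?case using insert by simp
qed (simp_all add: convop_zero[OF T])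

lemma dd_local:
  assumes "open U" "x \<in> U" "smooth g" "\<And>y. y \<in> U \<Longrightarrow> f y = g y"
  shows "dd v f x = dd v g x"
proof -
  have "(f has_derivative (\<lambda>v. dd v g x)) (at x)"
    by (rule has_derivative_transform_within_open[OF smooth_has_derivative[OF assms(3)] assms(1,2)])
      (simp add: assms(4))
  then show ?thesis by (rule dd_eqI)
qed

lemma sum_coord: "(\<Sum>c\<in>UNIV. h c) = (\<Sum>i\<in>UNIV. h (Inl i)) + (\<Sum>j\<in>UNIV. h (Inr j))"
  for h :: "'a::finite + 'b::finite \<Rightarrow> complex"
  using sum.Plus[of UNIV UNIV h] by (simp add: comp_def)

text \<open>The holomorphic differentials drop out because 1 + \<i> * \<i> = 0, and the conjugate
  ones are doubled, which cancels the 1/2.\<close>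

lemma cr_op_complex:
  assumes f: "smooth f" and w: "\<And>c. coord_fun c w = \<i> * coord_fun c v"
  shows "cr_op v w 1 f x = (\<Sum>c\<in>UNIV. cov (False, c) v * wirtinger (False, c) f x)"
proof -
  have "cr_op v w 1 f x = 1 / 2 * (\<Sum>c\<in>UNIV. (cov (True, c) v * wirtinger (True, c) f x + cov (False, c) v * wirtinger (False, c) f x) +
      \<i> * (cov (True, c) w * wirtinger (True, c) f x + cov (False, c) w * wirtinger (False, c) f x))"
    unfolding cr_op_def dd_wirtinger[OF f] sum_idx by (simp add: sum.distrib sum_distrib_left distrib_left)
  also have "\<dots> = (\<Sum>c\<in>UNIV. cov (False, c) v * wirtinger (False, c) f x)"
    unfolding sum_distrib_left
  proof (rule sum.cong[OF refl])
    fix c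
    have "cov (True, c) w = \<i> * cov (True, c) v" "cov (False, c) w = - \<i> * cov (False, c) v"
      by (simp_all add: cov_def w)
    then show "1 / 2 * ((cov (True, c) v * wirtinger (True, c) f x + cov (False, c) v * wirtinger (False, c) f x) +
      \<i> * (cov (True, c) w * wirtinger (True, c) f x + cov (False, c) w * wirtinger (False, c) f x)) =
      cov (False, c) v * wirtinger (False, c) f x"
      by (simp add: field_simps)
  qed
  finally show ?thesis .
qed

lemma w_sum_add: "w_sum (x + y) = w_sum x + w_sum y"
  by (simp add: w_sum_def sum.distrib)

lemma smooth_zop: "smooth f \<Longrightarrow> smooth (zop lam s f)"
  unfolding zop_def[abs_def] by (intro smooth_mult smooth_exp_w_sum smooth_wirtinger)

text \<open>The exponential prefactors are holomorphic in w, so conjugate derivatives pass through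
  them.\<close>

lemma zop_commute:
  assumes f: "smooth f" and st: "\<not> fst s" "\<not> fst t"
  shows "zop lam s (zop lam t f) = zop lam t (zop lam s f)"
proof
  fix x
  have *: "zop lam s (zop lam t f) x = exp (- of_real (lam * idx_sign s) * w_sum x) *
      (exp (- of_real (lam * idx_sign t) * w_sum x) * wirtinger s (wirtinger t f) x)" if "\<not> fst s" for s t
    unfolding zop_def[abs_def]
    unfolding wirtinger_mult[OF smooth_exp_w_sum smooth_wirtinger[OF f]] wirtinger_exp_w_sum[OF that] by simp
  show "zop lam s (zop lam t f) x = zop lam t (zop lam s f) x"
    unfolding *[OF st(1)] *[OF st(2)] wirtinger_commute[OF f, of s t] by (simp only: mult.left_commute)
qed

context solv_lattice
begin

lemma w_sum_fibre: "u \<in> fibre \<Longrightarrow> w_sum (x + u) = w_sum x"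
  by (simp add: w_sum_def fibre_def)

lemma w_sum_monodromy: "w_sum (monodromy N x) = w_sum x"
  by (simp add: w_sum_def monodromy_def)

lemma coord_vec_fibre: "coord_vec (Inr j) z \<in> fibre"
  by (simp add: coord_vec_def fibre_def)

lemma monodromy_coord_vec: "monodromy N (coord_vec c z) = (case c of Inl i \<Rightarrow> 1 | Inr j \<Rightarrow> stretch N j) *\<^sub>R coord_vec c z"
  by (rule coord_fun_inject) (auto simp: coord_fun_monodromy coord_fun_scale coord_coord_vec split: sum.splits)

lemma one_nonzero: "(1 :: real) \<noteq> 0" by simp

section \<open>Averages and Green operators of the fibre and the base\<close>

definition avg_fibre :: "int \<Rightarrow> (('n, 'm) grp \<Rightarrow> complex) \<Rightarrow> ('n, 'm) grp \<Rightarrow> complex"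
  where "avg_fibre N = avgs (fdir N) (enum_set UNIV)"

definition green_fibre :: "int \<Rightarrow> 'm \<times> bool \<Rightarrow> (('n, 'm) grp \<Rightarrow> complex) \<Rightarrow> ('n, 'm) grp \<Rightarrow> complex"
  where "green_fibre N = greens (fdir N) (\<lambda>_. 1) (enum_set UNIV)"

definition avg_base :: "(('n, 'm) grp \<Rightarrow> complex) \<Rightarrow> ('n, 'm) grp \<Rightarrow> complex"
  where "avg_base = avgs bdir (enum_set UNIV)"

definition green_base :: "'n \<times> bool \<Rightarrow> (('n, 'm) grp \<Rightarrow> complex) \<Rightarrow> ('n, 'm) grp \<Rightarrow> complex"
  where "green_base = greens bdir mu (enum_set UNIV)"

lemma convop_avg_fibre: "convop fibre (avg_fibre N)"
  unfolding avg_fibre_def by (rule convop_avgs[OF subspace_fibre fdir_fibre one_nonzero])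

lemma convop_green_fibre: "convop fibre (green_fibre N j)"
  unfolding green_fibre_def by (rule convop_greens[OF subspace_fibre fdir_fibre one_nonzero])

lemma convop_avg_base: "convop base avg_base"
  unfolding avg_base_def by (rule convop_avgs[OF subspace_base bdir_base mu_nonzero])

lemma convop_green_base: "convop base (green_base i)"
  unfolding green_base_def by (rule convop_greens[OF subspace_base bdir_base mu_nonzero])

text \<open>For N = 0 invertibility of P gives the real coordinates; the monodromy transports the
  basis to other N. Functions constant along the lattice basis are thus constant along the whole
  fibre.\<close>

lemma fibre_span:
  assumes v: "v \<in> fibre"
  shows "\<exists>a b. v = (\<Sum>j\<in>UNIV. a j *\<^sub>R fst (fdir N j) + b j *\<^sub>R snd (fdir N j))"
proof -
  have zero: "\<exists>a b. v = (\<Sum>j\<in>UNIV. a j *\<^sub>R fst (fdir 0 j) + b j *\<^sub>R snd (fdir 0 j))"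
    if v: "v \<in> fibre" for v
  proof -
    define a where "a = matrix_inv P *v (\<chi> i. Re (snd v $ i))"
    define b where "b = matrix_inv P *v (\<chi> i. Im (snd v $ i))"
    have Pab: "P *v a = (\<chi> i. Re (snd v $ i))" "P *v b = (\<chi> i. Im (snd v $ i))"
      unfolding a_def b_def by (simp_all add: matrix_vector_mul_assoc matrix_inverse(1)[OF inv_P])
    have ab: "(\<Sum>j\<in>UNIV. P $ i $ j * a $ j) = Re (snd v $ i)" "(\<Sum>j\<in>UNIV. P $ i $ j * b $ j) = Im (snd v $ i)" for i
      using arg_cong[OF Pab(1), of "\<lambda>w. w $ i"] arg_cong[OF Pab(2), of "\<lambda>w. w $ i"]
      by (simp_all add: matrix_vector_mult_def)
    have "v = (\<Sum>j\<in>UNIV. a $ j *\<^sub>R fst (fdir 0 j) + b $ j *\<^sub>R snd (fdir 0 j))"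
    proof (rule coord_fun_inject)
      fix c
      show "coord_fun c v = coord_fun c (\<Sum>j\<in>UNIV. a $ j *\<^sub>R fst (fdir 0 j) + b $ j *\<^sub>R snd (fdir 0 j))"
      proof (cases c)
        case (Inl i)
        then show ?thesis using v
          unfolding coord_fun_sum coord_fun_add coord_fun_scale by (simp add: coord_fun_def fdir_def fibre_def)
      next
        case (Inr i)
        have "coord_fun c (\<Sum>j\<in>UNIV. a $ j *\<^sub>R fst (fdir 0 j) + b $ j *\<^sub>R snd (fdir 0 j)) =
            of_real (\<Sum>j\<in>UNIV. P $ i $ j * a $ j) + \<i> * of_real (\<Sum>j\<in>UNIV. P $ i $ j * b $ j)"
          unfolding coord_fun_sum coord_fun_add coord_fun_scale
          by (simp add: Inr coord_fun_def fdir_def pvec_def sum.distrib sum_distrib_left mult_ac)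
        then show ?thesis unfolding ab using complex_eq[of "snd v $ i"] by (simp add: Inr coord_fun_def)
      qed
    qed
    then show ?thesis by (intro exI[of _ "\<lambda>j. a $ j"] exI[of _ "\<lambda>j. b $ j"])
  qed
  have "monodromy (- N) v \<in> fibre" using v by (simp add: fibre_def monodromy_def)
  then obtain a b where ab: "monodromy (- N) v = (\<Sum>j\<in>UNIV. a j *\<^sub>R fst (fdir 0 j) + b j *\<^sub>R snd (fdir 0 j))"
    using zero by blast
  interpret l: bounded_linear "monodromy N" by (rule bounded_linear_monodromy)
  have "v = monodromy N (monodromy (- N) v)" by (simp add: monodromy_lin)
  also have "\<dots> = (\<Sum>j\<in>UNIV. a j *\<^sub>R fst (fdir N j) + b j *\<^sub>R snd (fdir N j))"
    unfolding ab l.sum l.add l.scaleR by (simp add: fdir_def)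
  finally show ?thesis by (intro exI[of _ a] exI[of _ b])
qed

lemma base_span: "\<exists>a b. v = (\<Sum>i\<in>UNIV. a i *\<^sub>R fst (bdir i) + b i *\<^sub>R snd (bdir i)) + (0, snd v)"
proof -
  have "v = (\<Sum>i\<in>UNIV. Re (fst v $ i) *\<^sub>R fst (bdir i) + (Im (fst v $ i) / mu i) *\<^sub>R snd (bdir i)) + (0, snd v)"
  proof (rule coord_fun_inject)
    fix c
    show "coord_fun c v = coord_fun c ((\<Sum>i\<in>UNIV. Re (fst v $ i) *\<^sub>R fst (bdir i) + (Im (fst v $ i) / mu i) *\<^sub>R snd (bdir i)) + (0, snd v))"
    proof (cases c)
      case (Inr j)
      then show ?thesis unfolding coord_fun_add coord_fun_sum coord_fun_scale bdir_def fst_conv snd_conv coord_coord_vec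
        by (simp add: coord_fun_def)
    next
      case (Inl i)
      have "coord_fun c ((\<Sum>i\<in>UNIV. Re (fst v $ i) *\<^sub>R fst (bdir i) + (Im (fst v $ i) / mu i) *\<^sub>R snd (bdir i)) + (0, snd v)) =
          (\<Sum>j\<in>UNIV. if i = j then of_real (Re (fst v $ i)) + \<i> * of_real (Im (fst v $ i)) else 0)"
        unfolding coord_fun_add coord_fun_sum coord_fun_scale bdir_def fst_conv snd_conv coord_coord_vec Inl
      proof -
        have z: "coord_fun (Inl i) (0, snd v) = 0" by (simp add: coord_fun_def)
        show "(\<Sum>j\<in>UNIV. of_real (Re (fst v $ j)) * (if Inl i = Inl j then 1 else 0) +
            of_real (Im (fst v $ j) / mu j) * (if Inl i = Inl j then \<i> * of_real (mu j) else 0)) + coord_fun (Inl i) (0, snd v) =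
          (\<Sum>j\<in>UNIV. if i = j then of_real (Re (fst v $ i)) + \<i> * of_real (Im (fst v $ i)) else 0)"
          unfolding z add_0_right by (rule sum.cong) (auto simp: mu_nonzero)
      qed
      then show ?thesis using complex_eq[of "fst v $ i"] by (simp add: Inl coord_fun_def)
    qed
  qed
  then show ?thesis
    by (intro exI[of _ "\<lambda>i. Re (fst v $ i)"] exI[of _ "\<lambda>i. Im (fst v $ i) / mu i"])
qed

lemma dd_avg_fibre:
  assumes f: "smooth f" "periods (fdir N) f" and v: "v \<in> fibre"
  shows "dd v (avg_fibre N f) = (\<lambda>x. 0)"
proof
  fix x
  obtain a b where v: "v = (\<Sum>j\<in>UNIV. a j *\<^sub>R fst (fdir N j) + b j *\<^sub>R snd (fdir N j))"
    using fibre_span[OF v] by blast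
  note s = convop_smooth[OF convop_avg_fibre f(1), of N]
  have "dd (fst (fdir N j)) (avg_fibre N f) = (\<lambda>x. 0)" "dd (snd (fdir N j)) (avg_fibre N f) = (\<lambda>x. 0)" for j
    unfolding avg_fibre_def
    by (rule avgs_dd_zero[OF subspace_fibre fdir_fibre one_nonzero _ f, of j]; simp)+
  then show "dd v (avg_fibre N f) x = 0"
    unfolding v dd_sum_dir[OF s] dd_add_dir[OF s] dd_scale_dir[OF s] by simp
qed

lemma avg_fibre_invariant:
  assumes f: "smooth f" "periods (fdir N) f" and v: "v \<in> fibre"
  shows "avg_fibre N f (x + v) = avg_fibre N f x"
  by (rule translation_invariant[OF convop_smooth[OF convop_avg_fibre f(1)] dd_avg_fibre[OF assms]])

lemma wirtinger_fibre_zero: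
  "(\<And>v. v \<in> fibre \<Longrightarrow> dd v f = (\<lambda>x. 0)) \<Longrightarrow> wirtinger (h, Inr j) f = (\<lambda>x. 0)"
  by (rule ext) (simp add: wirtinger_def coord_vec_fibre)

text \<open>This matrix expresses the Cauchy-Riemann operators of the elliptic curves by the
  coordinate ones; \<open>inv_fibre\<close> uses its transpose.\<close>

lemma cr_fdir:
  assumes f: "smooth f"
  shows "cr_op (fst (fdir N j)) (snd (fdir N j)) 1 f =
    (\<lambda>x. \<Sum>i\<in>UNIV. of_real (stretch N i * P $ i $ j) * wirtinger (False, Inr i) f x)"
proof
  fix x
  have "coord_fun c (snd (fdir N j)) = \<i> * coord_fun c (fst (fdir N j))" for c
    by (cases c) (simp_all add: coord_fun_def fdir_def monodromy_def mult_ac)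
  from cr_op_complex[OF f this]
  show "cr_op (fst (fdir N j)) (snd (fdir N j)) 1 f x =
      (\<Sum>i\<in>UNIV. of_real (stretch N i * P $ i $ j) * wirtinger (False, Inr i) f x)"
    unfolding sum_coord by (simp add: cov_def coord_fun_def fdir_def monodromy_def pvec_def)
qed

lemma cr_bdir:
  assumes f: "smooth f"
  shows "cr_op (fst (bdir i)) (snd (bdir i)) (mu i) f = wirtinger (False, Inl i) f"
proof
  fix x
  have "coord_vec (Inl i) (\<i> * of_real (mu i)) = mu i *\<^sub>R (coord_vec (Inl i) \<i> :: ('n, 'm) grp)"
    by (rule coord_fun_inject) (simp add: coord_fun_scale coord_coord_vec mult.commute)
  then show "cr_op (fst (bdir i)) (snd (bdir i)) (mu i) f x = wirtinger (False, Inl i) f x"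
    using mu_nonzero[of i] by (simp add: cr_op_def wirtinger_def bdir_def dd_scale_dir[OF f])
qed

text \<open>Chosen so that the sum over l of \<open>inv_fibre N l\<close> after the derivative in
  conjugate z_l equals the sum over j of \<open>green_fibre N j\<close> after the Cauchy-Riemann
  operator of the j-th elliptic curve.\<close>

definition inv_fibre :: "int \<Rightarrow> 'm \<times> bool \<Rightarrow> (('n, 'm) grp \<Rightarrow> complex) \<Rightarrow> ('n, 'm) grp \<Rightarrow> complex"
  where "inv_fibre N l f x = (\<Sum>j\<in>UNIV. of_real (stretch N l * P $ l $ j) * green_fibre N j f x)"

lemma convop_inv_fibre: "convop fibre (inv_fibre N l)"
  unfolding inv_fibre_def[abs_def] by (intro convop_sum_op convop_scale convop_green_fibre)

lemma inv_fibre_sum: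
  assumes f: "smooth f" "periods (fdir N) f"
  shows "(\<Sum>l\<in>UNIV. inv_fibre N l (wirtinger (False, Inr l) f) x) = f x - avg_fibre N f x"
proof -
  have "(\<Sum>l\<in>UNIV. inv_fibre N l (wirtinger (False, Inr l) f) x) =
      (\<Sum>j\<in>UNIV. \<Sum>l\<in>UNIV. of_real (stretch N l * P $ l $ j) * green_fibre N j (wirtinger (False, Inr l) f) x)"
    unfolding inv_fibre_def by (rule sum.swap)
  also have "\<dots> = (\<Sum>j\<in>UNIV. green_fibre N j (cr_op (fst (fdir N j)) (snd (fdir N j)) 1 f) x)"
    unfolding cr_fdir[OF f(1)]
    by (subst convop_sum[OF convop_green_fibre]) (auto intro: smooth_wirtinger f)
  also have "\<dots> = f x - avg_fibre N f x"
    using greens_cr_op[OF subspace_fibre fdir_fibre one_nonzero distinct_enum_set f, of UNIV x]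
    unfolding green_fibre_def avg_fibre_def by simp
  finally show ?thesis .
qed

lemma convop_periods: "convop U T \<Longrightarrow> smooth f \<Longrightarrow> periods D f \<Longrightarrow> periods D (T f)"
  unfolding periods_def using convop_periodic by blast

text \<open>This replaces the invariance of the Haar measure of the torus under \<open>SL(2m, \<int>)\<close>.\<close>

lemma avg_fibre_independent:
  assumes f: "smooth f" "\<And>N. periods (fdir N) f"
  shows "avg_fibre N' f = avg_fibre N f"
proof -
  have zero: "avg_fibre N' (wirtinger (False, Inr l) (inv_fibre N l f)) = (\<lambda>x. 0)" for l
  proof -
    have h: "smooth (inv_fibre N l f)" "periods (fdir N') (inv_fibre N l f)"
      by (rule convop_smooth[OF convop_inv_fibre f(1)], rule convop_periods[OF convop_inv_fibre f])
    show ?thesis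
      unfolding convop_wirtinger[OF convop_avg_fibre h(1)]
      by (rule wirtinger_fibre_zero) (rule dd_avg_fibre[OF h])
  qed
  have sm: "smooth (wirtinger (False, Inr l) (inv_fibre N l f))" for l
    by (intro smooth_wirtinger convop_smooth[OF convop_inv_fibre f(1)])
  \<comment> \<open>\<open>f\<close> is \<open>avg_fibre N f\<close> plus fibre derivatives of
    periodic functions. The average for \<open>N'\<close> kills the derivatives and fixes the first
    term, which is constant along the fibres.\<close>
  have "f = (\<lambda>x. avg_fibre N f x + (\<Sum>l\<in>UNIV. 1 * wirtinger (False, Inr l) (inv_fibre N l f) x))"
  proof
    fix x
    show "f x = avg_fibre N f x + (\<Sum>l\<in>UNIV. 1 * wirtinger (False, Inr l) (inv_fibre N l f) x)"
      using inv_fibre_sum[OF f, of N x] by (simp add: convop_wirtinger[OF convop_inv_fibre f(1)])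
  qed
  then have "avg_fibre N' f = avg_fibre N' (\<lambda>x. avg_fibre N f x + (\<Sum>l\<in>UNIV. 1 * wirtinger (False, Inr l) (inv_fibre N l f) x))"
    by (rule arg_cong)
  also have "\<dots> = (\<lambda>x. avg_fibre N' (avg_fibre N f) x + avg_fibre N' (\<lambda>x. \<Sum>l\<in>UNIV. 1 * wirtinger (False, Inr l) (inv_fibre N l f) x) x)"
    by (rule convop_add[OF convop_avg_fibre convop_smooth[OF convop_avg_fibre f(1)] smooth_sum]) (rule smooth_cmult[OF sm])
  also have "avg_fibre N' (\<lambda>x. \<Sum>l\<in>UNIV. 1 * wirtinger (False, Inr l) (inv_fibre N l f) x) = (\<lambda>x. 0)"
    by (subst convop_sum[OF convop_avg_fibre]) (simp_all only: sm zero mult_zero_right sum.neutral_const)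
  also have "avg_fibre N' (avg_fibre N f) = avg_fibre N f"
    unfolding avg_fibre_def[of N']
    by (rule avgs_invariant[OF subspace_fibre fdir_fibre one_nonzero convop_smooth[OF convop_avg_fibre f(1)]
          avg_fibre_invariant[OF f]])
  finally show ?thesis by simp
qed

section \<open>Gluing the fibre operators over the base\<close>

definition t_fun :: "('n, 'm) grp \<Rightarrow> real"
  where "t_fun x = (\<Sum>i\<in>UNIV. Re (fst x $ i))"

lemma t_fun_a_fun: "t_fun x = Re (a_fun (fst x))"
  unfolding t_fun_def a_fun_def Re_sum by (rule sum.cong) auto

lemma bounded_linear_t_fun: "bounded_linear t_fun"
proof -
  have "bounded_linear (\<lambda>x :: ('n, 'm) grp. \<Sum>i\<in>UNIV. Re (coord_fun (Inl i) x))"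
    by (intro bounded_linear_sum bounded_linear_compose[OF bounded_linear_Re bounded_linear_coord_fun])
  then show ?thesis by (simp add: t_fun_def[abs_def] coord_fun_def)
qed

lemma t_fun_fibre: "u \<in> fibre \<Longrightarrow> t_fun (x + u) = t_fun x"
  by (simp add: t_fun_def fibre_def)

text \<open>The twist cancels the exponential in \<open>zop\<close> for the index l, so that the
  glued operators invert \<open>zop\<close> and not the bare derivative.\<close>

definition weight :: "int \<Rightarrow> 'm \<times> bool \<Rightarrow> ('n, 'm) grp \<Rightarrow> complex"
  where "weight N l x = part_unity N (t_fun x) * twist lam {(False, Inr l)} x"

lemma smooth_weight: "smooth (weight N l)"
  unfolding weight_def[abs_def] by (intro smooth_mult smooth_part_unity bounded_linear_t_fun smooth_twist)

lemma weight_fibre: "u \<in> fibre \<Longrightarrow> weight N l (x + u) = weight N l x"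
  by (simp add: weight_def t_fun_fibre twist_def w_sum_fibre)

text \<open>The operators on a single fibre are not compatible with the monodromy \<open>M\<close>; the partition of unity
  averages their conjugates by the powers of \<open>M\<close>.\<close>

definition glue :: "'m \<times> bool \<Rightarrow> (('n, 'm) grp \<Rightarrow> complex) \<Rightarrow> ('n, 'm) grp \<Rightarrow> complex"
  where "glue l f x = (\<Sum>N\<in>{\<lfloor>t_fun x\<rfloor>..\<lfloor>t_fun x\<rfloor> + 1}. weight N l x * inv_fibre N l f x)"

lemma glue_window:
  assumes "finite S" "{\<lfloor>t_fun x\<rfloor>..\<lfloor>t_fun x\<rfloor> + 1} \<subseteq> S"
  shows "glue l f x = (\<Sum>N\<in>S. weight N l x * inv_fibre N l f x)"
  unfolding glue_def weight_def mult.assoc by (rule part_unity_window[OF assms])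

text \<open>The window of \<open>glue\<close> jumps where \<open>t_fun\<close> is an integer. On a
  neighbourhood one finite range works, uniformly in l and f, so \<open>glue\<close> may be
  differentiated termwise there.\<close>

lemma glue_local:
  "\<exists>U S. open U \<and> x0 \<in> U \<and> finite S \<and>
    (\<forall>l f. \<forall>x\<in>U. glue l f x = (\<Sum>N\<in>S. weight N l x * inv_fibre N l f x))"
proof -
  define z where "z = \<lfloor>t_fun x0\<rfloor>"
  \<comment> \<open>\<open>t_fun x0\<close> lies between z and z + 1, hence inside. On
    \<open>U\<close> the floor is between z - 1 and z + 1, so the windows stay within z - 1 and z +
    2.\<close>
  define U where "U = t_fun -` {of_int z - 1<..<of_int z + 2}"
  have "open U" unfolding U_def
    by (intro open_vimage open_greaterThanLessThan linear_continuous_on bounded_linear_t_fun)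
  moreover have "x0 \<in> U" unfolding U_def z_def by (simp, linarith)
  moreover have "{\<lfloor>t_fun x\<rfloor>..\<lfloor>t_fun x\<rfloor> + 1} \<subseteq> {z - 1..z + 2}" if "x \<in> U" for x
  proof -
    have "z - 1 \<le> \<lfloor>t_fun x\<rfloor>" "\<lfloor>t_fun x\<rfloor> < z + 2" using that unfolding U_def
      by (simp_all add: le_floor_iff floor_less_iff)
    then show ?thesis by auto
  qed
  then have "glue l f x = (\<Sum>N\<in>{z - 1..z + 2}. weight N l x * inv_fibre N l f x)" if "x \<in> U" for l f x
    using glue_window[of "{z - 1..z + 2}"] that by simp
  ultimately show ?thesis by (intro exI[of _ U] exI[of _ "{z - 1..z + 2}"]) simp
qed

lemma smooth_glue_sum: "smooth f \<Longrightarrow> smooth (\<lambda>x. \<Sum>N\<in>S. weight N l x * inv_fibre N l f x)"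
  by (intro smooth_sum smooth_mult smooth_weight convop_smooth[OF convop_inv_fibre])

lemma smooth_glue:
  assumes f: "smooth f"
  shows "smooth (glue l f)"
proof (rule smooth_local)
  fix x
  obtain U S where US: "open U" "x \<in> U" "finite S"
    "\<And>l f x. x \<in> U \<Longrightarrow> glue l f x = (\<Sum>N\<in>S. weight N l x * inv_fibre N l f x)"
    using glue_local[of x] by blast
  show "\<exists>U g. open U \<and> x \<in> U \<and> smooth g \<and> (\<forall>y\<in>U. glue l f y = g y)"
    using US smooth_glue_sum[OF f] by blast
qed

text \<open>The exponential depends on w alone and is therefore a constant for operators acting
  along the fibres.\<close>

lemma zop_fibre_good:
  assumes T: "convop fibre T" and f: "smooth f"
  shows "T (zop lam s f) = zop lam s (T f)"
proof -
  have "T (\<lambda>x. exp (- of_real (lam * idx_sign s) * w_sum x) * wirtinger s f x) =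
      (\<lambda>x. exp (- of_real (lam * idx_sign s) * w_sum x) * T (wirtinger s f) x)"
    by (rule convop_mult[OF T smooth_wirtinger[OF f] smooth_exp_w_sum]) (simp add: w_sum_fibre)
  then show ?thesis
    unfolding convop_wirtinger[OF T f] by (simp add: zop_def[abs_def])
qed

text \<open>The weights are constant along the fibres, so fibre derivatives pass through. Base
  derivatives would differentiate the partition of unity; this is the commutator left over in the
  Koszul argument.\<close>

lemma glue_zop:
  assumes f: "smooth f"
  shows "zop lam (False, Inr i) (glue l f) = glue l (zop lam (False, Inr i) f)"
proof
  fix x
  let ?s = "(False, Inr i) :: ('n, 'm) idx"
  obtain U S where US: "open U" "x \<in> U" "finite S"
    "\<And>l f x. x \<in> U \<Longrightarrow> glue l f x = (\<Sum>N\<in>S. weight N l x * inv_fibre N l f x)"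
    using glue_local[of x] by blast
  note g = convop_smooth[OF convop_inv_fibre f]
  have gw: "convop fibre (wirtinger ?s)"
    by (rule convop_wirtinger_op[OF subspace_fibre]) (simp add: coord_vec_fibre)
  have "wirtinger ?s (glue l f) x = wirtinger ?s (\<lambda>x. \<Sum>N\<in>S. weight N l x * inv_fibre N l f x) x"
    unfolding wirtinger_def using dd_local[OF US(1,2) smooth_glue_sum[OF f] US(4)] by simp
  also have "\<dots> = wirtinger ?s (\<lambda>x. \<Sum>N\<in>S. 1 * (weight N l x * inv_fibre N l f x)) x" by simp
  also have "\<dots> = (\<Sum>N\<in>S. 1 * wirtinger ?s (\<lambda>x. weight N l x * inv_fibre N l f x) x)"
    by (subst convop_sum[OF gw]) (auto intro: smooth_mult smooth_weight g)
  also have "\<dots> = (\<Sum>N\<in>S. weight N l x * wirtinger ?s (inv_fibre N l f) x)"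
    by (intro sum.cong refl) (subst convop_mult[OF gw g smooth_weight weight_fibre], auto)
  finally have "zop lam ?s (glue l f) x = (\<Sum>N\<in>S. weight N l x * zop lam ?s (inv_fibre N l f) x)"
    by (simp add: zop_def sum_distrib_left mult_ac)
  also have "\<dots> = glue l (zop lam ?s f) x"
    unfolding US(4)[OF US(2)] zop_fibre_good[OF convop_inv_fibre f] ..
  finally show "zop lam ?s (glue l f) x = glue l (zop lam ?s f) x" .
qed

end

section \<open>The isomorphism\<close>

text \<open>The isomorphism theorem for a projection \<open>m\<close> of \<open>V\<close> onto
  \<open>B\<close> with kernel \<open>U\<close>. As \<open>m\<close> is constant on cosets, any
  chosen representative gives the same value.\<close>

lemma quotient_iso:
  fixes U V B :: "'v form set"
  assumes UV: "U \<subseteq> V" and U0: "0 \<in> U"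
    and U_add: "\<And>x y. x \<in> U \<Longrightarrow> y \<in> U \<Longrightarrow> x + y \<in> U"
    and U_scale: "\<And>c x. x \<in> U \<Longrightarrow> form_scale c x \<in> U"
    and V_add: "\<And>x y. x \<in> V \<Longrightarrow> y \<in> V \<Longrightarrow> x + y \<in> V"
    and V_scale: "\<And>c x. x \<in> V \<Longrightarrow> form_scale c x \<in> V"
    and m_add: "\<And>x y. x \<in> V \<Longrightarrow> y \<in> V \<Longrightarrow> m (x + y) = m x + m y"
    and m_scale: "\<And>c x. x \<in> V \<Longrightarrow> m (form_scale c x) = form_scale c (m x)"
    and m_kernel: "\<And>x. x \<in> V \<Longrightarrow> m x = 0 \<longleftrightarrow> x \<in> U"
    and m_B: "\<And>x. x \<in> V \<Longrightarrow> m x \<in> B"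
    and B: "\<And>b. b \<in> B \<Longrightarrow> b \<in> V \<and> m b = b"
  shows "linear_iso ((\<lambda>\<omega>. \<omega> +o U) ` V) (+) (coset_scale U) B (+) form_scale (\<lambda>X. m (SOME v. v \<in> X))"
proof -
  let ?\<Phi> = "\<lambda>X. m (SOME v. v \<in> X)"
  have \<Phi>: "?\<Phi> (v +o U) = m v" if v: "v \<in> V" for v
  proof -
    have "v \<in> v +o U" using U0 by (auto simp: elt_set_plus_def intro: bexI[of _ 0])
    then have "(SOME w. w \<in> v +o U) \<in> v +o U" by (rule someI[of "\<lambda>w. w \<in> v +o U"])
    then obtain u where u: "u \<in> U" "(SOME w. w \<in> v +o U) = v + u" by (auto simp: elt_set_plus_def)
    have "m u = 0" using m_kernel u(1) UV by blast
    then show ?thesis unfolding u(2) using m_add[of v u] v u(1) UV by auto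
  qed
  have uminus: "- x \<in> U" if "x \<in> U" for x
    using U_scale[OF that, of "- 1"] by (simp add: form_scale_def fun_Compl_def)
  have coset_eq: "v +o U = w +o U" if vw: "v - w \<in> U" for v w
  proof (rule equalityI; rule subsetI)
    fix x
    assume "x \<in> v +o U"
    then obtain u where "u \<in> U" "x = v + u" by (auto simp: elt_set_plus_def)
    then have "x = w + ((v - w) + u)" "(v - w) + u \<in> U" using U_add[OF vw] by simp_all
    then show "x \<in> w +o U" unfolding elt_set_plus_def by blast
  next
    fix x
    assume "x \<in> w +o U"
    then obtain u where "u \<in> U" "x = w + u" by (auto simp: elt_set_plus_def)
    then have "x = v + (- (v - w) + u)" "- (v - w) + u \<in> U" using U_add[OF uminus[OF vw]] by simp_all
    then show "x \<in> v +o U" unfolding elt_set_plus_def by blast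
  qed
  have "inj_on ?\<Phi> ((\<lambda>\<omega>. \<omega> +o U) ` V)"
  proof (rule inj_onI, clarify)
    fix v w assume v: "v \<in> V" and w: "w \<in> V" and eq: "?\<Phi> (v +o U) = ?\<Phi> (w +o U)"
    have w': "form_scale (- 1) w \<in> V" by (rule V_scale[OF w])
    have d: "v - w = v + form_scale (- 1) w" by (simp add: form_scale_def fun_eq_iff)
    have "m (v - w) = m v + form_scale (- 1) (m w)" unfolding d m_add[OF v w'] m_scale[OF w] ..
    also have "\<dots> = 0" using eq \<Phi>[OF v] \<Phi>[OF w] by (simp add: form_scale_def fun_eq_iff)
    finally have "v - w \<in> U" using m_kernel V_add[OF v w'] d by metis
    then show "v +o U = w +o U" by (rule coset_eq)
  qed
  moreover have "?\<Phi> ` ((\<lambda>\<omega>. \<omega> +o U) ` V) = B"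
  proof (intro equalityI subsetI)
    fix b assume "b \<in> ?\<Phi> ` ((\<lambda>\<omega>. \<omega> +o U) ` V)"
    then obtain v where "v \<in> V" "b = ?\<Phi> (v +o U)" by blast
    then show "b \<in> B" using \<Phi> m_B by simp
  next
    fix b assume b: "b \<in> B"
    then have "?\<Phi> (b +o U) = b" using B \<Phi> by simp
    then show "b \<in> ?\<Phi> ` ((\<lambda>\<omega>. \<omega> +o U) ` V)" using B[OF b] by (metis imageI)
  qed
  moreover have "?\<Phi> (X + Y) = ?\<Phi> X + ?\<Phi> Y"
    if X: "X \<in> (\<lambda>\<omega>. \<omega> +o U) ` V" and Y: "Y \<in> (\<lambda>\<omega>. \<omega> +o U) ` V" for X Y
  proof -
    obtain v w where v: "v \<in> V" "X = v +o U" and w: "w \<in> V" "Y = w +o U" using X Y by blast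
    have "X + Y = (v + w) +o U"
    proof (rule equalityI; rule subsetI)
      fix x assume "x \<in> X + Y"
      then obtain a b where ab: "a \<in> U" "b \<in> U" "x = (v + a) + (w + b)"
        unfolding v w by (auto simp: set_plus_def elt_set_plus_def)
      then have "x = (v + w) + (a + b)" by (simp add: algebra_simps)
      then show "x \<in> (v + w) +o U" using U_add[OF ab(1,2)] unfolding elt_set_plus_def by blast
    next
      fix x assume "x \<in> (v + w) +o U"
      then obtain a where a: "a \<in> U" "x = (v + w) + a" by (auto simp: elt_set_plus_def)
      then have x: "x = (v + a) + (w + 0)" by (simp add: algebra_simps)
      have "v + a \<in> X" "w + 0 \<in> Y" unfolding v w elt_set_plus_def using a(1) U0 by blast+
      then show "x \<in> X + Y" unfolding x by (rule set_plus_intro)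
    qed
    then show ?thesis using \<Phi> v w V_add m_add by simp
  qed
  moreover have "?\<Phi> (coset_scale U c X) = form_scale c (?\<Phi> X)" if X: "X \<in> (\<lambda>\<omega>. \<omega> +o U) ` V" for c X
  proof -
    obtain v where v: "v \<in> V" "X = v +o U" using X by blast
    have scale_add: "form_scale c (x + y) = form_scale c x + form_scale c y" for x y :: "'v form"
      by (simp add: form_scale_def fun_eq_iff distrib_left)
    have "coset_scale U c X = form_scale c v +o U"
    proof (rule equalityI; rule subsetI)
      fix x assume "x \<in> coset_scale U c X"
      then obtain a b where ab: "a \<in> U" "b \<in> U" "x = form_scale c (v + a) + b"
        unfolding v by (auto simp: coset_scale_def set_plus_def elt_set_plus_def)
      then have "x = form_scale c v + (form_scale c a + b)" by (simp add: scale_add add.assoc)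
      then show "x \<in> form_scale c v +o U"
        using U_add[OF U_scale[OF ab(1), of c] ab(2)] unfolding elt_set_plus_def by blast
    next
      fix x assume "x \<in> form_scale c v +o U"
      then obtain a where a: "a \<in> U" "x = form_scale c v + a" by (auto simp: elt_set_plus_def)
      have "v \<in> X" unfolding v elt_set_plus_def using U0 by (auto intro: bexI[of _ 0])
      then have "form_scale c v + a \<in> form_scale c ` X + U" using a(1) by (intro set_plus_intro imageI)
      then show "x \<in> coset_scale U c X" unfolding coset_scale_def a(2) .
    qed
    then show ?thesis using \<Phi> v V_scale m_scale by simp
  qed
  ultimately show ?thesis unfolding linear_iso_def bij_betw_def by blast
qed

context solv_lattice
begin

section \<open>The operators preserve invariant functions\<close>

lemma idx_sign_cases: "idx_sign s = 0 \<or> idx_sign s = 1 \<or> idx_sign s = - 1"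
  by (auto simp: idx_sign_def split: sum.splits)

lemma exp_w_sum_lattice:
  assumes "exp (of_real lam * w_sum \<gamma>) = exp (of_real (lam * of_int N))"
  shows "exp (of_real (lam * idx_sign s) * w_sum \<gamma>) = of_real (exp (idx_sign s * (lam * of_int N)))"
proof -
  have e: "exp (of_real lam * w_sum \<gamma>) = of_real (exp (lam * of_int N))"
    unfolding assms by (rule exp_of_real)
  have "exp (- (of_real lam * w_sum \<gamma>)) = of_real (exp (- (lam * of_int N)))"
    unfolding exp_minus e by simp
  with e idx_sign_cases[of s] show ?thesis by auto
qed

lemma stretch_idx_sign: "(case snd s of Inl i \<Rightarrow> 1 | Inr j \<Rightarrow> stretch N j) = exp (- idx_sign s * (lam * of_int N))"
  by (auto simp: idx_sign_def stretch_def split: sum.splits)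

lemma F_lattice:
  assumes "f \<in> F" "\<gamma> \<in> \<Gamma>" and N: "\<And>x. gmult lam \<gamma> x = \<gamma> + monodromy N x"
  shows "(\<lambda>x. f (\<gamma> + monodromy N x)) = f"
  unfolding N[symmetric] by (rule ext) (rule F_gmult[OF assms(1,2)])

lemma FI: "smooth f \<Longrightarrow> (\<And>\<gamma> x. \<gamma> \<in> \<Gamma> \<Longrightarrow> f (gmult lam \<gamma> x) = f x) \<Longrightarrow> f \<in> F"
  unfolding invariant_funs_def by blast

text \<open>The chain rule along the monodromy produces a factor \<open>c\<close> in front of the
  derivative at the translated point; the shift of \<open>w_sum\<close> multiplies the exponential
  prefactor there by the same \<open>c\<close>, so the two compensate.\<close>

lemma zop_F:
  assumes f: "f \<in> F"
  shows "zop lam s f \<in> F"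
proof (rule FI)
  note sf = F_smooth[OF f]
  show "smooth (zop lam s f)" by (rule smooth_zop[OF sf])
  fix \<gamma> x assume \<gamma>: "\<gamma> \<in> \<Gamma>"
  obtain N where N: "exp (of_real lam * w_sum \<gamma>) = exp (of_real (lam * of_int N))"
    "\<And>x. gmult lam \<gamma> x = \<gamma> + monodromy N x"
    using lattice_action[OF \<gamma>] by metis
  define c where "c = exp (- idx_sign s * (lam * of_int N))"
  have d: "dd (coord_vec (snd s) z) f x = c * dd (coord_vec (snd s) z) f (\<gamma> + monodromy N x)" for z
  proof -
    have "dd (coord_vec (snd s) z) (\<lambda>x. f (\<gamma> + monodromy N x)) x = dd (monodromy N (coord_vec (snd s) z)) f (\<gamma> + monodromy N x)"
      by (rule dd_eqI[OF dd_affine[OF bounded_linear_monodromy sf]])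
    then show ?thesis
      unfolding F_lattice[OF f \<gamma> N(2)] monodromy_coord_vec dd_scale_dir[OF sf] stretch_idx_sign c_def .
  qed
  have w: "wirtinger s f x = c * wirtinger s f (\<gamma> + monodromy N x)"
    unfolding wirtinger_def d by (simp add: algebra_simps)
  have "exp (- of_real (lam * idx_sign s) * w_sum \<gamma>) = inverse (exp (of_real (lam * idx_sign s) * w_sum \<gamma>))"
    by (simp add: exp_minus)
  also have "\<dots> = of_real c" unfolding exp_w_sum_lattice[OF N(1)] c_def by (simp add: exp_minus)
  finally have "exp (- of_real (lam * idx_sign s) * w_sum (\<gamma> + monodromy N x)) =
      of_real c * exp (- of_real (lam * idx_sign s) * w_sum x)"
    unfolding w_sum_add w_sum_monodromy distrib_left exp_add by simp
  then show "zop lam s f (gmult lam \<gamma> x) = zop lam s f x"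
    unfolding zop_def w N(2) by (simp add: mult_ac)
qed

lemma t_fun_lattice:
  assumes "Re (a_fun (fst \<gamma>)) = of_int N"
  shows "t_fun (\<gamma> + monodromy N' x) = t_fun x + of_int N"
proof -
  have "t_fun (\<gamma> + monodromy N' x) = t_fun \<gamma> + t_fun x"
    by (simp add: t_fun_def monodromy_def sum.distrib)
  then show ?thesis using assms by (simp add: t_fun_a_fun)
qed

text \<open>The translation moves the basis \<open>fdir (N - N')\<close> to \<open>fdir N\<close>
  and leaves \<open>f\<close> unchanged; the factor is the scaling of the l-th fibre
  coordinate.\<close>

lemma inv_fibre_lattice:
  assumes f: "f \<in> F" and \<gamma>: "\<gamma> \<in> \<Gamma>" and N': "\<And>x. gmult lam \<gamma> x = \<gamma> + monodromy N' x"
  shows "inv_fibre N l f (\<gamma> + monodromy N' x) = stretch N' l * inv_fibre (N - N') l f x"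
proof -
  have "green_fibre N j f (\<gamma> + monodromy N' x) = green_fibre (N - N') j f x" for j
    using greens_affine[OF bounded_linear_monodromy F_smooth[OF f] one_nonzero, of N' "fdir (N - N')" "enum_set UNIV" j \<gamma> x]
    unfolding fdir_monodromy F_lattice[OF f \<gamma> N'] green_fibre_def by simp
  moreover have "stretch N l = stretch N' l * stretch (N - N') l" using stretch_add[of N' "N - N'" l] by simp
  ultimately show ?thesis by (simp add: inv_fibre_def sum_distrib_left mult_ac)
qed

text \<open>A lattice element shifts \<open>t_fun\<close> by \<open>N'\<close>, so it renumbers the
  partition of unity exactly as it renumbers the bases; the factor \<open>stretch N' l\<close> is
  cancelled by the twist in \<open>weight\<close>.\<close>

lemma glue_F:
  assumes f: "f \<in> F"
  shows "glue l f \<in> F"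
proof (rule FI)
  show "smooth (glue l f)" by (rule smooth_glue[OF F_smooth[OF f]])
  fix \<gamma> x assume \<gamma>: "\<gamma> \<in> \<Gamma>"
  obtain N' where N': "Re (a_fun (fst \<gamma>)) = of_int N'"
    "exp (of_real lam * w_sum \<gamma>) = exp (of_real (lam * of_int N'))"
    "\<And>x. gmult lam \<gamma> x = \<gamma> + monodromy N' x"
    using lattice_action[OF \<gamma>] by metis
  let ?s = "(False, Inr l) :: ('n, 'm) idx"
  note t = t_fun_lattice[OF N'(1), of N' x]
  have tw: "twist lam {?s} (\<gamma> + monodromy N' x) * stretch N' l = twist lam {?s} x"
  proof -
    have "twist lam {?s} (\<gamma> + monodromy N' x) = of_real (exp (idx_sign ?s * (lam * of_int N'))) * twist lam {?s} x"
      unfolding twist_def w_sum_add w_sum_monodromy distrib_left exp_add using exp_w_sum_lattice[OF N'(2), where s = ?s] by simp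
    moreover have "stretch N' l = exp (- idx_sign ?s * (lam * of_int N'))" using stretch_idx_sign[where s = ?s and N = N'] by simp
    ultimately show ?thesis by (simp add: exp_minus)
  qed
  have term_eq: "weight (N + N') l (\<gamma> + monodromy N' x) * inv_fibre (N + N') l f (\<gamma> + monodromy N' x) =
      weight N l x * inv_fibre N l f x" for N
    unfolding weight_def t part_unity_shift inv_fibre_lattice[OF f \<gamma> N'(3)] tw[symmetric] by (simp add: mult_ac)
  have "glue l f (gmult lam \<gamma> x) =
      (\<Sum>N\<in>{\<lfloor>t_fun x\<rfloor> + N'..\<lfloor>t_fun x\<rfloor> + N' + 1}. weight N l (\<gamma> + monodromy N' x) * inv_fibre N l f (\<gamma> + monodromy N' x))"
    unfolding glue_def N'(3) t by (simp add: add_ac)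
  also have "\<dots> = (\<Sum>N\<in>{\<lfloor>t_fun x\<rfloor>..\<lfloor>t_fun x\<rfloor> + 1}. weight (N + N') l (\<gamma> + monodromy N' x) * inv_fibre (N + N') l f (\<gamma> + monodromy N' x))"
    by (rule sum.reindex_bij_witness[where i = "\<lambda>N. N + N'" and j = "\<lambda>N. N - N'"]) auto
  also have "\<dots> = glue l f x" unfolding term_eq glue_def ..
  finally show "glue l f (gmult lam \<gamma> x) = glue l f x" .
qed

text \<open>Translation turns the average over one basis into the average over another, and
  \<open>avg_fibre_independent\<close> identifies them.\<close>

lemma avg_fibre_F:
  assumes f: "f \<in> F"
  shows "avg_fibre 0 f \<in> F"
proof (rule FI)
  note sf = F_smooth[OF f]
  show "smooth (avg_fibre 0 f)" by (rule convop_smooth[OF convop_avg_fibre sf])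
  fix \<gamma> x assume \<gamma>: "\<gamma> \<in> \<Gamma>"
  obtain N where N: "\<And>x. gmult lam \<gamma> x = \<gamma> + monodromy N x" using lattice_action[OF \<gamma>] by metis
  have "avg_fibre 0 f (gmult lam \<gamma> x) = avg_fibre (- N) f x"
    using avgs_affine[OF bounded_linear.linear[OF bounded_linear_monodromy], of N "fdir (- N)" "enum_set UNIV" f \<gamma> x]
    unfolding fdir_monodromy F_lattice[OF f \<gamma> N] avg_fibre_def N by simp
  then show "avg_fibre 0 f (gmult lam \<gamma> x) = avg_fibre 0 f x"
    using avg_fibre_independent[OF sf F_periods[OF f], of "- N" 0] by simp
qed

text \<open>The monodromy fixes the base directions, so translation does not change the
  operator.\<close>

lemma green_base_F:
  assumes f: "f \<in> F"
  shows "green_base i f \<in> F"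
proof (rule FI)
  note sf = F_smooth[OF f]
  show "smooth (green_base i f)" by (rule convop_smooth[OF convop_green_base sf])
  fix \<gamma> x assume \<gamma>: "\<gamma> \<in> \<Gamma>"
  obtain N where N: "\<And>x. gmult lam \<gamma> x = \<gamma> + monodromy N x" using lattice_action[OF \<gamma>] by metis
  show "green_base i f (gmult lam \<gamma> x) = green_base i f x"
    using greens_affine[OF bounded_linear_monodromy[of N] sf mu_nonzero, where D = bdir and js = "enum_set UNIV"
        and i = i and c = \<gamma> and x = x]
    unfolding bdir_monodromy F_lattice[OF f \<gamma> N] green_base_def N by simp
qed

text \<open>An element of \<open>F\<close> itself need not have these periods, since left
  translation also applies the monodromy to the fibre. After averaging this is invisible:
  \<open>monodromy N x - x\<close> lies in the fibre.\<close>

lemma periods_bdir: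
  assumes f: "f \<in> F"
  shows "periods bdir (avg_fibre 0 f)"
proof -
  let ?h = "avg_fibre 0 f"
  have "?h (x + \<gamma>) = ?h x" if \<gamma>: "\<gamma> \<in> \<Gamma>" for \<gamma> x
  proof -
    obtain N where N: "\<And>x. gmult lam \<gamma> x = \<gamma> + monodromy N x" using lattice_action[OF \<gamma>] by metis
    have "monodromy N x - x \<in> fibre" by (simp add: monodromy_def fibre_def)
    from avg_fibre_invariant[OF F_smooth[OF f] F_periods[OF f, of 0] this, where x = "x + \<gamma>"]
    have "?h (\<gamma> + monodromy N x) = ?h (x + \<gamma>)" by (simp add: add_ac)
    then show ?thesis using F_gmult[OF avg_fibre_F[OF f] \<gamma>, of x] N by simp
  qed
  then show ?thesis unfolding periods_def using bdir_lattice by blast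
qed

lemma zop_base: "zop lam (h, Inl i) f = wirtinger (h, Inl i) f"
  by (rule ext) (simp add: zop_def idx_sign_def)

text \<open>Follows the splitting 1 - mean = (1 - fibre average) + (fibre average - mean). The base
  Green operators serve the second part, where the base periods are available.\<close>

definition homotopy_op :: "('n, 'm) idx \<Rightarrow> (('n, 'm) grp \<Rightarrow> complex) \<Rightarrow> ('n, 'm) grp \<Rightarrow> complex"
  where "homotopy_op s f = (case snd s of Inl i \<Rightarrow> green_base i (avg_fibre 0 f) | Inr l \<Rightarrow> glue l f)"

definition mean :: "(('n, 'm) grp \<Rightarrow> complex) \<Rightarrow> ('n, 'm) grp \<Rightarrow> complex"
  where "mean f = avg_base (avg_fibre 0 f)"

lemma wirtinger_avg_fibre: "f \<in> F \<Longrightarrow> wirtinger (h, Inr j) (avg_fibre 0 f) = (\<lambda>x. 0)"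
  by (rule wirtinger_fibre_zero) (rule dd_avg_fibre[OF F_smooth F_periods])

lemma avg_fibre_zop: "f \<in> F \<Longrightarrow> avg_fibre 0 (zop lam (h, Inr j) f) = (\<lambda>x. 0)"
  unfolding zop_fibre_good[OF convop_avg_fibre F_smooth]
  by (rule ext) (simp add: zop_def wirtinger_avg_fibre)

lemma convop_linear_op:
  assumes "convop U T"
  shows "linear_op F T"
  unfolding linear_op_def using convop_add[OF assms] convop_cmult[OF assms] F_smooth by blast

lemma glue_linear_op: "linear_op F (glue l)"
proof -
  have "inv_fibre N l (\<lambda>x. f x + g x) = (\<lambda>x. inv_fibre N l f x + inv_fibre N l g x)" if "f \<in> F" "g \<in> F" for N f g
    by (rule convop_add[OF convop_inv_fibre F_smooth[OF that(1)] F_smooth[OF that(2)]])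
  moreover have "inv_fibre N l (\<lambda>x. c * f x) = (\<lambda>x. c * inv_fibre N l f x)" if "f \<in> F" for N f c
    by (rule convop_cmult[OF convop_inv_fibre F_smooth[OF that]])
  ultimately show ?thesis
    by (simp add: linear_op_def glue_def[abs_def] distrib_left sum.distrib sum_distrib_left mult_ac)
qed

lemma linear_op_comp:
  assumes "linear_op F S" "linear_op F T" "\<And>f. f \<in> F \<Longrightarrow> T f \<in> F"
  shows "linear_op F (\<lambda>f. S (T f))"
  unfolding linear_op_def
proof (intro conjI ballI allI)
  show "S (T (\<lambda>x. f x + g x)) = (\<lambda>x. S (T f) x + S (T g) x)" if "f \<in> F" "g \<in> F" for f g
    unfolding linear_op_add[OF assms(2) that] by (rule linear_op_add[OF assms(1) assms(3)[OF that(1)] assms(3)[OF that(2)]])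
  show "S (T (\<lambda>x. c * f x)) = (\<lambda>x. c * S (T f) x)" if "f \<in> F" for f c
    unfolding linear_op_cmult[OF assms(2) that] by (rule linear_op_cmult[OF assms(1) assms(3)[OF that]])
qed

lemma homotopy_op_linear: "linear_op F (homotopy_op s)"
proof (cases "snd s")
  case (Inl i)
  then have "homotopy_op s = (\<lambda>f. green_base i (avg_fibre 0 f))" by (simp add: homotopy_op_def fun_eq_iff)
  then show ?thesis
    using linear_op_comp[OF convop_linear_op[OF convop_green_base] convop_linear_op[OF convop_avg_fibre] avg_fibre_F] by simp
next
  case (Inr l)
  then have "homotopy_op s = glue l" by (simp add: homotopy_op_def fun_eq_iff)
  then show ?thesis using glue_linear_op by simp
qed

lemma mean_linear: "linear_op F mean"
proof -
  have "mean = (\<lambda>f. avg_base (avg_fibre 0 f))" by (rule ext) (rule mean_def)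
  then show ?thesis
    using linear_op_comp[OF convop_linear_op[OF convop_avg_base] convop_linear_op[OF convop_avg_fibre] avg_fibre_F] by simp
qed

lemma zop_linear: "linear_op F (zop lam s)"
proof -
  have "convop UNIV (wirtinger s)" by (rule convop_wirtinger_op[OF subspace_UNIV]) simp
  note l = convop_linear_op[OF this]
  show ?thesis
    unfolding linear_op_def
  proof (intro conjI ballI allI ext)
    show "zop lam s (\<lambda>x. f x + g x) x = zop lam s f x + zop lam s g x" if "f \<in> F" "g \<in> F" for f g x
      unfolding zop_def linear_op_add[OF l that] by (simp add: distrib_left)
    show "zop lam s (\<lambda>x. c * f x) x = c * zop lam s f x" if "f \<in> F" for f c x
      unfolding zop_def linear_op_cmult[OF l that] by (simp add: mult_ac)
  qed
qed

lemma mean_zop: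
  assumes f: "f \<in> F" and s: "s \<in> antihol"
  shows "mean (zop lam s f) = (\<lambda>x. 0)"
proof -
  obtain c where c: "s = (False, c)" using s by (cases s) (auto simp: antihol_def)
  show ?thesis
  proof (cases c)
    case (Inl i)
    note h = F_smooth[OF avg_fibre_F[OF f]]
    have "mean (zop lam s f) = avg_base (cr_op (fst (bdir i)) (snd (bdir i)) (mu i) (avg_fibre 0 f))"
      unfolding mean_def c Inl zop_base convop_wirtinger[OF convop_avg_fibre F_smooth[OF f]] cr_bdir[OF h] ..
    also have "\<dots> = (\<lambda>x. 0)"
      unfolding avg_base_def
      by (rule avgs_cr_zero[OF subspace_base bdir_base mu_nonzero _ h periods_bdir[OF f]]) simp
    finally show ?thesis .
  next
    case (Inr j)
    then show ?thesis unfolding mean_def c Inr avg_fibre_zop[OF f] convop_zero[OF convop_avg_base] by simp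
  qed
qed

text \<open>For every N the fibre operators give \<open>f\<close> minus an average that is the same
  for all N by \<open>avg_fibre_independent\<close>; the partition of unity then sums to 1.\<close>

lemma homotopy_glue:
  assumes f: "f \<in> F"
  shows "(\<Sum>l\<in>UNIV. glue l (zop lam (False, Inr l) f) x) = f x - avg_fibre 0 f x"
proof -
  note sf = F_smooth[OF f]
  have t: "weight N l x * inv_fibre N l (zop lam (False, Inr l) f) x =
      part_unity N (t_fun x) * inv_fibre N l (wirtinger (False, Inr l) f) x" for N l
  proof -
    let ?s = "(False, Inr l) :: ('n, 'm) idx"
    have "twist lam {?s} x * exp (- of_real (lam * idx_sign ?s) * w_sum x) = 1"
      by (simp add: twist_def flip: exp_add)
    moreover have "inv_fibre N l (zop lam ?s f) x =
        exp (- of_real (lam * idx_sign ?s) * w_sum x) * inv_fibre N l (wirtinger ?s f) x"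
      unfolding zop_fibre_good[OF convop_inv_fibre sf] convop_wirtinger[OF convop_inv_fibre sf] zop_def ..
    ultimately show ?thesis unfolding weight_def by (metis (no_types, lifting) mult.assoc mult.right_neutral)
  qed
  have "(\<Sum>l\<in>UNIV. glue l (zop lam (False, Inr l) f) x) =
      (\<Sum>N\<in>{\<lfloor>t_fun x\<rfloor>..\<lfloor>t_fun x\<rfloor> + 1}. part_unity N (t_fun x) * (\<Sum>l\<in>UNIV. inv_fibre N l (wirtinger (False, Inr l) f) x))"
    unfolding glue_def t sum_distrib_left by (rule sum.swap)
  also have "\<dots> = (\<Sum>N\<in>{\<lfloor>t_fun x\<rfloor>..\<lfloor>t_fun x\<rfloor> + 1}. part_unity N (t_fun x)) * (f x - avg_fibre 0 f x)"
    unfolding inv_fibre_sum[OF sf F_periods[OF f]] sum_distrib_right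
    by (intro sum.cong refl) (subst avg_fibre_independent[OF sf F_periods[OF f], of _ 0], rule refl)
  finally show ?thesis unfolding part_unity_sum by simp
qed

lemma homotopy_base:
  assumes f: "f \<in> F"
  shows "(\<Sum>i\<in>UNIV. green_base i (avg_fibre 0 (zop lam (False, Inl i) f)) x) = avg_fibre 0 f x - mean f x"
proof -
  note h = F_smooth[OF avg_fibre_F[OF f]]
  have "avg_fibre 0 (zop lam (False, Inl i) f) = cr_op (fst (bdir i)) (snd (bdir i)) (mu i) (avg_fibre 0 f)" for i
    unfolding zop_base convop_wirtinger[OF convop_avg_fibre F_smooth[OF f]] cr_bdir[OF h] ..
  then show ?thesis
    using greens_cr_op[OF subspace_base bdir_base mu_nonzero distinct_enum_set[of UNIV] h periods_bdir[OF f], where x = x]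
    unfolding green_base_def mean_def avg_base_def by simp
qed

text \<open>For two fibre indices this is \<open>glue_zop\<close>; for two base indices both
  operators are translation-invariant. For s in the fibre and t in the base both sides vanish, as
  fibre averages are constant along the fibres. The excluded case differentiates the
  weights.\<close>

lemma homotopy_zop_commute:
  assumes f: "f \<in> F" and s: "s \<in> antihol" and t: "t \<in> antihol"
    and st: "\<not> ((\<exists>i. snd s = Inl i) \<and> \<not> (\<exists>i. snd t = Inl i))"
  shows "zop lam s (homotopy_op t f) = homotopy_op t (zop lam s f)"
proof -
  obtain c d where c: "s = (False, c)" and d: "t = (False, d)"
    using s t by (cases s; cases t) (auto simp: antihol_def)
  note sf = F_smooth[OF f] and h = F_smooth[OF avg_fibre_F[OF f]]
  show ?thesis
  proof (cases d)
    case (Inr l)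
    then obtain j where "c = Inr j" using st c d by (cases c) auto
    then show ?thesis unfolding c d Inr homotopy_op_def using glue_zop[OF sf] by simp
  next
    case (Inl i)
    show ?thesis
    proof (cases c)
      case (Inl i')
      show ?thesis
        unfolding c d Inl \<open>d = Inl i\<close> homotopy_op_def
        by (simp add: zop_base convop_wirtinger[OF convop_green_base h] convop_wirtinger[OF convop_avg_fibre sf])
    next
      case (Inr j)
      have "zop lam (False, Inr j) (green_base i (avg_fibre 0 f)) = (\<lambda>x. 0)"
        by (rule ext) (simp add: zop_def convop_wirtinger[OF convop_green_base h, symmetric]
            wirtinger_avg_fibre[OF f] convop_zero[OF convop_green_base])
      moreover have "green_base i (avg_fibre 0 (zop lam (False, Inr j) f)) = (\<lambda>x. 0)"
        unfolding avg_fibre_zop[OF f] by (rule convop_zero[OF convop_green_base])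
      ultimately show ?thesis unfolding c d Inr \<open>d = Inl i\<close> homotopy_op_def by simp
    qed
  qed
qed

lemma homotopy_op_F: "f \<in> F \<Longrightarrow> homotopy_op s f \<in> F"
  by (cases "snd s") (simp_all add: homotopy_op_def green_base_F avg_fibre_F glue_F)

lemma F_zero: "(\<lambda>x. 0) \<in> F"
  by (rule FI) (auto intro: smooth_const)

lemma F_const: "(\<lambda>x. c) \<in> F"
  by (rule FI) (auto intro: smooth_const)

lemma F_add: "f \<in> F \<Longrightarrow> g \<in> F \<Longrightarrow> (\<lambda>x. f x + g x) \<in> F"
  by (rule FI) (auto intro: smooth_add F_smooth simp: F_gmult)

lemma F_cmult: "f \<in> F \<Longrightarrow> (\<lambda>x. c * f x) \<in> F"
  by (rule FI) (auto intro: smooth_cmult F_smooth simp: F_gmult)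

lemma koszul_solv: "koszul F antihol {s. \<exists>i. snd s = Inl i} (zop lam) homotopy_op mean"
proof
  fix f assume f: "f \<in> F"
  have anti: "antihol = (\<lambda>c. (False, c)) ` (UNIV :: ('n, 'm) coord set)"
    by (auto simp: antihol_def)
  fix x
  have "(\<Sum>s\<in>antihol. homotopy_op s (zop lam s f) x) = (\<Sum>c\<in>UNIV. homotopy_op (False, c) (zop lam (False, c) f) x)"
    unfolding anti by (subst sum.reindex) (auto simp: inj_on_def)
  also have "\<dots> = f x - mean f x"
    unfolding sum_coord homotopy_op_def using homotopy_base[OF f, of x] homotopy_glue[OF f, of x] by simp
  finally show "(\<Sum>s\<in>antihol. homotopy_op s (zop lam s f) x) = f x - mean f x" .
next
  fix s t :: "('n, 'm) idx" and f
  assume "s \<in> antihol" "t \<in> antihol" "f \<in> F"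
  then show "zop lam s (zop lam t f) = zop lam t (zop lam s f)"
    by (intro zop_commute F_smooth) (auto simp: antihol_def)
qed (auto intro: F_zero F_add F_cmult zop_F homotopy_op_F zop_linear homotopy_op_linear mean_linear mean_zop
    homotopy_zop_commute)

end

lemma bidegree_add:
  assumes "s \<in> C" "s \<in> antihol" "C - {s} \<in> bidegree_sets p q"
  shows "C \<in> bidegree_sets p (Suc q)"
proof -
  have s: "\<not> fst s" using assms(2) by (simp add: antihol_def)
  have "{t \<in> C. \<not> fst t} = insert s {t \<in> C - {s}. \<not> fst t}" "{t \<in> C. fst t} = {t \<in> C - {s}. fst t}"
    using assms(1) s by auto
  then show ?thesis using assms(3) by (simp add: bidegree_sets_def)
qed

lemma bidegree_0: "C \<in> bidegree_sets p 0 \<Longrightarrow> C \<inter> antihol = {}"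
  by (auto simp: bidegree_sets_def antihol_def)

context solv_lattice
begin

lemma mean_const: "mean (\<lambda>x. c) = (\<lambda>x. c)"
  unfolding mean_def avg_fibre_def avg_base_def
    avgs_invariant[OF subspace_fibre fdir_fibre one_nonzero smooth_const refl]
  by (rule avgs_invariant[OF subspace_base bdir_base mu_nonzero smooth_const refl])

text \<open>The derivative along the vector x vanishes everywhere: its base part by the base
  average, its fibre part by the fibre average. Integration from 0 to x gives the claim.\<close>

lemma mean_constant:
  assumes f: "f \<in> F"
  shows "mean f x = mean f 0"
proof -
  note h = F_smooth[OF avg_fibre_F[OF f]]
  note sm = convop_smooth[OF convop_avg_base h]
  have b: "dd (fst (bdir i)) (avg_base (avg_fibre 0 f)) = (\<lambda>x. 0)" "dd (snd (bdir i)) (avg_base (avg_fibre 0 f)) = (\<lambda>x. 0)" for i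
    unfolding avg_base_def
    by (rule avgs_dd_zero[OF subspace_base bdir_base mu_nonzero _ h periods_bdir[OF f], of i]; simp)+
  have fi: "dd (0, snd x) (avg_base (avg_fibre 0 f)) = (\<lambda>x. 0)"
    unfolding convop_dd[OF convop_avg_base h] dd_avg_fibre[OF F_smooth[OF f] F_periods[OF f], of "(0, snd x)", unfolded fibre_def, simplified]
    by (rule convop_zero[OF convop_avg_base])
  obtain a c where x: "x = (\<Sum>i\<in>UNIV. a i *\<^sub>R fst (bdir i) + c i *\<^sub>R snd (bdir i)) + (0, snd x)"
    using base_span by blast
  have "dd x (mean f) = (\<lambda>x. 0)"
  proof
    fix y
    have "dd ((\<Sum>i\<in>UNIV. a i *\<^sub>R fst (bdir i) + c i *\<^sub>R snd (bdir i)) + (0, snd x)) (mean f) y = 0"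
      unfolding mean_def dd_add_dir[OF sm] dd_sum_dir[OF sm] dd_scale_dir[OF sm] b fi by simp
    then show "dd x (mean f) y = 0" unfolding x[symmetric] .
  qed
  then have "mean f (0 + x) = mean f 0"
    by (intro translation_invariant) (simp_all add: mean_def sm)
  then show ?thesis by simp
qed

lemma Gamma_trivial:
  "\<gamma> \<in> \<Gamma> \<Longrightarrow> \<exists>r::real. exp (of_real lam * a_fun (fst \<gamma>)) = exp (of_real r) \<and>
    exp (of_real lam * w_sum \<gamma>) = exp (of_real r)"
  using lattice_action[of \<gamma>] by metis

interpretation kz: koszul F antihol "{s. \<exists>i. snd s = Inl i}" "zop lam" homotopy_op mean
  by (rule koszul_solv)

section \<open>Dolbeault classes as Koszul classes\<close>

lemma forms_cochain: "forms lam \<Gamma> p q = {form_of lam p q f | f. kz.cochain f}"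
  using forms_eq[OF Gamma_trivial, where p = p and q = q] unfolding kz.cochain_def by simp

lemma dbar_diff: "kz.cochain f \<Longrightarrow> dbar lam p q (form_of lam p q f) = form_of lam p (Suc q) (kz.diff f)"
  unfolding kz.diff_def[abs_def] by (rule dbar_form_of) (auto simp: kz.cochain_def intro: F_smooth)

lemma cochain_add: "kz.cochain f \<Longrightarrow> kz.cochain g \<Longrightarrow> kz.cochain (\<lambda>C x. f C x + g C x)"
  unfolding kz.cochain_def using F_add by blast

lemma cochain_scale: "kz.cochain f \<Longrightarrow> kz.cochain (\<lambda>C x. c * f C x)"
  unfolding kz.cochain_def using F_cmult by blast

lemma cochain_zero: "kz.cochain (\<lambda>C x. 0)"
  unfolding kz.cochain_def using F_zero by blast

lemma diff_zero: "kz.diff (\<lambda>C x. 0) = (\<lambda>C x. 0)"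
  by (intro ext) (simp add: kz.diff_def kz.op_zero[OF zop_linear])

lemma diff_add: "kz.cochain f \<Longrightarrow> kz.cochain g \<Longrightarrow> kz.diff (\<lambda>C x. f C x + g C x) = (\<lambda>C x. kz.diff f C x + kz.diff g C x)"
  using kz.diff_add[of f g 1] by simp

lemma diff_scale: "kz.cochain f \<Longrightarrow> kz.diff (\<lambda>C x. c * f C x) = (\<lambda>C x. c * kz.diff f C x)"
  using kz.diff_add[OF cochain_zero, of f c] by (simp add: diff_zero)

lemma closed_cochain:
  "dbar_closed lam \<Gamma> p q = {form_of lam p q f | f. kz.cochain f \<and> form_of lam p (Suc q) (kz.diff f) = 0}"
  unfolding dbar_closed_def forms_cochain using dbar_diff by auto

lemma exact_cochain:
  "dbar_exact lam \<Gamma> p (Suc q) = {form_of lam p (Suc q) (kz.diff f) | f. kz.cochain f}"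
proof -
  have "dbar_exact lam \<Gamma> p (Suc q) = dbar lam p q ` {form_of lam p q f | f. kz.cochain f}"
    by (simp add: dbar_exact_def forms_cochain)
  also have "\<dots> = {form_of lam p (Suc q) (kz.diff f) | f. kz.cochain f}"
    unfolding setcompr_eq_image image_image by (rule image_cong[OF refl]) (simp add: dbar_diff)
  finally show ?thesis .
qed

text \<open>The projection onto B. Means of invariant functions are constant functions, and
  evaluation at 0 turns them into the numbers that \<open>B_space_eq\<close> asks for.\<close>

definition mean_form :: "nat \<Rightarrow> nat \<Rightarrow> ('n, 'm) grp form \<Rightarrow> ('n, 'm) grp form"
  where "mean_form p q \<omega> = form_of lam p q (\<lambda>C x. mean (\<lambda>y. cov_coeff C (\<omega> y) * inverse (twist lam C y)) 0)"

lemma mean_form_of: "mean_form p q (form_of lam p q f) = form_of lam p q (\<lambda>C x. mean (f C) 0)"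
  unfolding mean_form_def
proof (rule form_of_cong)
  fix C :: "('n, 'm) idx set" assume "C \<in> bidegree_sets p q"
  then have "(\<lambda>y. cov_coeff C (form_of lam p q f y) * inverse (twist lam C y)) = f C"
    by (simp add: fun_eq_iff form_of_def coeff_comb twist_nonzero)
  then show "(\<lambda>x. mean (\<lambda>y. cov_coeff C (form_of lam p q f y) * inverse (twist lam C y)) 0) = (\<lambda>x. mean (f C) 0)"
    by simp
qed

lemma closed_mean_zero_exact:
  assumes f: "kz.cochain f" and closed: "form_of lam p (Suc q) (kz.diff f) = 0"
    and mean0: "form_of lam p q (\<lambda>C x. mean (f C) 0) = 0"
  shows "form_of lam p q f \<in> dbar_exact lam \<Gamma> p q"
proof -
  \<comment> \<open>\<open>form_of\<close> sees only sets of its own bidegree, so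
    \<open>kz.diff f\<close> is known to vanish only on sets of bidegree (p, q + 1). Cutting off the
    other components of \<open>f\<close> makes the whole cochain closed.\<close>
  define f' where "f' C = (if C \<in> bidegree_sets p q then f C else (\<lambda>x. 0))" for C
  have f': "kz.cochain f'" using f F_zero by (simp add: kz.cochain_def f'_def)
  have eq: "form_of lam p q f = form_of lam p q f'" by (rule form_of_cong) (simp add: f'_def)
  have "mean (f' C) = (\<lambda>x. 0)" for C
  proof (cases "C \<in> bidegree_sets p q")
    case True
    have "(\<lambda>x :: ('n, 'm) grp. mean (f C) 0) = (\<lambda>x. 0)"
      using form_of_inject[OF trans[OF mean0 form_of_zero[symmetric]] True] .
    then have "mean (f C) 0 = 0" by metis
    moreover have "mean (f C) x = mean (f C) 0" for x
      by (rule mean_constant) (use f in \<open>simp add: kz.cochain_def\<close>)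
    ultimately show ?thesis using True by (simp add: f'_def fun_eq_iff)
  next
    case False
    then show ?thesis using mean_const[of 0] by (simp add: f'_def)
  qed
  moreover have "kz.diff f' = (\<lambda>C x. 0)"
  proof
    fix C
    show "kz.diff f' C = (\<lambda>x. 0)"
    proof (cases "C \<in> bidegree_sets p (Suc q)")
      case True
      have "kz.diff f' C = kz.diff f C"
        unfolding kz.diff_def using bidegree_remove[OF True] by (intro ext sum.cong) (auto simp: f'_def)
      also have "\<dots> = (\<lambda>x. 0)"
        using form_of_inject[OF trans[OF closed form_of_zero[symmetric]] True] .
      finally show ?thesis .
    next
      case False
      \<comment> \<open>If \<open>C - {s}\<close> had bidegree (p, q) for a conjugate index s, then
        \<open>C\<close> would have bidegree (p, q + 1).\<close>
      have "f' (C - {s}) = (\<lambda>x. 0)" if "s \<in> C \<inter> antihol" for s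
        using bidegree_add[of s C p q] that False by (auto simp: f'_def)
      then show ?thesis
        unfolding kz.diff_def by (intro ext sum.neutral ballI) (simp add: kz.op_zero[OF zop_linear])
    qed
  qed
  ultimately obtain \<eta> where \<eta>: "kz.cochain \<eta>" "kz.diff \<eta> = f'"
    using kz.closed_imp_exact[OF f'] by blast
  show ?thesis
  proof (cases q)
    \<comment> \<open>Sets without conjugate indices receive nothing from \<open>kz.diff\<close>, so
      the form is 0, in accordance with the definition of \<open>dbar_exact\<close> in degree
      0.\<close>
    case 0
    have "f' C = (\<lambda>x. 0)" if "C \<in> bidegree_sets p q" for C
      unfolding \<eta>(2)[symmetric] kz.diff_def using bidegree_0[of C p] that 0 by simp
    then have "form_of lam p q f' = 0"
      using form_of_cong[of p q f' "\<lambda>C x. 0" lam] form_of_zero by simp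
    then show ?thesis unfolding eq by (simp add: dbar_exact_def 0)
  next
    case (Suc q')
    then show ?thesis unfolding eq \<eta>(2)[symmetric] using \<eta>(1) exact_cochain by blast
  qed
qed

lemma exact_mean_zero:
  assumes "\<omega> \<in> dbar_exact lam \<Gamma> p q"
  shows "\<omega> \<in> dbar_closed lam \<Gamma> p q" "mean_form p q \<omega> = 0"
proof -
  have "\<exists>f. \<omega> = form_of lam p q f \<and> kz.cochain f \<and> form_of lam p (Suc q) (kz.diff f) = 0 \<and> (\<forall>C. mean (f C) = (\<lambda>x. 0))"
  proof (cases q)
    case 0
    then have "\<omega> = form_of lam p q (\<lambda>C x. 0)" using assms form_of_zero by (simp add: dbar_exact_def)
    then show ?thesis
      using cochain_zero mean_const[of 0] form_of_zero
      by (intro exI[of _ "\<lambda>C x. 0"]) (simp add: diff_zero)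
  next
    case (Suc q')
    then obtain g where g: "\<omega> = form_of lam p q (kz.diff g)" "kz.cochain g"
      using assms exact_cochain by blast
    then show ?thesis
      using kz.cochain_diff[OF g(2)] kz.diff_diff[OF g(2)] kz.A_diff[OF g(2)] form_of_zero
      by (intro exI[of _ "kz.diff g"]) simp
  qed
  then obtain f where f: "\<omega> = form_of lam p q f" "kz.cochain f" "form_of lam p (Suc q) (kz.diff f) = 0"
    "\<And>C. mean (f C) = (\<lambda>x. 0)" by blast
  show "\<omega> \<in> dbar_closed lam \<Gamma> p q" unfolding closed_cochain using f by blast
  show "mean_form p q \<omega> = 0" unfolding f(1) mean_form_of f(4) by (rule form_of_zero)
qed

text \<open>On closed forms \<open>mean_form\<close> is a projection onto B. Its kernel consists of
  the exact forms: the mean annihilates every conjugate \<open>zop\<close>, and conversely closed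
  cochains of mean zero are exact by the Koszul argument.\<close>

lemma dolbeault_iso:
  "linear_iso (dolbeault lam \<Gamma> p q) (+) (coset_scale (dbar_exact lam \<Gamma> p q))
     (B_space lam p q) (+) form_scale (\<lambda>X. mean_form p q (SOME v. v \<in> X))"
  unfolding dolbeault_def
proof (rule quotient_iso[where m = "mean_form p q"])
  let ?U = "dbar_exact lam \<Gamma> p q" and ?V = "dbar_closed lam \<Gamma> p q"
  have monodromy: "mean (\<lambda>x. f C x + g C x) = (\<lambda>x. mean (f C) x + mean (g C) x)" "mean (\<lambda>x. c * f C x) = (\<lambda>x. c * mean (f C) x)"
    if "kz.cochain f" "kz.cochain g" for f g C c
    using that unfolding kz.cochain_def by (intro linear_op_add[OF mean_linear] linear_op_cmult[OF mean_linear]; simp)+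
  show "?U \<subseteq> ?V" using exact_mean_zero by blast
  show "0 \<in> ?U"
  proof (cases q)
    case (Suc q')
    then show ?thesis using cochain_zero exact_cochain form_of_zero diff_zero by (metis (mono_tags, lifting) mem_Collect_eq)
  qed (simp add: dbar_exact_def)
  show "x + y \<in> ?U" if xy: "x \<in> ?U" "y \<in> ?U" for x y
  proof (cases q)
    case 0
    then show ?thesis using xy by (simp add: dbar_exact_def)
  next
    case (Suc q')
    then obtain f g where f: "x = form_of lam p q (kz.diff f)" "kz.cochain f" and g: "y = form_of lam p q (kz.diff g)" "kz.cochain g"
      using xy exact_cochain by blast
    have "x + y = form_of lam p q (kz.diff (\<lambda>C x. f C x + g C x))"
      unfolding f(1) g(1) form_of_add diff_add[OF f(2) g(2)] ..
    then show ?thesis using cochain_add[OF f(2) g(2)] Suc exact_cochain by blast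
  qed
  show "form_scale c x \<in> ?U" if x: "x \<in> ?U" for c x
  proof (cases q)
    case 0
    then show ?thesis using x by (simp add: dbar_exact_def form_scale_def fun_eq_iff)
  next
    case (Suc q')
    then obtain f where f: "x = form_of lam p q (kz.diff f)" "kz.cochain f" using x exact_cochain by blast
    have "form_scale c x = form_of lam p q (kz.diff (\<lambda>C x. c * f C x))"
      unfolding f(1) form_of_scale diff_scale[OF f(2)] ..
    then show ?thesis using cochain_scale[OF f(2)] Suc exact_cochain by blast
  qed
  have "x + y \<in> ?V \<and> mean_form p q (x + y) = mean_form p q x + mean_form p q y" if xy: "x \<in> ?V" "y \<in> ?V" for x y
  proof -
    obtain f g where f: "x = form_of lam p q f" "kz.cochain f" "form_of lam p (Suc q) (kz.diff f) = 0"
      and g: "y = form_of lam p q g" "kz.cochain g" "form_of lam p (Suc q) (kz.diff g) = 0"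
      using xy unfolding closed_cochain by blast
    have e: "x + y = form_of lam p q (\<lambda>C x. f C x + g C x)" unfolding f(1) g(1) form_of_add ..
    have "form_of lam p (Suc q) (kz.diff (\<lambda>C x. f C x + g C x)) = 0"
      unfolding diff_add[OF f(2) g(2)] form_of_add[symmetric] f(3) g(3) by simp
    moreover have "mean_form p q (x + y) = mean_form p q x + mean_form p q y"
      unfolding e unfolding f(1) g(1) mean_form_of form_of_add monodromy[OF f(2) g(2)] ..
    ultimately show ?thesis unfolding closed_cochain using e cochain_add[OF f(2) g(2)] by blast
  qed
  then show "\<And>x y. x \<in> ?V \<Longrightarrow> y \<in> ?V \<Longrightarrow> x + y \<in> ?V"
    "\<And>x y. x \<in> ?V \<Longrightarrow> y \<in> ?V \<Longrightarrow> mean_form p q (x + y) = mean_form p q x + mean_form p q y" by blast+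
  have "form_scale c x \<in> ?V \<and> mean_form p q (form_scale c x) = form_scale c (mean_form p q x)" if x: "x \<in> ?V" for c x
  proof -
    obtain f where f: "x = form_of lam p q f" "kz.cochain f" "form_of lam p (Suc q) (kz.diff f) = 0"
      using x unfolding closed_cochain by blast
    have e: "form_scale c x = form_of lam p q (\<lambda>C x. c * f C x)" unfolding f(1) form_of_scale ..
    have "form_of lam p (Suc q) (kz.diff (\<lambda>C x. c * f C x)) = 0"
      unfolding diff_scale[OF f(2)] form_of_scale[symmetric] f(3) by (simp add: form_scale_def fun_eq_iff)
    moreover have "mean_form p q (form_scale c x) = form_scale c (mean_form p q x)"
      unfolding e unfolding f(1) mean_form_of form_of_scale monodromy(2)[OF f(2) f(2)] ..
    ultimately show ?thesis unfolding closed_cochain using e cochain_scale[OF f(2)] by blast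
  qed
  then show "\<And>c x. x \<in> ?V \<Longrightarrow> form_scale c x \<in> ?V"
    "\<And>c x. x \<in> ?V \<Longrightarrow> mean_form p q (form_scale c x) = form_scale c (mean_form p q x)" by blast+
  show "mean_form p q x = 0 \<longleftrightarrow> x \<in> ?U" if x: "x \<in> ?V" for x
  proof
    assume m: "mean_form p q x = 0"
    obtain f where f: "x = form_of lam p q f" "kz.cochain f" "form_of lam p (Suc q) (kz.diff f) = 0"
      using x unfolding closed_cochain by blast
    show "x \<in> ?U" unfolding f(1)
      by (rule closed_mean_zero_exact[OF f(2,3)]) (use m in \<open>simp add: f(1) mean_form_of\<close>)
  qed (rule exact_mean_zero)
  show "mean_form p q x \<in> B_space lam p q" if "x \<in> ?V" for x
    unfolding B_space_eq mean_form_def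
    by (rule CollectI, rule exI[of _ "\<lambda>C. mean (\<lambda>y. cov_coeff C (x y) * inverse (twist lam C y)) 0"],
        rule conjI[OF refl TrueI])
  show "b \<in> ?V \<and> mean_form p q b = b" if b: "b \<in> B_space lam p q" for b
  proof -
    obtain c where c: "b = form_of lam p q (\<lambda>C x. c C)" using b unfolding B_space_eq by blast
    have "zop lam s (\<lambda>x. d) = (\<lambda>x. 0)" for s :: "('n, 'm) idx" and d
      by (simp add: fun_eq_iff zop_def wirtinger_def dd_const)
    then have "kz.diff (\<lambda>C x. c C) = (\<lambda>C x. 0)" by (simp add: fun_eq_iff kz.diff_def)
    then have "form_of lam p (Suc q) (kz.diff (\<lambda>C x. c C)) = 0" using form_of_zero by simp
    moreover have "kz.cochain (\<lambda>C x. c C)" using F_const by (simp add: kz.cochain_def)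
    ultimately have "b \<in> ?V" unfolding closed_cochain c by blast
    moreover have "mean_form p q b = b" unfolding c mean_form_of mean_const ..
    ultimately show ?thesis ..
  qed
qed

end

theorem proposition3p2:
  fixes M :: "int ^ ('m::finite \<times> bool) ^ ('m \<times> bool)"
    and P :: "real ^ ('m \<times> bool) ^ ('m \<times> bool)"
    and lam :: real
    and k :: "'n::finite \<times> bool \<Rightarrow> int"
    and mu :: "'n \<times> bool \<Rightarrow> real"
    and \<Gamma> :: "('n, 'm) grp set"
  assumes "det M = 1"
    and "invertible P"
    and "lam \<noteq> 0"
    and "P ** (\<chi> i j. of_int (M $ i $ j)) ** matrix_inv P =
         diagonal (\<lambda>j. if odd_index j then exp lam else exp (- lam))"
    and "\<And>i. k i \<noteq> 0"
    and "\<And>i. mu i = 2 * of_int (k i) * pi / lam"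
    and "\<Gamma> = Gamma_lattice mu P"
  shows "\<exists>\<Phi>. \<forall>p q.
    linear_iso (dolbeault lam \<Gamma> p q) (+) (coset_scale (dbar_exact lam \<Gamma> p q))
               (B_space lam p q :: ('n, 'm) grp form set) (+) form_scale (\<Phi> p q)"
proof -
  interpret solv_lattice M P lam k mu \<Gamma>
    by (rule solv_lattice.intro) (fact assms)+
  show ?thesis
    by (rule exI[of _ "\<lambda>p q X. mean_form p q (SOME v. v \<in> X)"]) (intro allI dolbeault_iso)
qed

end
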